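(* Let $p:(\widetilde{\mathbb{T}},\ast)\to(\mathbb{T},\ast)$ be the universal object in the category of fibrations with unique path lifting and path-connected total space over $\mathbb{T}$. Then $\widetilde{\mathbb{T}}$ is simply connected, although the Spanier group $\pi^s(\mathbb{T},\ast)$ is uncountable.
   Context: For each $m\in\mathbb{N}=\{1,2,3,\dots\}$ let $C_m\subseteq\mathbb{R}^2$ be the circle of radius $\frac1m$ centered at $(\frac1m,0)$; let $\mathbb{E}=\bigcup_{m\in\mathbb{N}}C_m\subseteq\mathbb{R}^2$ (subspace topology) with basepoint $\ast=(0,0)$. Let $\ell_m:[0,1]\to C_m$ be the loop $\ell_m(t)=\left(\frac1m(1-\cos 2\pi t),\frac1m\sin 2\pi t\right)$. Let $f:\mathbb{E}\to\mathbb{E}$ be the unique continuous map with $f\circ\ell_m=\ell_{m+1}$ for all $m\in\mathbb{N}$. Let $\mathbb{T}$ be the mapping torus of $f$, i.e. the quotient space $\mathbb{E}\times[0,1]/\sim$ with $(x,1)\sim(f(x),0)$ for all $x\in\mathbb{E}$, and let $h:\mathbb{E}\times[0,1]\to\mathbb{T}$ be the quotient map. The basepoint of $\mathbb{T}$ is $\ast=h(\ast,0)$. "Fibration" means Hurewicz fibration. A map $p:Y\to X$ has unique path lifting if any two paths $\omega,\omega'$ in $Y$ with $\omega(0)=\omega'(0)$ and $p\circ\omega=p\circ\omega'$ are equal. In the category of (pointed) fibrations with unique path lifting and path-connected total space over $(X,x)$, a morphism from $p:(Y,y)\to(X,x)$ to $p':(Y',y')\to(X,x)$ is a continuous map $g:(Y,y)\to(Y',y')$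 with $p'\circ g=p$. The universal object is an object $p:(\widetilde{X},\widetilde{x})\to(X,x)$ of this category admitting a morphism to every object; it exists for every path-connected $X$ (as shown in Spanier's textbook Algebraic Topology: choose an indexed set $\{r_a:(Z_a,z_a)\to(X,x)\mid a\in A\}$ containing one representative of each isomorphism class of objects of this category, let $\widetilde{X}$ be the path component of the point $\widetilde{x}=(z_a)_{a\in A}$ in the fibered product $\{(w_a)_{a\in A}\in\prod_{a\in A}Z_a\mid r_a(w_a)=r_b(w_b)\text{ for all }a,b\in A\}$, and put $p((w_a)_{a\in A})=r_a(w_a)$ for any $a\in A$) and is unique up to isomorphism. Spanier group: for a space $X$ with $x\in X$ and an open cover $\mathcal{U}$ of $X$, let $\pi(\mathcal{U},x)$ be the subgroup of $\pi_1(X,x)$ generated by all elements $[\gamma\cdot\delta\cdot\gamma^-]$ where $\gamma:[0,1]\to X$ is a path with $\gamma(0)=x$, $\gamma^-(t)=\gamma(1-t)$, and $\delta$ is a loop based at $\gamma(1)$ whose image lies in some $U\in\mathcal{U}$. The Spanier group is $\pi^s(X,x)=\bigcap_{\mathcal{U}}\pi(\mathcal{U},x)$, the intersection over all open covers $\mathcal{U}$ of $X$. *)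

theory Defs
  imports "HOL-Analysis.Analysis" "HOL-Algebra.Generated_Groups"
begin

section \<open>Quotient topology and mapping torus\<close>

definition quotient_topology :: "'a topology \<Rightarrow> ('a \<Rightarrow> 'b) \<Rightarrow> 'b topology" where
  "quotient_topology X q =
     topology (\<lambda>U. U \<subseteq> q ` topspace X \<and> openin X {x \<in> topspace X. q x \<in> U})"

lemma openin_quotient_topology:
  "openin (quotient_topology X q) U \<longleftrightarrow>
     U \<subseteq> q ` topspace X \<and> openin X {x \<in> topspace X. q x \<in> U}"
proof -
  have "istopology (\<lambda>U. U \<subseteq> q ` topspace X \<and> openin X {x \<in> topspace X. q x \<in> U})"
    unfolding istopology_def
  proof (intro conjI allI impI)
    fix S T
    assume S: "S \<subseteq> q ` topspace X \<and> openin X {x \<in> topspace X. q x \<in> S}"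
      and T: "T \<subseteq> q ` topspace X \<and> openin X {x \<in> topspace X. q x \<in> T}"
    have "{x \<in> topspace X. q x \<in> S \<inter> T}
        = {x \<in> topspace X. q x \<in> S} \<inter> {x \<in> topspace X. q x \<in> T}"
      by auto
    then show "openin X {x \<in> topspace X. q x \<in> S \<inter> T}"
      using S T by (simp add: openin_Int)
    show "S \<inter> T \<subseteq> q ` topspace X"
      using S by auto
  next
    fix \<K> assume K: "\<forall>K\<in>\<K>. K \<subseteq> q ` topspace X \<and> openin X {x \<in> topspace X. q x \<in> K}"
    have "{x \<in> topspace X. q x \<in> \<Union>\<K>} = (\<Union>K\<in>\<K>. {x \<in> topspace X. q x \<in> K})"
      by auto
    then show "openin X {x \<in> topspace X. q x \<in> \<Union>\<K>}"
      using K by auto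
    show "\<Union>\<K> \<subseteq> q ` topspace X"
      using K by auto
  qed
  then show ?thesis
    by (simp add: quotient_topology_def)
qed

lemma topspace_quotient_topology [simp]: "topspace (quotient_topology X q) = q ` topspace X"
proof (rule antisym)
  show "topspace (quotient_topology X q) \<subseteq> q ` topspace X"
    using openin_quotient_topology by (metis openin_topspace)
  have "{x \<in> topspace X. q x \<in> q ` topspace X} = topspace X" by auto
  then have "openin (quotient_topology X q) (q ` topspace X)"
    by (simp add: openin_quotient_topology)
  then show "q ` topspace X \<subseteq> topspace (quotient_topology X q)"
    by (rule openin_subset)
qed

lemma quotient_map_quotient_topology: "quotient_map X (quotient_topology X q) q"
  by (simp add: quotient_map_def openin_quotient_topology)

definition torus_proj :: "'a topology \<Rightarrow> ('a \<Rightarrow> 'a) \<Rightarrow> 'a \<times> real \<Rightarrow> ('a \<times> real) set" where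
  "torus_proj X f a =
     {b \<in> topspace X \<times> {0..1}. equivclp (\<lambda>c d. \<exists>x\<in>topspace X. c = (x, 1) \<and> d = (f x, 0)) a b}"

definition mapping_torus :: "'a topology \<Rightarrow> ('a \<Rightarrow> 'a) \<Rightarrow> ('a \<times> real) set topology" where
  "mapping_torus X f =
     quotient_topology (prod_topology X (top_of_set {0..1})) (torus_proj X f)"


section \<open>The Hawaiian earring and the mapping torus of its shift\<close>

definition earring :: "(real \<times> real) set" where
  "earring = (\<Union>m\<in>{1::nat..}. sphere (1 / real m, 0) (1 / real m))"

definition earring_loop :: "nat \<Rightarrow> real \<Rightarrow> real \<times> real" where
  "earring_loop m t = ((1 - cos (2 * pi * t)) / real m, sin (2 * pi * t) / real m)"

text \<open>Membership in \<^const>\<open>extensional\<close> fixes the irrelevant values outside the earring, so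
  that the description is a unique one (see \<open>earring_shift_ex1\<close> below).\<close>

definition earring_shift :: "real \<times> real \<Rightarrow> real \<times> real" where
  "earring_shift = (THE f. f \<in> extensional earring \<and>
     continuous_map (top_of_set earring) (top_of_set earring) f \<and>
     (\<forall>m\<ge>1. \<forall>t\<in>{0..1}. f (earring_loop m t) = earring_loop (m + 1) t))"

definition earring_torus :: "((real \<times> real) \<times> real) set topology" where
  "earring_torus = mapping_torus (top_of_set earring) earring_shift"

definition earring_torus_base :: "((real \<times> real) \<times> real) set" where
  "earring_torus_base = torus_proj (top_of_set earring) earring_shift ((0, 0), 0)"

lemma earring_eq: "earring = (\<Union>m\<in>{1::nat..}. earring_loop m ` {0..1})"
proof -
  have "sphere (1 / real m, 0) (1 / real m) = earring_loop m ` {0..1}" if m: "m \<ge> 1" for m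
  proof (intro Set.set_eqI iffI)
    fix v :: "real \<times> real" assume v: "v \<in> sphere (1 / real m, 0) (1 / real m)"
    obtain a b where ab: "v = (a, b)" by fastforce
    have "(1 / real m - a)\<^sup>2 + b\<^sup>2 = (1 / real m)\<^sup>2"
    proof -
      have "sqrt ((1 / real m - a)\<^sup>2 + b\<^sup>2) = 1 / real m"
        using v by (simp add: ab dist_Pair_Pair dist_real_def)
      then show ?thesis
        by (metis real_sqrt_ge_0_iff real_sqrt_pow2 sum_power2_ge_zero)
    qed
    then have "(1 - real m * a)\<^sup>2 + (real m * b)\<^sup>2 = 1"
      using m by (simp add: power2_eq_square field_simps)
    then obtain s where s: "0 \<le> s" "s < 2 * pi" "1 - real m * a = cos s" "real m * b = sin s"
      using sincos_total_2pi by metis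
    have "v = earring_loop m (s / (2 * pi))"
      using s m by (simp add: ab earring_loop_def field_simps)
    moreover have "s / (2 * pi) \<in> {0..1}"
      using s by (simp add: field_simps)
    ultimately show "v \<in> earring_loop m ` {0..1}" by blast
  next
    fix v assume "v \<in> earring_loop m ` {0..1}"
    then obtain t where v: "v = earring_loop m t" by blast
    have "(1 / real m - (1 - cos (2 * pi * t)) / real m)\<^sup>2 + (sin (2 * pi * t) / real m)\<^sup>2
        = (cos (2 * pi * t) / real m)\<^sup>2 + (sin (2 * pi * t) / real m)\<^sup>2"
      by (simp add: diff_divide_distrib)
    also have "\<dots> = (1 / real m)\<^sup>2"
      by (simp add: power_divide flip: add_divide_distrib)
    finally show "v \<in> sphere (1 / real m, 0) (1 / real m)"
      by (simp add: v earring_loop_def dist_Pair_Pair dist_real_def del: abs_divide)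
  qed
  then show ?thesis
    by (simp add: earring_def)
qed

lemma earring_iff: "v \<in> earring \<longleftrightarrow> (\<exists>m\<ge>1. \<exists>t\<in>{0..1}. v = earring_loop m t)"
  unfolding earring_eq by auto

lemma earring_shift_ex1:
  "\<exists>!f. f \<in> extensional earring \<and>
     continuous_map (top_of_set earring) (top_of_set earring) f \<and>
     (\<forall>m\<ge>1. \<forall>t\<in>{0..1}. f (earring_loop m t) = earring_loop (m + 1) t)"
proof (rule ex_ex1I)
  text \<open>On the circle of radius \<open>1 / m\<close> one has \<open>m = 2 * a / (a\<^sup>2 + b\<^sup>2)\<close> away from the origin.\<close>
  define c where "c = (\<lambda>v :: real \<times> real. 2 * fst v / (2 * fst v + (fst v)\<^sup>2 + (snd v)\<^sup>2))"
  define f where "f = restrict (\<lambda>v. c v *\<^sub>R v) earring"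
  have loop_in: "earring_loop m t \<in> earring" if "m \<ge> 1" "t \<in> {0..1}" for m t
    using that unfolding earring_iff by blast
  have f_loop: "f (earring_loop m t) = earring_loop (m + 1) t" if m: "m \<ge> 1" and t: "t \<in> {0..1}" for m t
  proof (cases "cos (2 * pi * t) = 1")
    case True
    then have "sin (2 * pi * t) = 0"
      by (simp add: cos_one_sin_zero)
    then show ?thesis
      using True loop_in[OF m t] by (simp add: f_def earring_loop_def zero_prod_def)
  next
    case False
    define C where "C = cos (2 * pi * t)"
    define S where "S = sin (2 * pi * t)"
    have SC: "S\<^sup>2 + C\<^sup>2 = 1" by (simp add: S_def C_def)
    have C: "C < 1" using False cos_le_one[of "2 * pi * t"] by (simp add: C_def less_le)
    have "((1 - C) / real m)\<^sup>2 + (S / real m)\<^sup>2 = 2 * (1 - C) / (real m)\<^sup>2"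
      using SC by (simp add: power_divide power2_diff flip: add_divide_distrib)
    then have "c (earring_loop m t) = 2 * ((1 - C) / m) / (2 * ((1 - C) / m) + 2 * (1 - C) / (real m)\<^sup>2)"
      by (simp add: c_def earring_loop_def add.assoc flip: C_def S_def)
    also have "\<dots> = real m / (real m + 1)"
    proof -
      have "2 * ((1 - C) / m) + 2 * (1 - C) / (real m)\<^sup>2 = 2 * ((1 - C) / m) * ((real m + 1) / m)"
        using m by (simp add: field_simps power2_eq_square)
      then show ?thesis using m C by simp
    qed
    finally have "c (earring_loop m t) = real m / (real m + 1)" .
    then show ?thesis
      using loop_in[OF m t] m by (simp add: f_def earring_loop_def add.commute)
  qed
  have f_in: "f v \<in> earring" if v: "v \<in> earring" for v
  proof -
    obtain m t where mt: "m \<ge> 1" "t \<in> {0..1}" "v = earring_loop m t"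
      using v unfolding earring_iff by blast
    then show ?thesis
      using loop_in[of "m + 1" t] by (simp add: f_loop)
  qed
  have nonneg: "fst v \<ge> 0" and zero: "fst v = 0 \<Longrightarrow> v = 0" if v: "v \<in> earring" for v
  proof -
    obtain m t where mt: "m \<ge> 1" "t \<in> {0..1}" "v = earring_loop m t"
      using v unfolding earring_iff by blast
    show "fst v \<ge> 0"
      by (simp add: mt earring_loop_def)
    show "fst v = 0 \<Longrightarrow> v = 0"
      using mt by (auto simp: earring_loop_def zero_prod_def cos_one_sin_zero)
  qed
  have cont: "continuous_on earring (\<lambda>v. c v *\<^sub>R v)"
    unfolding continuous_on_eq_continuous_within
  proof
    fix v assume v: "v \<in> earring"
    show "continuous (at v within earring) (\<lambda>v. c v *\<^sub>R v)"
    proof (cases "v = 0")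
      case True
      have "norm (c w *\<^sub>R w) \<le> norm w" if "w \<in> earring" for w
      proof -
        have "0 \<le> c w" "c w \<le> 1"
          using nonneg[OF that] by (simp_all add: c_def divide_le_eq)
        then show ?thesis by (simp add: mult_left_le_one_le)
      qed
      then have "\<forall>\<^sub>F w in at 0 within earring. norm (c w *\<^sub>R w) \<le> norm w"
        unfolding eventually_at_filter by (intro always_eventually) blast
      moreover have "(norm \<longlongrightarrow> 0) (at (0 :: real \<times> real) within earring)"
        using tendsto_norm[OF tendsto_ident_at[of "0 :: real \<times> real" earring]] by simp
      ultimately have "((\<lambda>v. c v *\<^sub>R v) \<longlongrightarrow> 0) (at 0 within earring)"
        by (rule Lim_null_comparison)
      then show ?thesis
        by (simp add: True continuous_within)
    next
      case False
      then have "fst v > 0" using nonneg[OF v] zero[OF v] by force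
      then have "2 * fst v + (fst v)\<^sup>2 + (snd v)\<^sup>2 > 0"
        by (meson add_pos_nonneg add_pos_pos mult_pos_pos zero_le_power2 zero_less_numeral)
      then have "2 * fst v + (fst v)\<^sup>2 + (snd v)\<^sup>2 \<noteq> 0" by simp
      then show ?thesis
        unfolding c_def by (intro continuous_intros) auto
    qed
  qed
  have "continuous_map (top_of_set earring) (top_of_set earring) f"
  proof -
    have "continuous_on earring f"
      using cont by (rule continuous_on_eq) (simp add: f_def)
    then show ?thesis
      using f_in by (auto simp: continuous_map_in_subtopology)
  qed
  then show "\<exists>f. f \<in> extensional earring \<and>
     continuous_map (top_of_set earring) (top_of_set earring) f \<and>
     (\<forall>m\<ge>1. \<forall>t\<in>{0..1}. f (earring_loop m t) = earring_loop (m + 1) t)"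
    using f_loop by (intro exI[of _ f]) (auto simp: f_def)
next
  fix f g
  assume f: "f \<in> extensional earring \<and>
     continuous_map (top_of_set earring) (top_of_set earring) f \<and>
     (\<forall>m\<ge>1. \<forall>t\<in>{0..1}. f (earring_loop m t) = earring_loop (m + 1) t)"
    and g: "g \<in> extensional earring \<and>
     continuous_map (top_of_set earring) (top_of_set earring) g \<and>
     (\<forall>m\<ge>1. \<forall>t\<in>{0..1}. g (earring_loop m t) = earring_loop (m + 1) t)"
  show "f = g"
  proof (rule extensionalityI)
    fix v assume "v \<in> earring"
    then obtain m t where "m \<ge> 1" "t \<in> {0..1}" "v = earring_loop m t"
      unfolding earring_iff by blast
    then show "f v = g v" using f g by simp
  qed (use f g in auto)
qed


section \<open>Fundamental group and Spanier group\<close>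

definition path_join :: "(real \<Rightarrow> 'a) \<Rightarrow> (real \<Rightarrow> 'a) \<Rightarrow> real \<Rightarrow> 'a" where
  "path_join g h t = (if t \<le> 1/2 then g (2 * t) else h (2 * t - 1))"

definition path_reverse :: "(real \<Rightarrow> 'a) \<Rightarrow> real \<Rightarrow> 'a" where
  "path_reverse g t = g (1 - t)"

definition loop_at :: "'a topology \<Rightarrow> 'a \<Rightarrow> (real \<Rightarrow> 'a) \<Rightarrow> bool" where
  "loop_at X x g \<longleftrightarrow> pathin X g \<and> g 0 = x \<and> g 1 = x"

definition loop_class :: "'a topology \<Rightarrow> 'a \<Rightarrow> (real \<Rightarrow> 'a) \<Rightarrow> (real \<Rightarrow> 'a) set" where
  "loop_class X x g =
     {h. loop_at X x h \<and> homotopic_with (\<lambda>k. k 0 = x \<and> k 1 = x) (top_of_set {0..1}) X g h}"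

text \<open>The product of two classes is the union of the classes of all products of representatives;
  these classes all coincide, which avoids a choice of representatives.\<close>

definition fundamental_group :: "'a topology \<Rightarrow> 'a \<Rightarrow> (real \<Rightarrow> 'a) set monoid" where
  "fundamental_group X x =
     \<lparr>carrier = {loop_class X x g | g. loop_at X x g},
      mult = (\<lambda>A B. \<Union>g\<in>A. \<Union>h\<in>B. loop_class X x (path_join g h)),
      one = loop_class X x (\<lambda>_. x)\<rparr>"

definition simply_connected_space :: "'a topology \<Rightarrow> bool" where
  "simply_connected_space X \<longleftrightarrow>
     path_connected_space X \<and>
     (\<forall>x\<in>topspace X. carrier (fundamental_group X x) = {\<one>\<^bsub>fundamental_group X x\<^esub>})"

definition open_cover :: "'a topology \<Rightarrow> 'a set set \<Rightarrow> bool" where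
  "open_cover X \<U> \<longleftrightarrow> (\<forall>U\<in>\<U>. openin X U) \<and> \<Union>\<U> = topspace X"

definition spanier_subgroup ::
    "'a topology \<Rightarrow> 'a \<Rightarrow> 'a set set \<Rightarrow> (real \<Rightarrow> 'a) set set" where
  "spanier_subgroup X x \<U> = generate (fundamental_group X x)
     {loop_class X x (path_join (path_join \<gamma> \<delta>) (path_reverse \<gamma>)) | \<gamma> \<delta>.
        pathin X \<gamma> \<and> \<gamma> 0 = x \<and> loop_at X (\<gamma> 1) \<delta> \<and> (\<exists>U\<in>\<U>. \<delta> ` {0..1} \<subseteq> U)}"

definition spanier_group :: "'a topology \<Rightarrow> 'a \<Rightarrow> (real \<Rightarrow> 'a) set set" where
  "spanier_group X x = (\<Inter>\<U>\<in>{\<U>. open_cover X \<U>}. spanier_subgroup X x \<U>)"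


section \<open>Fibrations with unique path lifting\<close>

definition homotopy_lifting ::
    "'w topology \<Rightarrow> 'y topology \<Rightarrow> 'x topology \<Rightarrow> ('y \<Rightarrow> 'x) \<Rightarrow> bool" where
  "homotopy_lifting W Y X p \<longleftrightarrow>
     (\<forall>g H. continuous_map W Y g \<and>
            continuous_map (prod_topology W (top_of_set {0..1::real})) X H \<and>
            (\<forall>w\<in>topspace W. H (w, 0) = p (g w)) \<longrightarrow>
            (\<exists>K. continuous_map (prod_topology W (top_of_set {0..1::real})) Y K \<and>
                 (\<forall>w\<in>topspace W. K (w, 0) = g w) \<and>
                 (\<forall>w\<in>topspace W. \<forall>t\<in>{0..1}. p (K (w, t)) = H (w, t))))"

text \<open>A definition cannot quantify over all types, so the test spaces range over the topologies
  on one type that is large enough: by \<open>hurewicz_fibration_lifting\<close> below, homotopies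
  then lift for test spaces over any type.\<close>

definition hurewicz_fibration :: "'y topology \<Rightarrow> 'x topology \<Rightarrow> ('y \<Rightarrow> 'x) \<Rightarrow> bool" where
  "hurewicz_fibration Y X p \<longleftrightarrow>
     continuous_map Y X p \<and>
     (\<forall>W :: ('y \<times> (real \<Rightarrow> 'x)) topology. homotopy_lifting W Y X p)"

definition unique_path_lifting :: "'y topology \<Rightarrow> ('y \<Rightarrow> 'x) \<Rightarrow> bool" where
  "unique_path_lifting Y p \<longleftrightarrow>
     (\<forall>\<omega> \<omega>'. pathin Y \<omega> \<and> pathin Y \<omega>' \<and> \<omega> 0 = \<omega>' 0 \<and> (\<forall>t\<in>{0..1}. p (\<omega> t) = p (\<omega>' t)) \<longrightarrow>
             (\<forall>t\<in>{0..1}. \<omega> t = \<omega>' t))"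

definition upl_object ::
    "'x topology \<Rightarrow> 'x \<Rightarrow> 'y topology \<Rightarrow> 'y \<Rightarrow> ('y \<Rightarrow> 'x) \<Rightarrow> bool" where
  "upl_object X x Y y p \<longleftrightarrow>
     hurewicz_fibration Y X p \<and> unique_path_lifting Y p \<and> path_connected_space Y \<and>
     y \<in> topspace Y \<and> p y = x"

definition upl_morphism ::
    "'y topology \<Rightarrow> 'y \<Rightarrow> ('y \<Rightarrow> 'x) \<Rightarrow> 'z topology \<Rightarrow> 'z \<Rightarrow> ('z \<Rightarrow> 'x) \<Rightarrow> ('y \<Rightarrow> 'z) \<Rightarrow> bool" where
  "upl_morphism Y y p Z z q g \<longleftrightarrow>
     continuous_map Y Z g \<and> g y = z \<and> (\<forall>v\<in>topspace Y. q (g v) = p v)"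

text \<open>Again one large type suffices: a point in the total space of an object is determined by the
  projection of any path leading to it from the basepoint, so that every object is isomorphic to
  one carried by \<^typ>\<open>real \<Rightarrow> 'x\<close>. By \<open>universal_upl_object_morphism\<close> below, a universal object
  admits morphisms to objects over any type, and \<open>universal_upl_object_exists\<close> provides one.\<close>

definition universal_upl_object ::
    "'x topology \<Rightarrow> 'x \<Rightarrow> 'y topology \<Rightarrow> 'y \<Rightarrow> ('y \<Rightarrow> 'x) \<Rightarrow> bool" where
  "universal_upl_object X x Y y p \<longleftrightarrow>
     upl_object X x Y y p \<and>
     (\<forall>(Z :: (real \<Rightarrow> 'x) topology) z q.
        upl_object X x Z z q \<longrightarrow> (\<exists>g. upl_morphism Y y p Z z q g))"

lemma hurewicz_fibration_lifting:
  fixes W :: "'w topology" and Y :: "'y topology" and X :: "'x topology"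
  assumes fib: "hurewicz_fibration Y X p"
  shows "homotopy_lifting W Y X p"
  unfolding homotopy_lifting_def
proof (intro allI impI, elim conjE)
  fix g H
  let ?I = "top_of_set {0..1::real}"
  assume g: "continuous_map W Y g" and H: "continuous_map (prod_topology W ?I) X H"
    and Hg: "\<forall>w\<in>topspace W. H (w, 0) = p (g w)"
  define \<phi> where "\<phi> = (\<lambda>w. (g w, restrict (\<lambda>t. H (w, t)) {0..1}))"
  define V where "V = quotient_topology W \<phi>"
  have V: "quotient_map W V \<phi>"
    unfolding V_def by (rule quotient_map_quotient_topology)
  have VI: "quotient_map (prod_topology W ?I) (prod_topology V ?I) (\<lambda>(w, t). (\<phi> w, t))"
  proof (rule quotient_map_prod_left[OF _ _ V])
    show "locally_compact_space ?I"
      by (simp add: compact_imp_locally_compact_space compact_space_subtopology)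
    show "Hausdorff_space ?I \<or> regular_space ?I"
      by (simp add: Hausdorff_space_subtopology)
  qed
  have "continuous_map V Y fst"
    using g by (intro continuous_compose_quotient_map[OF V]) (simp add: \<phi>_def o_def)
  moreover have "continuous_map (prod_topology V ?I) X (\<lambda>(v, t). snd v t)"
  proof (rule continuous_compose_quotient_map[OF VI])
    show "continuous_map (prod_topology W ?I) X ((\<lambda>(v, t). snd v t) \<circ> (\<lambda>(w, t). (\<phi> w, t)))"
      by (rule continuous_map_eq[OF H]) (auto simp: \<phi>_def)
  qed
  moreover have "\<forall>v\<in>topspace V. (case (v, 0) of (v, t) \<Rightarrow> snd v t) = p (fst v)"
    using Hg by (auto simp: V_def \<phi>_def)
  moreover have "homotopy_lifting V Y X p"
    using fib by (simp add: hurewicz_fibration_def)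
  ultimately have "\<exists>K. continuous_map (prod_topology V ?I) Y K \<and>
      (\<forall>v\<in>topspace V. K (v, 0) = fst v) \<and>
      (\<forall>v\<in>topspace V. \<forall>t\<in>{0..1}. p (K (v, t)) = (case (v, t) of (v, t) \<Rightarrow> snd v t))"
    unfolding homotopy_lifting_def by blast
  then obtain K where K: "continuous_map (prod_topology V ?I) Y K"
    "\<forall>v\<in>topspace V. K (v, 0) = fst v"
    "\<forall>v\<in>topspace V. \<forall>t\<in>{0..1}. p (K (v, t)) = snd v t"
    by auto
  have "continuous_map (prod_topology W ?I) Y (K \<circ> (\<lambda>(w, t). (\<phi> w, t)))"
    using quotient_imp_continuous_map[OF VI] K(1) by (rule continuous_map_compose)
  moreover have "\<phi> w \<in> topspace V" if "w \<in> topspace W" for w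
    using that by (auto simp: V_def)
  ultimately show "\<exists>K. continuous_map (prod_topology W ?I) Y K \<and>
     (\<forall>w\<in>topspace W. K (w, 0) = g w) \<and>
     (\<forall>w\<in>topspace W. \<forall>t\<in>{0..1}. p (K (w, t)) = H (w, t))"
    using K(2,3) by (intro exI[of _ "K \<circ> (\<lambda>(w, t). (\<phi> w, t))"]) (auto simp: \<phi>_def)
qed

lemma upl_object_homeomorphic:
  fixes X :: "'x topology" and Z :: "'z topology" and Z' :: "'u topology"
  assumes Z: "upl_object X x Z z q" and hom: "homeomorphic_maps Z Z' e e'"
  shows "upl_object X x Z' (e z) (q \<circ> e')"
proof -
  have e: "continuous_map Z Z' e" and e': "continuous_map Z' Z e'"
    and e'e: "\<And>v. v \<in> topspace Z \<Longrightarrow> e' (e v) = v" and ee': "\<And>v. v \<in> topspace Z' \<Longrightarrow> e (e' v) = v"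
    using hom by (auto simp: homeomorphic_maps_def)
  have q: "continuous_map Z X q" and fib: "hurewicz_fibration Z X q"
    and upl: "unique_path_lifting Z q" and z: "z \<in> topspace Z" "q z = x"
    using Z by (auto simp: upl_object_def hurewicz_fibration_def)
  have "homotopy_lifting W Z' X (q \<circ> e')" for W :: "('u \<times> (real \<Rightarrow> 'x)) topology"
    unfolding homotopy_lifting_def
  proof (intro allI impI, elim conjE)
    fix g H
    let ?I = "top_of_set {0..1::real}"
    assume g: "continuous_map W Z' g" and H: "continuous_map (prod_topology W ?I) X H"
      and Hg: "\<forall>w\<in>topspace W. H (w, 0) = (q \<circ> e') (g w)"
    have "continuous_map W Z (e' \<circ> g)"
      using g e' by (rule continuous_map_compose)
    moreover have "\<forall>w\<in>topspace W. H (w, 0) = q ((e' \<circ> g) w)"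
      using Hg by simp
    ultimately have "\<exists>K. continuous_map (prod_topology W ?I) Z K \<and>
        (\<forall>w\<in>topspace W. K (w, 0) = (e' \<circ> g) w) \<and>
        (\<forall>w\<in>topspace W. \<forall>t\<in>{0..1}. q (K (w, t)) = H (w, t))"
      using hurewicz_fibration_lifting[OF fib, of W] H unfolding homotopy_lifting_def by blast
    then obtain K where K: "continuous_map (prod_topology W ?I) Z K"
      "\<forall>w\<in>topspace W. K (w, 0) = e' (g w)"
      "\<forall>w\<in>topspace W. \<forall>t\<in>{0..1}. q (K (w, t)) = H (w, t)"
      by auto
    have "K (w, t) \<in> topspace Z" if "w \<in> topspace W" "t \<in> {0..1}" for w t
      using continuous_map_image_subset_topspace[OF K(1)] that by auto
    moreover have "g w \<in> topspace Z'" if "w \<in> topspace W" for w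
      using continuous_map_image_subset_topspace[OF g] that by auto
    moreover have "continuous_map (prod_topology W ?I) Z' (e \<circ> K)"
      using K(1) e by (rule continuous_map_compose)
    ultimately show "\<exists>K. continuous_map (prod_topology W ?I) Z' K \<and>
       (\<forall>w\<in>topspace W. K (w, 0) = g w) \<and>
       (\<forall>w\<in>topspace W. \<forall>t\<in>{0..1}. (q \<circ> e') (K (w, t)) = H (w, t))"
      using K(2,3) e'e ee' by (intro exI[of _ "e \<circ> K"]) auto
  qed
  then have "hurewicz_fibration Z' X (q \<circ> e')"
    using q e' by (simp add: hurewicz_fibration_def continuous_map_compose)
  moreover have "unique_path_lifting Z' (q \<circ> e')"
    unfolding unique_path_lifting_def
  proof (intro allI impI ballI, elim conjE)
    fix \<omega> \<omega>' :: "real \<Rightarrow> 'u" and t :: real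
    assume w: "pathin Z' \<omega>" "pathin Z' \<omega>'" "\<omega> 0 = \<omega>' 0"
      "\<forall>t\<in>{0..1}. (q \<circ> e') (\<omega> t) = (q \<circ> e') (\<omega>' t)" and t: "t \<in> {0..1}"
    have "pathin Z (e' \<circ> \<omega>)" "pathin Z (e' \<circ> \<omega>')"
      using pathin_compose[OF w(1) e'] pathin_compose[OF w(2) e'] by simp_all
    moreover have "(e' \<circ> \<omega>) 0 = (e' \<circ> \<omega>') 0"
      "\<forall>s\<in>{0..1}. q ((e' \<circ> \<omega>) s) = q ((e' \<circ> \<omega>') s)"
      using w(3,4) by simp_all
    ultimately have "(e' \<circ> \<omega>) t = (e' \<circ> \<omega>') t"
      using upl t unfolding unique_path_lifting_def by blast
    then have "e (e' (\<omega> t)) = e (e' (\<omega>' t))"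
      by simp
    moreover have "\<omega> t \<in> topspace Z'" "\<omega>' t \<in> topspace Z'"
      using path_image_subset_topspace[OF w(1)] path_image_subset_topspace[OF w(2)] t by auto
    ultimately show "\<omega> t = \<omega>' t"
      by (simp only: ee')
  qed
  moreover have "path_connected_space Z'"
    using Z homeomorphic_path_connected_space[OF homeomorphic_maps_imp_homeomorphic_space[OF hom]]
    by (simp add: upl_object_def)
  moreover have "e z \<in> topspace Z'"
    using continuous_map_image_subset_topspace[OF e] z by auto
  ultimately show ?thesis
    using z e'e by (simp add: upl_object_def)
qed

lemma universal_upl_object_morphism:
  fixes X :: "'x topology" and Z :: "'z topology"
  assumes univ: "universal_upl_object X x Y y p" and Z: "upl_object X x Z z q"
  shows "\<exists>g. upl_morphism Y y p Z z q g"
proof -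
  have pc: "path_connected_space Z" and z: "z \<in> topspace Z" and upl: "unique_path_lifting Z q"
    using Z by (auto simp: upl_object_def)
  have "\<exists>\<alpha>. pathin Z \<alpha> \<and> \<alpha> 0 = z \<and> \<alpha> 1 = v" if "v \<in> topspace Z" for v
    using pc z that unfolding path_connected_space_def by blast
  then obtain \<alpha> where \<alpha>: "\<And>v. v \<in> topspace Z \<Longrightarrow> pathin Z (\<alpha> v) \<and> \<alpha> v 0 = z \<and> \<alpha> v 1 = v"
    by metis
  define e where "e = (\<lambda>v. restrict (\<lambda>t. q (\<alpha> v t)) {0..1})"
  have inj: "inj_on e (topspace Z)"
  proof (rule inj_onI)
    fix v w assume vw: "v \<in> topspace Z" "w \<in> topspace Z" and eq: "e v = e w"
    have "q (\<alpha> v t) = q (\<alpha> w t)" if "t \<in> {0..1}" for t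
      using fun_cong[OF eq, of t] that by (simp add: e_def)
    moreover have "(1::real) \<in> {0..1}" by simp
    ultimately have "\<alpha> v 1 = \<alpha> w 1"
      using upl \<alpha>[OF vw(1)] \<alpha>[OF vw(2)] unfolding unique_path_lifting_def by metis
    then show "v = w" using \<alpha> vw by auto
  qed
  define Z' where "Z' = quotient_topology Z e"
  have "homeomorphic_map Z Z' e"
    unfolding homeomorphic_map_def Z'_def using inj quotient_map_quotient_topology by blast
  then obtain e' where hom: "homeomorphic_maps Z Z' e e'"
    by (auto simp: homeomorphic_map_maps)
  have "upl_object X x Z' (e z) (q \<circ> e')"
    using Z hom by (rule upl_object_homeomorphic)
  then obtain g where g: "upl_morphism Y y p Z' (e z) (q \<circ> e') g"
    using univ unfolding universal_upl_object_def by blast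
  have "continuous_map Z' Z e'" "e' (e z) = z"
    using hom z by (auto simp: homeomorphic_maps_def)
  then have "upl_morphism Y y p Z z q (e' \<circ> g)"
    using g by (auto simp: upl_morphism_def intro: continuous_map_compose)
  then show ?thesis by blast
qed

text \<open>Spanier's construction, with all objects over one type instead of representatives of the
  isomorphism classes: the path component of the basepoint in their fibered product.\<close>

lemma universal_upl_object_exists:
  fixes X :: "'x topology"
  assumes pcX: "path_connected_space X" and x: "x \<in> topspace X"
  shows "\<exists>(Y :: ((real \<Rightarrow> 'x) topology \<times> (real \<Rightarrow> 'x) \<times> ((real \<Rightarrow> 'x) \<Rightarrow> 'x) \<Rightarrow> (real \<Rightarrow> 'x)) topology) y p.
           universal_upl_object X x Y y p"
proof -
  define A where "A = {(Z :: (real \<Rightarrow> 'x) topology, z, q). upl_object X x Z z q}"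
  define sp :: "(real \<Rightarrow> 'x) topology \<times> (real \<Rightarrow> 'x) \<times> ((real \<Rightarrow> 'x) \<Rightarrow> 'x) \<Rightarrow> (real \<Rightarrow> 'x) topology"
    where "sp = fst"
  define pt :: "(real \<Rightarrow> 'x) topology \<times> (real \<Rightarrow> 'x) \<times> ((real \<Rightarrow> 'x) \<Rightarrow> 'x) \<Rightarrow> (real \<Rightarrow> 'x)"
    where "pt = fst \<circ> snd"
  define pr :: "(real \<Rightarrow> 'x) topology \<times> (real \<Rightarrow> 'x) \<times> ((real \<Rightarrow> 'x) \<Rightarrow> 'x) \<Rightarrow> (real \<Rightarrow> 'x) \<Rightarrow> 'x"
    where "pr = snd \<circ> snd"
  have obj: "upl_object X x (sp a) (pt a) (pr a)" if "a \<in> A" for a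
    using that by (auto simp: A_def sp_def pt_def pr_def)
  define P where "P = product_topology sp A"
  define F where "F = subtopology P {w. \<forall>a\<in>A. \<forall>b\<in>A. pr a (w a) = pr b (w b)}"
  define y where "y = restrict pt A"
  define Y where "Y = subtopology F (path_component_of_set F y)"
  have id_obj: "upl_object X x X x id"
  proof -
    have "homotopy_lifting W X X id" for W :: "('x \<times> (real \<Rightarrow> 'x)) topology"
      unfolding homotopy_lifting_def by auto
    then show ?thesis
      using pcX x by (simp add: upl_object_def hurewicz_fibration_def unique_path_lifting_def)
  qed
  have "\<exists>a. a \<in> A"
  proof -
    define k where "k = (\<lambda>v::'x. (\<lambda>t::real. v))"
    have "inj_on k (topspace X)"
      by (auto simp: k_def inj_on_def dest: fun_cong)
    then have "homeomorphic_map X (quotient_topology X k) k"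
      unfolding homeomorphic_map_def using quotient_map_quotient_topology by blast
    then obtain k' where "homeomorphic_maps X (quotient_topology X k) k k'"
      by (auto simp: homeomorphic_map_maps)
    from upl_object_homeomorphic[OF id_obj this] show ?thesis
      by (auto simp: A_def)
  qed
  then obtain a0 where a0: "a0 \<in> A" by blast
  define p where "p = (\<lambda>w. pr a0 (w a0))"
  have obj': "continuous_map (sp a) X (pr a)" "hurewicz_fibration (sp a) X (pr a)"
    "unique_path_lifting (sp a) (pr a)" "pt a \<in> topspace (sp a)" "pr a (pt a) = x" if "a \<in> A" for a
    using obj[OF that] by (auto simp: upl_object_def hurewicz_fibration_def)
  have yF: "y \<in> topspace F"
    using obj' by (auto simp: F_def P_def y_def)
  have topY: "topspace Y = path_component_of_set F y"
    by (simp add: Y_def path_component_of_subset_topspace inf_absorb2)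
  have yY: "y \<in> topspace Y"
    using yF by (simp add: topY path_component_of_refl)
  have proj: "continuous_map Y (sp a) (\<lambda>w. w a)" if "a \<in> A" for a
    unfolding Y_def F_def P_def
    by (intro continuous_map_from_subtopology continuous_map_product_projection that)
  have prY: "pr a (w a) = p w" if "w \<in> topspace Y" "a \<in> A" for w a
    using that a0 unfolding Y_def F_def p_def topspace_subtopology by blast
  have extY: "w \<in> extensional A" if "w \<in> topspace Y" for w
  proof -
    have "w \<in> topspace P"
      using that unfolding Y_def F_def topspace_subtopology by blast
    then show ?thesis by (simp add: P_def PiE_def)
  qed
  have contp: "continuous_map Y X p"
    unfolding p_def using continuous_map_compose[OF proj[OF a0] obj'(1)[OF a0]]
    by (simp add: o_def)
  have lift: "homotopy_lifting W Y X p"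
    for W :: "(((real \<Rightarrow> 'x) topology \<times> (real \<Rightarrow> 'x) \<times> ((real \<Rightarrow> 'x) \<Rightarrow> 'x) \<Rightarrow> (real \<Rightarrow> 'x)) \<times> (real \<Rightarrow> 'x)) topology"
    unfolding homotopy_lifting_def
  proof (intro allI impI, elim conjE)
    fix g H
    let ?I = "top_of_set {0..1::real}"
    assume g: "continuous_map W Y g" and H: "continuous_map (prod_topology W ?I) X H"
      and Hg: "\<forall>w\<in>topspace W. H (w, 0) = p (g w)"
    have gY: "g w \<in> topspace Y" if "w \<in> topspace W" for w
      using continuous_map_image_subset_topspace[OF g] that by auto
    have ex: "\<exists>K. continuous_map (prod_topology W ?I) (sp a) K \<and>
              (\<forall>w\<in>topspace W. K (w, 0) = g w a) \<and>
              (\<forall>w\<in>topspace W. \<forall>t\<in>{0..1}. pr a (K (w, t)) = H (w, t))" if a: "a \<in> A" for a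
    proof -
      have "\<forall>w\<in>topspace W. H (w, 0) = pr a (g w a)"
        using Hg gY prY[OF _ a] by simp
      moreover have "continuous_map W (sp a) (\<lambda>w. g w a)"
        using continuous_map_compose[OF g proj[OF a]] by (simp add: o_def)
      ultimately show ?thesis
        using hurewicz_fibration_lifting[OF obj'(2)[OF a], of W] H
        unfolding homotopy_lifting_def by blast
    qed
    have "\<exists>k. \<forall>a\<in>A. continuous_map (prod_topology W ?I) (sp a) (k a) \<and>
        (\<forall>w\<in>topspace W. k a (w, 0) = g w a) \<and>
        (\<forall>w\<in>topspace W. \<forall>t\<in>{0..1}. pr a (k a (w, t)) = H (w, t))"
      by (rule bchoice) (blast intro: ex)
    then obtain k where k0: "\<forall>a\<in>A. continuous_map (prod_topology W ?I) (sp a) (k a) \<and>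
        (\<forall>w\<in>topspace W. k a (w, 0) = g w a) \<and>
        (\<forall>w\<in>topspace W. \<forall>t\<in>{0..1}. pr a (k a (w, t)) = H (w, t))" ..
    have k: "\<And>a. a \<in> A \<Longrightarrow> continuous_map (prod_topology W ?I) (sp a) (k a)"
        "\<And>a w. a \<in> A \<Longrightarrow> w \<in> topspace W \<Longrightarrow> k a (w, 0) = g w a"
        "\<And>a w t. a \<in> A \<Longrightarrow> w \<in> topspace W \<Longrightarrow> t \<in> {0..1} \<Longrightarrow> pr a (k a (w, t)) = H (w, t)"
      using k0 by blast+
    define K where "K = (\<lambda>u. restrict (\<lambda>a. k a u) A)"
    have "continuous_map (prod_topology W ?I) P K"
      unfolding P_def continuous_map_componentwise using k(1) by (simp add: K_def image_subset_iff)
    moreover have "pr a (K u a) = pr b (K u b)"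
      if u: "u \<in> topspace (prod_topology W ?I)" and ab: "a \<in> A" "b \<in> A" for u a b
    proof -
      obtain w t where "u = (w, t)" "w \<in> topspace W" "t \<in> {0..1}"
        using u by (cases u) auto
      then show ?thesis
        using k(3)[OF ab(1), of w t] k(3)[OF ab(2), of w t] ab by (simp add: K_def)
    qed
    ultimately have KF: "continuous_map (prod_topology W ?I) F K"
      unfolding F_def continuous_map_in_subtopology by blast
    have K0: "K (w, 0) = g w" if "w \<in> topspace W" for w
    proof (rule extensionalityI)
      show "g w \<in> extensional A"
        using extY gY that by blast
    qed (use k(2) that in \<open>auto simp: K_def\<close>)
    have "K (w, t) \<in> path_component_of_set F y" if w: "w \<in> topspace W" and t: "t \<in> {0..1}" for w t
    proof -
      have "continuous_map ?I (prod_topology W ?I) (\<lambda>s. (w, t * s))"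
      proof (rule continuous_map_pairedI)
        show "continuous_map ?I W (\<lambda>s. w)" using w by simp
        show "continuous_map ?I ?I (\<lambda>s. t * s)"
          using t by (auto simp: continuous_map_in_subtopology mult_le_one intro!: continuous_intros)
      qed
      then have "pathin F (\<lambda>s. K (w, t * s))"
        unfolding pathin_def using continuous_map_compose[OF _ KF] by (simp add: o_def)
      then have "path_component_of F (g w) (K (w, t))"
        unfolding path_component_of_def using K0[OF w] by (intro exI[of _ "\<lambda>s. K (w, t * s)"]) simp
      moreover have "path_component_of F y (g w)"
        using gY[OF w] topY by simp
      ultimately show ?thesis
        using path_component_of_trans by fastforce
    qed
    then have "continuous_map (prod_topology W ?I) Y K"
      using KF by (auto simp: Y_def continuous_map_in_subtopology)
    moreover have "p (K (w, t)) = H (w, t)" if "w \<in> topspace W" "t \<in> {0..1}" for w t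
      using k(3)[OF a0 that] a0 by (simp add: p_def K_def)
    ultimately show "\<exists>K. continuous_map (prod_topology W ?I) Y K \<and>
       (\<forall>w\<in>topspace W. K (w, 0) = g w) \<and>
       (\<forall>w\<in>topspace W. \<forall>t\<in>{0..1}. p (K (w, t)) = H (w, t))"
      using K0 by blast
  qed
  have upl: "unique_path_lifting Y p"
    unfolding unique_path_lifting_def
  proof (intro allI impI ballI, elim conjE)
    fix \<omega> \<omega>' :: "real \<Rightarrow> (real \<Rightarrow> 'x) topology \<times> (real \<Rightarrow> 'x) \<times> ((real \<Rightarrow> 'x) \<Rightarrow> 'x) \<Rightarrow> (real \<Rightarrow> 'x)"
      and t :: real
    assume w: "pathin Y \<omega>" "pathin Y \<omega>'" "\<omega> 0 = \<omega>' 0" "\<forall>t\<in>{0..1}. p (\<omega> t) = p (\<omega>' t)"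
      and t: "t \<in> {0..1}"
    have inY: "\<omega> s \<in> topspace Y" "\<omega>' s \<in> topspace Y" if "s \<in> {0..1}" for s
      using path_image_subset_topspace[OF w(1)] path_image_subset_topspace[OF w(2)] that by auto
    show "\<omega> t = \<omega>' t"
    proof (rule extensionalityI)
      show "\<omega> t \<in> extensional A" "\<omega>' t \<in> extensional A"
        using extY inY[OF t] by blast+
      fix a assume a: "a \<in> A"
      have "pathin (sp a) (\<lambda>s. \<omega> s a)" "pathin (sp a) (\<lambda>s. \<omega>' s a)"
        using pathin_compose[OF w(1) proj[OF a]] pathin_compose[OF w(2) proj[OF a]]
        by (simp_all add: o_def)
      moreover have "\<omega> 0 a = \<omega>' 0 a" "\<forall>s\<in>{0..1}. pr a (\<omega> s a) = pr a (\<omega>' s a)"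
        using w(3,4) inY prY a by simp_all
      ultimately have "\<forall>s\<in>{0..1}. \<omega> s a = \<omega>' s a"
        using obj'(3)[OF a] unfolding unique_path_lifting_def by blast
      then show "\<omega> t a = \<omega>' t a"
        using t by blast
    qed
  qed
  have "path_connected_space Y"
    unfolding Y_def by (metis path_connectedin_def path_connectedin_path_component_of)
  moreover have "p y = x"
    using a0 obj'(5) by (simp add: p_def y_def)
  ultimately have "upl_object X x Y y p"
    using contp lift upl yY by (simp add: upl_object_def hurewicz_fibration_def)
  moreover have "\<exists>g. upl_morphism Y y p Z z q g" if "upl_object X x Z z q"
    for Z :: "(real \<Rightarrow> 'x) topology" and z q
  proof -
    have a: "(Z, z, q) \<in> A" using that by (simp add: A_def)
    then have "upl_morphism Y y p Z z q (\<lambda>w. w (Z, z, q))"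
      using proj[OF a] prY[OF _ a] a
      by (simp add: upl_morphism_def sp_def pr_def pt_def y_def)
    then show ?thesis by blast
  qed
  ultimately have "universal_upl_object X x Y y p"
    by (simp add: universal_upl_object_def)
  then show ?thesis by blast
qed

end

theory Submission
  imports Defs
begin

text \<open>
  Pulling back the covering of the circle by the line along a continuous map of the universal
  object \<open>Y\<close> to the circle gives another fibration with unique path lifting; by universality it
  has a section, so every continuous map from \<open>Y\<close> to the circle lifts to the line. In particular
  the height coordinate of the torus lifts to \<open>Y\<close>, and the circles of the earring then
  induce circle-valued maps \<open>\<theta> j\<close> on \<open>Y\<close>, of which at most one differs from \<open>1\<close> at any point. If the
  open set where \<open>\<theta> j \<noteq> 1\<close> is split into two open pieces, then restricting \<open>\<theta> j\<close> to one
  piece again gives a circle-valued map, whose lift counts the crossings of that piece. Modulo these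
  lifts, \<open>Y\<close> behaves like a tree: two paths that connect the same two distinct points
  have a further point in common. As in a tree, a loop can therefore be contracted by projecting it onto
  its own initial segments. The contraction lives in an earring that is reached by pushing
  the loop along the semiflow of the mapping torus.

  The semiflow also moves every loop of the earring into an arbitrarily small neighbourhood of the
  basepoint, so that all these loops represent elements of the Spanier group. Uncountably many of
  them are distinguished by winding numbers, after lifting homotopies to the infinite cyclic cover.
\<close>

section \<open>Lifting circle-valued maps\<close>

text \<open>Winding numbers alone would not do: a commutator of two circles winds zero times around
  each of them. Splitting into pieces repairs this. The crossings of one circle can be sorted by the
  integer parts of finitely many lifts already obtained, that is, by what has happened before; each
  class of crossings is again an open piece with a lift of its own. So the lifts record the order of
  the crossings and not just their number.

  The obstacle is that nothing is available about the local structure of \<open>Y\<close>: its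
  points are not given as words, and components need not be open. Hence components are replaced by
  relatively clopen pieces, equality by the relation \<open>eqv\<close>, and the infinite family of
  all lifts is handled through finite subfamilies and compactness of the unit interval.

  The shift is not onto, so points can be pushed forward only; an integer above all heights of the
  compact loop serves as the common target level. There the loop becomes a loop in one earring, and
  it passes equivalent points of \<open>Y\<close> at equal points of the earring.\<close>

abbreviation I01 :: "real topology" where "I01 \<equiv> top_of_set {0..1}"

lemma Ints_valued_constant:
  fixes f :: "'a::topological_space \<Rightarrow> real"
  assumes "connected S" "continuous_on S f" "\<And>x. x \<in> S \<Longrightarrow> f x \<in> \<int>" "x \<in> S" "y \<in> S"
  shows "f x = f y"
proof (rule ccontr)
  have conn: "connected (f ` S)"
    using assms by (intro connected_continuous_image)
  have *: False if uv: "u \<in> f ` S" "v \<in> f ` S" "u < v" for u v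
  proof -
    obtain m n :: int where mn: "u = of_int m" "v = of_int n"
      using uv assms(3) by (metis Ints_cases imageE)
    have "(u + of_int m + 1) / 2 \<in> f ` S" if "m < n"
      using that mn by (intro connectedD_interval[OF conn uv(1,2)]) auto
    moreover have "m < n" using uv mn by simp
    ultimately have "real_of_int m + 1 / 2 \<in> \<int>"
      using assms(3) mn by (auto simp: field_simps)
    then have "real_of_int m + 1 / 2 - real_of_int m \<in> \<int>" by (intro Ints_diff) auto
    then show False using Ints_nonzero_abs_less1 by fastforce
  qed
  assume "f x \<noteq> f y"
  then show False using *[of "f x" "f y"] *[of "f y" "f x"] assms by force
qed

lemma cis_2pi_eq_iff: "cis (2 * pi * x) = cis (2 * pi * y) \<longleftrightarrow> x - y \<in> \<int>"
proof -
  have "cis (2 * pi * x) = cis (2 * pi * y) \<longleftrightarrow> (\<exists>n::int. 2 * pi * x = 2 * pi * y + 2 * pi * of_int n)"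
    by (subst sin_cos_eq_iff[symmetric]) (auto simp: complex_eq_iff)
  also have "\<dots> \<longleftrightarrow> (\<exists>n::int. 2 * pi * x = 2 * pi * (y + of_int n))"
    by (simp only: distrib_left)
  also have "\<dots> \<longleftrightarrow> (\<exists>n::int. x - y = of_int n)"
    by (simp add: diff_eq_eq add.commute)
  finally show ?thesis by (auto simp: Ints_def)
qed

lemma circle_lift_contractible:
  fixes f :: "'a::real_normed_vector \<Rightarrow> complex"
  assumes "continuous_on S f" "contractible S" "\<And>x. x \<in> S \<Longrightarrow> norm (f x) = 1"
  obtains g where "continuous_on S g" "\<And>x. x \<in> S \<Longrightarrow> f x = cis (2 * pi * g x)"
proof -
  have "f x \<noteq> 0" if "x \<in> S" for x using assms(3)[OF that] by auto
  then obtain g where g: "continuous_on S g" "\<And>x. x \<in> S \<Longrightarrow> f x = exp (g x)"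
    using continuous_logarithm_on_contractible[OF assms(1,2)] by blast
  have "f x = cis (2 * pi * (Im (g x) / (2 * pi)))" if "x \<in> S" for x
  proof -
    have "Re (g x) = 0" using assms(3)[OF that] g(2)[OF that] by simp
    then show ?thesis using g(2)[OF that] by (simp add: exp_eq_polar)
  qed
  moreover have "continuous_on S (\<lambda>x. Im (g x) / (2 * pi))"
    by (intro continuous_intros g) auto
  ultimately show ?thesis using that by blast
qed

lemma circle_path_lift:
  fixes f :: "real \<Rightarrow> complex"
  assumes "continuous_on {0..1} f" "\<And>t. t \<in> {0..1} \<Longrightarrow> norm (f t) = 1" "cis (2 * pi * a) = f 0"
  obtains g where "continuous_on {0..1} g" "g 0 = a" "\<And>t. t \<in> {0..1} \<Longrightarrow> f t = cis (2 * pi * g t)"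
proof -
  obtain g where g: "continuous_on {0..1} g" "\<And>t. t \<in> {0..1} \<Longrightarrow> f t = cis (2 * pi * g t)"
    using circle_lift_contractible[of "{0..1}" f] assms by (auto simp: convex_imp_contractible)
  have "a - g 0 \<in> \<int>" using g(2)[of 0] assms(3) by (simp flip: cis_2pi_eq_iff)
  then have "f t = cis (2 * pi * (g t + (a - g 0)))" if "t \<in> {0..1}" for t
    using that g(2)[OF that] cis_2pi_eq_iff[of "g t + (a - g 0)" "g t"] by simp
  moreover have "continuous_on {0..1} (\<lambda>t. g t + (a - g 0))" by (intro continuous_intros g)
  ultimately show ?thesis using that by auto
qed

text \<open>Made for functions such as the principal logarithm of a quotient, which are continuous
  only on a part \<open>S\<close> of the target.\<close>

lemma continuous_map_pair_compose:
  assumes "continuous_map X euclidean f" "continuous_map X euclidean g"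
    "\<And>x. x \<in> topspace X \<Longrightarrow> (f x, g x) \<in> S" "continuous_on S h"
  shows "continuous_map X euclidean (\<lambda>x. h (f x, g x))"
proof -
  have "continuous_map X (top_of_set S) (\<lambda>x. (f x, g x))"
    using assms by (auto simp: continuous_map_in_subtopology simp flip: prod_topology_euclidean intro!: continuous_map_pairedI)
  moreover have "continuous_map (top_of_set S) euclidean h" using assms(4) by simp
  ultimately show ?thesis using continuous_map_compose[of X _ "\<lambda>x. (f x, g x)" euclidean h] by (simp add: o_def)
qed

text \<open>Homotopy lifting for the covering of the circle by the line, over an arbitrary
  \<open>W\<close>. Lifting each path separately gives \<open>k\<close>; only joint continuity is at
  stake. It is local in \<open>w\<close>: by compactness of the time interval, \<open>w0\<close> has
  a neighbourhood on which \<open>\<phi> (w, t) / \<phi> (w0, t)\<close> stays in the right half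
  plane, and there the principal logarithm gives a continuous lift.\<close>

lemma circle_homotopy_lifting:
  fixes W :: "'w topology" and \<phi> :: "'w \<times> real \<Rightarrow> complex"
  assumes \<phi>: "continuous_map (prod_topology W I01) euclidean \<phi>"
    and unit: "\<And>w t. w \<in> topspace W \<Longrightarrow> t \<in> {0..1} \<Longrightarrow> norm (\<phi> (w, t)) = 1"
    and g: "continuous_map W euclideanreal g"
    and init: "\<And>w. w \<in> topspace W \<Longrightarrow> cis (2 * pi * g w) = \<phi> (w, 0)"
  obtains K where "continuous_map (prod_topology W I01) euclideanreal K"
    "\<And>w. w \<in> topspace W \<Longrightarrow> K (w, 0) = g w"
    "\<And>w t. w \<in> topspace W \<Longrightarrow> t \<in> {0..1} \<Longrightarrow> \<phi> (w, t) = cis (2 * pi * K (w, t))"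
proof -
  have slice: "continuous_on {0..1} (\<lambda>t. \<phi> (w, t))" if w: "w \<in> topspace W" for w
  proof -
    have "continuous_map I01 (prod_topology W I01) (\<lambda>t. (w, t))"
      using w by (auto intro!: continuous_map_pairedI)
    from continuous_map_compose[OF this \<phi>] show ?thesis by (simp add: o_def)
  qed
  have "\<exists>k. continuous_on {0..1} k \<and> k 0 = g w \<and> (\<forall>t\<in>{0..1}. \<phi> (w, t) = cis (2 * pi * k t))"
    if w: "w \<in> topspace W" for w
    using circle_path_lift[OF slice[OF w] unit[OF w] init[OF w]] by metis
  then obtain k where k: "\<And>w. w \<in> topspace W \<Longrightarrow> continuous_on {0..1} (k w)"
    "\<And>w. w \<in> topspace W \<Longrightarrow> k w 0 = g w"
    "\<And>w t. w \<in> topspace W \<Longrightarrow> t \<in> {0..1} \<Longrightarrow> \<phi> (w, t) = cis (2 * pi * k w t)"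
    by metis
  define q where "q = (\<lambda>w0 w t. \<phi> (w, t) / \<phi> (w0, t))"
  have "\<exists>N. openin W N \<and> w0 \<in> N \<and> (\<forall>w\<in>N. \<forall>t\<in>{0..1}. norm (\<phi> (w, t) - \<phi> (w0, t)) < 1)"
    if w0: "w0 \<in> topspace W" for w0
  proof -
    have c0: "continuous_map (prod_topology W I01) euclidean (\<lambda>z. \<phi> (w0, snd z))"
    proof -
      have "continuous_map I01 euclidean (\<lambda>t. \<phi> (w0, t))" using slice[OF w0] by simp
      from continuous_map_compose[OF continuous_map_snd this, of W] show ?thesis by (simp add: o_def)
    qed
    have "continuous_map (prod_topology W I01) euclidean (\<lambda>z. norm (\<phi> z - \<phi> (w0, snd z)))"
      by (rule continuous_map_pair_compose[OF \<phi> c0, of UNIV "\<lambda>p. norm (fst p - snd p)", simplified])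
         (intro continuous_intros)
    then have "openin (prod_topology W I01) {z \<in> topspace (prod_topology W I01). norm (\<phi> z - \<phi> (w0, snd z)) \<in> {..<1}}"
      (is "openin _ ?S")
      by (rule openin_continuous_map_preimage) simp
    moreover have "compactin I01 {0..1}" by (simp add: compactin_subtopology)
    moreover have "{w0} \<times> {0..1} \<subseteq> ?S" using w0 by auto
    ultimately have "\<exists>U V. openin W U \<and> openin I01 V \<and> w0 \<in> U \<and> {0..1} \<subseteq> V \<and> U \<times> V \<subseteq> ?S"
      using w0 by (intro tube_lemma_right)
    then obtain U V where UV: "openin W U" "w0 \<in> U" "{0..1} \<subseteq> V" "U \<times> V \<subseteq> ?S"
      by blast
    have "norm (\<phi> (w, t) - \<phi> (w0, t)) < 1" if "w \<in> U" "t \<in> {0..1}" for w t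
    proof -
      have "(w, t) \<in> U \<times> V" using that UV(3) by auto
      then show ?thesis using UV(4) by force
    qed
    then show ?thesis using UV by blast
  qed
  then obtain N where N: "\<And>w0. w0 \<in> topspace W \<Longrightarrow> openin W (N w0)" "\<And>w0. w0 \<in> topspace W \<Longrightarrow> w0 \<in> N w0"
    "\<And>w0 w t. w0 \<in> topspace W \<Longrightarrow> w \<in> N w0 \<Longrightarrow> t \<in> {0..1} \<Longrightarrow> norm (\<phi> (w, t) - \<phi> (w0, t)) < 1"
    by metis
  have NW: "w \<in> topspace W" if "w0 \<in> topspace W" "w \<in> N w0" for w w0
    using openin_subset[OF N(1)[OF that(1)]] that by auto
  have Re: "Re (\<phi> (w, t) / \<phi> (w0, t)) > 0" if "w0 \<in> topspace W" "w \<in> N w0" "t \<in> {0..1}" for w0 w t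
  proof -
    have nz: "norm (\<phi> (w0, t)) = 1" using unit that by auto
    then have "\<phi> (w0, t) \<noteq> 0" by auto
    then have "\<phi> (w, t) / \<phi> (w0, t) - 1 = (\<phi> (w, t) - \<phi> (w0, t)) / \<phi> (w0, t)"
      by (simp add: diff_divide_distrib)
    then have "norm (\<phi> (w, t) / \<phi> (w0, t) - 1) < 1"
      using N(3)[OF that] nz by (simp add: norm_divide)
    then show ?thesis
      using complex_Re_le_cmod[of "1 - \<phi> (w, t) / \<phi> (w0, t)"] by (simp add: norm_minus_commute)
  qed
  define L where "L = (\<lambda>w0 w t. Im (Ln (q w0 w t)) / (2 * pi))"
  have cisL: "cis (2 * pi * L w0 w t) = q w0 w t" if "w0 \<in> topspace W" "w \<in> N w0" "t \<in> {0..1}" for w0 w t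
  proof -
    have "norm (q w0 w t) = 1" using unit that NW by (auto simp: q_def norm_divide)
    moreover from this have "q w0 w t \<noteq> 0" by auto
    ultimately have "exp (Ln (q w0 w t)) = q w0 w t" "Re (Ln (q w0 w t)) = 0" by simp_all
    then show ?thesis by (simp add: L_def exp_eq_polar)
  qed
  \<comment> \<open>As \<open>k w0 0 = g w0\<close>, the bracket corrects the value at time 0 to
    \<open>g w\<close>. So \<open>K' w0 (w, t)\<close> and \<open>k w t\<close> lift the same path
    in \<open>t\<close> from the same start.\<close>
  define K' where "K' = (\<lambda>w0 (w, t). k w0 t + L w0 w t + (g w - g w0 - L w0 w 0))"
  have K'k: "K' w0 (w, t) = k w t" if w0: "w0 \<in> topspace W" and w: "w \<in> N w0" and t: "t \<in> {0..1}"
      and Kc: "continuous_map (prod_topology (subtopology W (N w0)) I01) euclideanreal (K' w0)" for w0 w t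
  proof -
    have "continuous_map I01 (prod_topology (subtopology W (N w0)) I01) (\<lambda>t. (w, t))"
      using w NW[OF w0 w] by (auto intro!: continuous_map_pairedI)
    from continuous_map_compose[OF this Kc]
    have "continuous_on {0..1} (\<lambda>t. K' w0 (w, t))" by (simp add: o_def)
    then have cont: "continuous_on {0..1} (\<lambda>t. K' w0 (w, t) - k w t)"
      using k(1)[OF NW[OF w0 w]] by (intro continuous_intros)
    have int: "K' w0 (w, t) - k w t \<in> \<int>" if t: "t \<in> {0..1}" for t
    proof -
      have e: "cis (2 * pi * (k w0 s + L w0 w s)) = \<phi> (w, s)" if s: "s \<in> {0..1}" for s
        using k(3)[OF w0 s] cisL[OF w0 w s] unit[OF w0 s]
        by (auto simp: distrib_left q_def simp flip: cis_mult)
      have "g w - (k w0 0 + L w0 w 0) \<in> \<int>"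
        unfolding cis_2pi_eq_iff[symmetric] using e[of 0] init[OF NW[OF w0 w]] by simp
      moreover have "k w0 t + L w0 w t - k w t \<in> \<int>"
        unfolding cis_2pi_eq_iff[symmetric] using e[OF t] k(3)[OF NW[OF w0 w] t] by simp
      ultimately have "(g w - (k w0 0 + L w0 w 0)) + (k w0 t + L w0 w t - k w t) \<in> \<int>"
        by (rule Ints_add)
      then show ?thesis by (simp add: K'_def k(2)[OF w0] algebra_simps)
    qed
    have "K' w0 (w, t) - k w t = K' w0 (w, 0) - k w 0"
      by (rule Ints_valued_constant[OF _ cont int]) (use t in auto)
    then show ?thesis using k(2) w0 NW[OF w0 w] by (simp add: K'_def)
  qed
  have K'c: "continuous_map (prod_topology (subtopology W (N w0)) I01) euclideanreal (K' w0)"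
    if w0: "w0 \<in> topspace W" for w0
  proof -
    let ?P = "prod_topology (subtopology W (N w0)) I01"
    have fstW: "continuous_map ?P W fst"
      using continuous_map_fst[of "subtopology W (N w0)" I01] continuous_map_into_fulltopology by blast
    have Lc: "continuous_map ?P euclideanreal (\<lambda>z. L w0 (fst z) (h (snd z)))" if h: "continuous_map I01 I01 h" for h
    proof -
      have hs: "continuous_map ?P I01 (\<lambda>z. h (snd z))"
        using continuous_map_compose[OF continuous_map_snd h] by (simp add: o_def)
      have a: "continuous_map ?P (prod_topology W I01) (\<lambda>z. (fst z, h (snd z)))"
        using fstW hs by (intro continuous_map_pairedI) auto
      have b: "continuous_map ?P (prod_topology W I01) (\<lambda>z. (w0, h (snd z)))"
        using w0 hs by (intro continuous_map_pairedI) auto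
      have hI: "h (snd z) \<in> {0..1}" if "z \<in> topspace ?P" for z
        using continuous_map_image_subset_topspace[OF h] that by (auto simp: image_subset_iff)
      have "continuous_on {p. snd p \<noteq> 0 \<and> Re (fst p / snd p) > 0} (\<lambda>p. Im (Ln (fst p / snd p)) / (2 * pi))"
        by (intro continuous_intros) (auto simp: complex_nonpos_Reals_iff)
      from continuous_map_pair_compose[OF continuous_map_compose[OF a \<phi>] continuous_map_compose[OF b \<phi>] _ this]
      show ?thesis
        using Re[OF w0 _ hI] hI unit[OF w0] by (fastforce simp: L_def q_def o_def)
    qed
    have "continuous_map ?P euclideanreal (\<lambda>z. k w0 (snd z) + L w0 (fst z) (snd z) + (g (fst z) - g w0 - L w0 (fst z) 0))"
      using Lc[of "\<lambda>t. t"] Lc[of "\<lambda>t. 0"] continuous_map_compose[OF fstW g]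
        continuous_map_compose[OF continuous_map_snd, of I01 euclidean "k w0" "subtopology W (N w0)"] k(1)[OF w0]
      by (intro continuous_intros) (auto simp: o_def)
    then show ?thesis by (simp add: K'_def case_prod_unfold)
  qed
  define K where "K = (\<lambda>(w, t). k w t)"
  have "continuous_map (prod_topology W I01) euclideanreal K"
  proof (rule pasting_lemma[where I = "topspace W" and T = "\<lambda>w0. N w0 \<times> {0..1}" and f = K'])
    show "openin (prod_topology W I01) (N i \<times> {0..1})" if "i \<in> topspace W" for i
      using N(1)[OF that] by (simp add: openin_prod_Times_iff openin_subtopology_self)
    show "continuous_map (subtopology (prod_topology W I01) (N i \<times> {0..1})) euclideanreal (K' i)"
      if "i \<in> topspace W" for i
      using K'c[OF that] by (simp add: subtopology_Times subtopology_subtopology)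
  next
    fix i j x
    assume "i \<in> topspace W" "j \<in> topspace W"
      "x \<in> topspace (prod_topology W I01) \<inter> N i \<times> {0..1} \<inter> N j \<times> {0..1}"
    then show "K' i x = K' j x" using K'k[OF _ _ _ K'c] by (cases x) auto
  next
    fix x assume "x \<in> topspace (prod_topology W I01)"
    then show "\<exists>j. j \<in> topspace W \<and> x \<in> N j \<times> {0..1} \<and> K x = K' j x"
      using K'k[OF _ _ _ K'c] N(2) by (cases x) (force simp: K_def)
  qed
  then show ?thesis
    using that[of K] k by (auto simp: K_def)
qed


text \<open>The path component \<open>C\<close> of the pullback \<open>Z\<close> is an object over
  \<open>X\<close> because a homotopy lifts first to \<open>Y\<close> and then, by
  \<open>circle_homotopy_lifting\<close>, to the line. For a morphism \<open>g\<close> from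
  \<open>Y\<close> to \<open>C\<close>, the lift is \<open>snd \<circ> g\<close>, once
  \<open>fst \<circ> g\<close> is known to be the identity.\<close>

lemma universal_upl_object_circle_lift:
  fixes X :: "'x topology" and Y :: "'y topology" and \<phi> :: "'y \<Rightarrow> complex"
  assumes univ: "universal_upl_object X x Y y p"
    and \<phi>: "continuous_map Y euclidean \<phi>"
    and unit: "\<And>v. v \<in> topspace Y \<Longrightarrow> norm (\<phi> v) = 1"
  obtains c where "continuous_map Y euclideanreal c"
    "\<And>v. v \<in> topspace Y \<Longrightarrow> \<phi> v = cis (2 * pi * c v)"
proof -
  have fib: "hurewicz_fibration Y X p" and p: "continuous_map Y X p" and upl: "unique_path_lifting Y p"
    and pc: "path_connected_space Y" and y: "y \<in> topspace Y" "p y = x"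
    using univ by (auto simp: universal_upl_object_def upl_object_def hurewicz_fibration_def)
  define Z where "Z = subtopology (prod_topology Y euclideanreal) {z. \<phi> (fst z) = cis (2 * pi * snd z)}"
  define z where "z = (y, Arg (\<phi> y) / (2 * pi))"
  define C where "C = subtopology Z (path_component_of_set Z z)"
  have zZ: "z \<in> topspace Z"
    using y unit[OF y(1)] rcis_cmod_Arg[of "\<phi> y"] by (simp add: Z_def z_def rcis_def)
  have topC: "topspace C = path_component_of_set Z z"
    by (simp add: C_def path_component_of_subset_topspace inf_absorb2)
  have zC: "z \<in> topspace C"
    using zZ by (simp add: topC path_component_of_refl)
  have CZ: "v \<in> topspace Y \<and> \<phi> v = cis (2 * pi * r)" if "(v, r) \<in> topspace C" for v r
    using that unfolding C_def Z_def by auto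
  have fstC: "continuous_map C Y fst" and sndC: "continuous_map C euclideanreal snd"
    unfolding C_def Z_def
    by (intro continuous_map_from_subtopology continuous_map_fst continuous_map_snd)+
  have lift: "homotopy_lifting W C X (p \<circ> fst)" for W :: "(('y \<times> real) \<times> (real \<Rightarrow> 'x)) topology"
    unfolding homotopy_lifting_def
  proof (intro allI impI, elim conjE)
    fix g H
    assume g: "continuous_map W C g" and H: "continuous_map (prod_topology W I01) X H"
      and Hg: "\<forall>w\<in>topspace W. H (w, 0) = (p \<circ> fst) (g w)"
    have gC: "g w \<in> topspace C" if "w \<in> topspace W" for w
      using continuous_map_image_subset_topspace[OF g] that by auto
    have g1: "continuous_map W Y (fst \<circ> g)" and g2: "continuous_map W euclideanreal (snd \<circ> g)"
      using g fstC sndC by (auto intro: continuous_map_compose)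
    obtain k where k: "continuous_map (prod_topology W I01) Y k"
      "\<And>w. w \<in> topspace W \<Longrightarrow> k (w, 0) = fst (g w)"
      "\<And>w t. w \<in> topspace W \<Longrightarrow> t \<in> {0..1} \<Longrightarrow> p (k (w, t)) = H (w, t)"
      using hurewicz_fibration_lifting[OF fib, of W] g1 H Hg
      unfolding homotopy_lifting_def o_def by metis
    have kY: "k (w, t) \<in> topspace Y" if "w \<in> topspace W" "t \<in> {0..1}" for w t
      using continuous_map_image_subset_topspace[OF k(1)] that by auto
    have init: "cis (2 * pi * (snd \<circ> g) w) = (\<phi> \<circ> k) (w, 0)" if "w \<in> topspace W" for w
      using CZ[of "fst (g w)" "snd (g w)"] gC[OF that] k(2)[OF that] by simp
    have nrm: "norm ((\<phi> \<circ> k) (w, t)) = 1" if "w \<in> topspace W" "t \<in> {0..1}" for w t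
      using unit kY[OF that] by simp
    obtain l where l: "continuous_map (prod_topology W I01) euclideanreal l"
      "\<And>w. w \<in> topspace W \<Longrightarrow> l (w, 0) = (snd \<circ> g) w"
      "\<And>w t. w \<in> topspace W \<Longrightarrow> t \<in> {0..1} \<Longrightarrow> (\<phi> \<circ> k) (w, t) = cis (2 * pi * l (w, t))"
      using circle_homotopy_lifting[OF continuous_map_compose[OF k(1) \<phi>] nrm g2 init] by blast
    define K where "K = (\<lambda>u. (k u, l u))"
    have KZ: "continuous_map (prod_topology W I01) Z K"
      using k(1) l kY unfolding Z_def K_def
      by (auto simp: continuous_map_in_subtopology intro: continuous_map_pairedI)
    have K0: "K (w, 0) = g w" if "w \<in> topspace W" for w
      using that k l by (simp add: K_def)
    \<comment> \<open>The vertical path that starts at \<open>g w\<close> stays in one path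
      component.\<close>
    have "K (w, t) \<in> path_component_of_set Z z" if w: "w \<in> topspace W" and t: "t \<in> {0..1}" for w t
    proof -
      have "continuous_map I01 (prod_topology W I01) (\<lambda>s. (w, t * s))"
      proof (rule continuous_map_pairedI)
        show "continuous_map I01 W (\<lambda>s. w)" using w by simp
        show "continuous_map I01 I01 (\<lambda>s. t * s)"
          using t by (auto simp: continuous_map_in_subtopology mult_le_one intro!: continuous_intros)
      qed
      then have "pathin Z (\<lambda>s. K (w, t * s))"
        unfolding pathin_def using continuous_map_compose[OF _ KZ] by (simp add: o_def)
      then have "path_component_of Z (g w) (K (w, t))"
        unfolding path_component_of_def using K0[OF w] by (intro exI[of _ "\<lambda>s. K (w, t * s)"]) simp
      moreover have "path_component_of Z z (g w)"
        using gC[OF w] topC by simp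
      ultimately show ?thesis
        using path_component_of_trans by fastforce
    qed
    then have "continuous_map (prod_topology W I01) C K"
      using KZ by (auto simp: C_def continuous_map_in_subtopology)
    then show "\<exists>K. continuous_map (prod_topology W I01) C K \<and>
       (\<forall>w\<in>topspace W. K (w, 0) = g w) \<and>
       (\<forall>w\<in>topspace W. \<forall>t\<in>{0..1}. (p \<circ> fst) (K (w, t)) = H (w, t))"
      using K0 k(3) by (intro exI[of _ K]) (simp add: K_def)
  qed
  have uplC: "unique_path_lifting C (p \<circ> fst)"
    unfolding unique_path_lifting_def
  proof (intro allI impI ballI, elim conjE)
    fix \<omega> \<omega>' :: "real \<Rightarrow> 'y \<times> real" and t :: real
    assume w: "pathin C \<omega>" "pathin C \<omega>'" "\<omega> 0 = \<omega>' 0"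
      "\<forall>t\<in>{0..1}. (p \<circ> fst) (\<omega> t) = (p \<circ> fst) (\<omega>' t)" and t: "t \<in> {0..1}"
    have inC: "\<omega> s \<in> topspace C" "\<omega>' s \<in> topspace C" if "s \<in> {0..1}" for s
      using path_image_subset_topspace[OF w(1)] path_image_subset_topspace[OF w(2)] that by auto
    have "pathin Y (fst \<circ> \<omega>)" "pathin Y (fst \<circ> \<omega>')"
      using pathin_compose[OF w(1) fstC] pathin_compose[OF w(2) fstC] by simp_all
    moreover have "(fst \<circ> \<omega>) 0 = (fst \<circ> \<omega>') 0"
      "\<forall>s\<in>{0..1}. p ((fst \<circ> \<omega>) s) = p ((fst \<circ> \<omega>') s)"
      using w(3,4) by simp_all
    ultimately have "\<forall>s\<in>{0..1}. (fst \<circ> \<omega>) s = (fst \<circ> \<omega>') s"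
      using upl unfolding unique_path_lifting_def by blast
    then have eq: "fst (\<omega> s) = fst (\<omega>' s)" if "s \<in> {0..1}" for s
      using that by simp
    have "pathin euclideanreal (snd \<circ> \<omega>)" "pathin euclideanreal (snd \<circ> \<omega>')"
      using pathin_compose[OF w(1) sndC] pathin_compose[OF w(2) sndC] by simp_all
    then have cont: "continuous_on {0..1} (\<lambda>s. snd (\<omega> s) - snd (\<omega>' s))"
      by (intro continuous_intros) (auto simp: pathin_def o_def)
    have "snd (\<omega> s) - snd (\<omega>' s) \<in> \<int>" if "s \<in> {0..1}" for s
    proof -
      have "\<phi> (fst (\<omega> s)) = cis (2 * pi * snd (\<omega> s))" "\<phi> (fst (\<omega>' s)) = cis (2 * pi * snd (\<omega>' s))"
        using CZ[of "fst (\<omega> s)" "snd (\<omega> s)"] CZ[of "fst (\<omega>' s)" "snd (\<omega>' s)"] inC[OF that] by simp_all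
      then show ?thesis unfolding cis_2pi_eq_iff[symmetric] by (simp add: eq[OF that])
    qed
    then have "snd (\<omega> t) - snd (\<omega>' t) = snd (\<omega> 0) - snd (\<omega>' 0)"
      by (intro Ints_valued_constant[OF _ cont]) (use t in auto)
    then show "\<omega> t = \<omega>' t"
      using eq[OF t] w(3) by (simp add: prod_eq_iff)
  qed
  have "path_connected_space C"
    unfolding C_def by (metis path_connectedin_def path_connectedin_path_component_of)
  then have "upl_object X x C z (p \<circ> fst)"
    using lift uplC zC y continuous_map_compose[OF fstC p]
    by (simp add: upl_object_def hurewicz_fibration_def z_def)
  then obtain g where "upl_morphism Y y p C z (p \<circ> fst) g"
    using universal_upl_object_morphism[OF univ, of C z "p \<circ> fst"] by blast
  then have g: "continuous_map Y C g" "g y = z" "\<And>v. v \<in> topspace Y \<Longrightarrow> p (fst (g v)) = p v"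
    by (auto simp: upl_morphism_def)
  \<comment> \<open>A path from \<open>y\<close> to \<open>v\<close> and its image under
    \<open>fst \<circ> g\<close> have the same projection and the same start; unique path lifting
    identifies them.\<close>
  have id: "fst (g v) = v" if v: "v \<in> topspace Y" for v
  proof -
    obtain \<alpha> where \<alpha>: "pathin Y \<alpha>" "\<alpha> 0 = y" "\<alpha> 1 = v"
      using pc y v unfolding path_connected_space_def by blast
    have "pathin Y (fst \<circ> g \<circ> \<alpha>)"
      using pathin_compose[OF \<alpha>(1) continuous_map_compose[OF g(1) fstC]] by (simp add: o_assoc)
    moreover have "\<forall>t\<in>{0..1}. p ((fst \<circ> g \<circ> \<alpha>) t) = p (\<alpha> t)"
      using g(3) funcset_mem[OF path_image_subset_topspace[OF \<alpha>(1)]] by simp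
    moreover have "(fst \<circ> g \<circ> \<alpha>) 0 = \<alpha> 0" using \<alpha>(2) g(2) by (simp add: z_def)
    ultimately have "\<forall>t\<in>{0..1}. (fst \<circ> g \<circ> \<alpha>) t = \<alpha> t"
      using upl \<alpha>(1) unfolding unique_path_lifting_def by blast
    then show ?thesis using \<alpha>(3) by auto
  qed
  have "continuous_map Y euclideanreal (snd \<circ> g)"
    using g(1) sndC by (rule continuous_map_compose)
  moreover have "\<phi> v = cis (2 * pi * (snd \<circ> g) v)" if "v \<in> topspace Y" for v
  proof -
    have "(fst (g v), snd (g v)) \<in> topspace C"
      using continuous_map_image_subset_topspace[OF g(1)] that by auto
    from CZ[OF this] show ?thesis using id[OF that] by simp
  qed
  ultimately show ?thesis using that by blast
qed

section \<open>Homotopies of loops read off from maps on the square\<close>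

lemma loop_class_eqI:
  assumes "homotopic_with (\<lambda>k. k 0 = x \<and> k 1 = x) I01 X g h"
  shows "loop_class X x g = loop_class X x h"
proof -
  have "homotopic_with (\<lambda>k. k 0 = x \<and> k 1 = x) I01 X g k \<longleftrightarrow>
      homotopic_with (\<lambda>k. k 0 = x \<and> k 1 = x) I01 X h k" for k
    by (rule iffI) (erule homotopic_with_trans[OF assms] homotopic_with_trans[OF homotopic_with_symD[OF assms]])+
  then show ?thesis by (simp add: loop_class_def)
qed

lemma loop_class_cong:
  assumes "loop_at X x g" "\<And>t. t \<in> {0..1} \<Longrightarrow> g t = h t"
  shows "loop_class X x g = loop_class X x h"
proof (rule loop_class_eqI, rule homotopic_with_equal)
  show "continuous_map I01 X g" using assms(1) by (simp add: loop_at_def pathin_def)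
qed (use assms in \<open>auto simp: loop_at_def\<close>)

text \<open>The square is convex, so the straight-line homotopy between \<open>a\<close> and
  \<open>b\<close> stays in it and fixes the common ends.\<close>

lemma loop_class_square:
  fixes K :: "real \<times> real \<Rightarrow> 'a" and a b :: "real \<Rightarrow> real \<times> real"
  assumes K: "continuous_map (prod_topology I01 I01) X K"
    and a: "continuous_on {0..1} a" "a ` {0..1} \<subseteq> {0..1} \<times> {0..1}"
    and b: "continuous_on {0..1} b" "b ` {0..1} \<subseteq> {0..1} \<times> {0..1}"
    and ends: "a 0 = b 0" "a 1 = b 1" "K (a 0) = x" "K (a 1) = x"
  shows "loop_class X x (\<lambda>t. K (a t)) = loop_class X x (\<lambda>t. K (b t))"
proof (rule loop_class_eqI)
  define m where "m = (\<lambda>(u, t). (1 - u) *\<^sub>R a t + u *\<^sub>R b t)"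
  have conv: "convex ({0..1::real} \<times> {0..1::real})" by (intro convex_Times) auto
  have "m z \<in> {0..1} \<times> {0..1}" if z: "z \<in> {0..1} \<times> {0..1}" for z
  proof -
    obtain u t where "z = (u, t)" "u \<in> {0..1}" "t \<in> {0..1}" using z by auto
    then show ?thesis
      using convexD[OF conv, of "a t" "b t" "1 - u" u] a(2) b(2) by (auto simp: m_def image_subset_iff)
  qed
  moreover have "continuous_on ({0..1} \<times> {0..1}) m"
    unfolding m_def case_prod_unfold
    by (intro continuous_intros continuous_on_compose2[OF a(1)] continuous_on_compose2[OF b(1)]) auto
  ultimately have "continuous_map (prod_topology I01 I01) (prod_topology I01 I01) m"
    by (auto simp: continuous_map_in_subtopology simp flip: subtopology_Times)
  from continuous_map_compose[OF this K]
  have "continuous_map (prod_topology I01 I01) X (\<lambda>z. K (m z))" by (simp add: o_def)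
  then show "homotopic_with (\<lambda>k. k 0 = x \<and> k 1 = x) I01 X (\<lambda>t. K (a t)) (\<lambda>t. K (b t))"
    unfolding homotopic_with_def
    by (intro exI[of _ "\<lambda>z. K (m z)"]) (use ends in \<open>auto simp: m_def simp flip: scaleR_add_left\<close>)
qed

text \<open>The bottom side is homotopic in the square to the path \<open>b\<close> along the other
  three sides, and \<open>K\<close> cannot tell the right side from the left one. The result is a
  conjugate in exactly the form of the generators of the Spanier group.\<close>

lemma loop_class_free_homotopy:
  fixes K :: "real \<times> real \<Rightarrow> 'a"
  assumes K: "continuous_map (prod_topology I01 I01) X K"
    and sides: "\<And>u. u \<in> {0..1} \<Longrightarrow> K (0, u) = K (1, u)"
  shows "loop_class X (K (0, 0)) (\<lambda>t. K (t, 0)) =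
    loop_class X (K (0, 0)) (path_join (path_join (\<lambda>u. K (0, u)) (\<lambda>t. K (t, 1))) (path_reverse (\<lambda>u. K (0, u))))"
    (is "?L = loop_class X ?x ?J")
proof -
  \<comment> \<open>Up the left side until time 1/4, along the top until 1/2, down the right side
    until 1: the timing of the nested \<open>path_join\<close>.\<close>
  define b where "b = (\<lambda>t::real. (max 0 (min 1 (4 * t - 1)), min 1 (min (4 * t) (2 - 2 * t))))"
  have b: "continuous_on {0..1} b" unfolding b_def by (intro continuous_intros)
  have bI: "b ` {0..1} \<subseteq> {0..1} \<times> {0..1}" by (auto simp: b_def)
  have "?L = loop_class X ?x (\<lambda>t. K (b t))"
    by (rule loop_class_square[OF K _ _ b bI]) (use sides[of 0] in \<open>auto simp: b_def intro!: continuous_intros\<close>)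
  also have "\<dots> = loop_class X ?x ?J"
  proof (rule loop_class_cong)
    have "continuous_map I01 (prod_topology I01 I01) b"
      using b bI by (auto simp: continuous_map_in_subtopology simp flip: subtopology_Times)
    from continuous_map_compose[OF this K]
    show "loop_at X ?x (\<lambda>t. K (b t))"
      using sides[of 0] by (simp add: loop_at_def pathin_def o_def b_def)
    show "K (b t) = ?J t" if "t \<in> {0..1}" for t
    proof (cases "t = 1 / 2")
      case True
      then show ?thesis using sides[of 1] unfolding True by (simp add: b_def path_join_def)
    next
      case False
      then show ?thesis
        using that sides[of "2 - 2 * t"]
        by (auto simp: b_def path_join_def path_reverse_def min_def max_def)
    qed
  qed
  finally show ?thesis .
qed

text \<open>With a constant top side, the path along three sides has the same image under
  \<open>K\<close> as the path \<open>a\<close>, which only goes up and down the left side and so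
  shrinks to the corner.\<close>

lemma loop_class_free_nullhomotopy:
  fixes K :: "real \<times> real \<Rightarrow> 'a"
  assumes K: "continuous_map (prod_topology I01 I01) X K"
    and sides: "\<And>u. u \<in> {0..1} \<Longrightarrow> K (0, u) = K (1, u)"
    and top: "\<And>t. t \<in> {0..1} \<Longrightarrow> K (t, 1) = K (0, 1)"
  shows "loop_class X (K (0, 0)) (\<lambda>t. K (t, 0)) = loop_class X (K (0, 0)) (\<lambda>_. K (0, 0))"
    (is "?L = ?R")
proof -
  define b where "b = (\<lambda>t::real. (max 0 (min 1 (4 * t - 1)), min 1 (min (4 * t) (2 - 2 * t))))"
  define a where "a = (\<lambda>t::real. (0::real, min 1 (min (4 * t) (2 - 2 * t))))"
  have b: "continuous_on {0..1} b" unfolding b_def by (intro continuous_intros)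
  have bI: "b ` {0..1} \<subseteq> {0..1} \<times> {0..1}" by (auto simp: b_def)
  have a: "continuous_on {0..1} a" unfolding a_def by (intro continuous_intros)
  have aI: "a ` {0..1} \<subseteq> {0..1} \<times> {0..1}" by (auto simp: a_def)
  have "?L = loop_class X (K (0, 0)) (\<lambda>t. K (b t))"
    by (rule loop_class_square[OF K _ _ b bI]) (use sides[of 0] in \<open>auto simp: b_def intro!: continuous_intros\<close>)
  also have "\<dots> = loop_class X (K (0, 0)) (\<lambda>t. K (a t))"
  proof (rule loop_class_cong)
    have "continuous_map I01 (prod_topology I01 I01) b"
      using b bI by (auto simp: continuous_map_in_subtopology simp flip: subtopology_Times)
    from continuous_map_compose[OF this K]
    show "loop_at X (K (0, 0)) (\<lambda>t. K (b t))"
      using sides[of 0] by (simp add: loop_at_def pathin_def o_def b_def)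
    show "K (b t) = K (a t)" if "t \<in> {0..1}" for t
      using that sides[of "2 - 2 * t"] top[of "4 * t - 1"]
      by (auto simp: a_def b_def min_def max_def)
  qed
  also have "\<dots> = loop_class X (K (0, 0)) (\<lambda>t. K ((\<lambda>_. (0, 0)) t))"
    by (rule loop_class_square[OF K a aI]) (auto simp: a_def)
  finally show ?thesis .
qed

lemma simply_connected_spaceI:
  assumes "path_connected_space X"
    and null: "\<And>x g. x \<in> topspace X \<Longrightarrow> loop_at X x g \<Longrightarrow> loop_class X x g = loop_class X x (\<lambda>_. x)"
  shows "simply_connected_space X"
  unfolding simply_connected_space_def
proof (intro conjI ballI)
  fix x assume x: "x \<in> topspace X"
  then have "loop_at X x (\<lambda>_. x)" by (simp add: loop_at_def pathin_def)
  then have "{loop_class X x g | g. loop_at X x g} = {loop_class X x (\<lambda>_. x)}"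
    using null[OF x] by blast
  then show "carrier (fundamental_group X x) = {\<one>\<^bsub>fundamental_group X x\<^esub>}"
    by (simp add: fundamental_group_def)
qed (use assms in simp)

section \<open>Families of circle-valued maps with disjoint supports\<close>

lemma floor_eq_if_no_integer_value:
  fixes g :: "real \<Rightarrow> real"
  assumes "continuous_on {0..1} g" "\<And>t. t \<in> {0..1} \<Longrightarrow> g t \<notin> \<int>"
  shows "\<lfloor>g 0\<rfloor> = \<lfloor>g 1\<rfloor>"
proof (rule ccontr)
  have conn: "connected (g ` {0..1})" using assms by (intro connected_continuous_image) auto
  have *: False if ab: "a \<in> g ` {0..1}" "b \<in> g ` {0..1}" "\<lfloor>a\<rfloor> < \<lfloor>b\<rfloor>" for a b
  proof -
    have "a \<le> of_int \<lfloor>b\<rfloor>" using ab(3) by linarith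
    then have "of_int \<lfloor>b\<rfloor> \<in> g ` {0..1}"
      by (intro connectedD_interval[OF conn ab(1,2)]) auto
    then show False using assms(2) by (metis Ints_of_int imageE)
  qed
  assume "\<lfloor>g 0\<rfloor> \<noteq> \<lfloor>g 1\<rfloor>"
  then show False using *[of "g 0" "g 1"] *[of "g 1" "g 0"] by force
qed

lemma nonint_floor_iff:
  fixes x :: real
  shows "x \<notin> \<int> \<and> \<lfloor>x\<rfloor> = n \<longleftrightarrow> of_int n < x \<and> x < of_int n + 1"
proof
  assume "x \<notin> \<int> \<and> \<lfloor>x\<rfloor> = n"
  moreover from this have "x \<noteq> of_int n" by (metis Ints_of_int)
  ultimately show "of_int n < x \<and> x < of_int n + 1" by (auto simp: floor_eq_iff)
next
  assume n: "of_int n < x \<and> x < of_int n + 1"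
  then have "x \<notin> \<int>" by (auto elim!: Ints_cases)
  then show "x \<notin> \<int> \<and> \<lfloor>x\<rfloor> = n" using n by (auto simp: floor_eq_iff)
qed

text \<open>What the contraction uses of the universal object; universality enters only as
  \<open>lift\<close>. Indices are integers because \<open>\<theta> j\<close> stands for a circle
  relative to height 0: in the sheet at height \<open>k\<close> it is the angle of index
  \<open>j + k\<close>.\<close>

locale circle_family =
  fixes Y :: "'y topology" and \<theta> :: "int \<Rightarrow> 'y \<Rightarrow> complex"
  assumes path_connected: "path_connected_space Y"
    and cont: "continuous_map Y euclidean (\<theta> j)"
    and unit: "v \<in> topspace Y \<Longrightarrow> norm (\<theta> j v) = 1"
    and disjoint: "v \<in> topspace Y \<Longrightarrow> \<theta> i v \<noteq> 1 \<Longrightarrow> \<theta> j v \<noteq> 1 \<Longrightarrow> i = j"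
    and lift: "continuous_map Y euclidean \<phi> \<Longrightarrow> (\<And>v. v \<in> topspace Y \<Longrightarrow> norm (\<phi> v) = 1) \<Longrightarrow>
      \<exists>c. continuous_map Y euclideanreal c \<and> (\<forall>v\<in>topspace Y. \<phi> v = cis (2 * pi * c v))"
begin

definition arcs :: "int \<Rightarrow> 'y set" where
  "arcs j = {v \<in> topspace Y. \<theta> j v \<noteq> 1}"

text \<open>A relatively clopen part of \<open>arcs j\<close>. It replaces a union of components,
  which need not be open since \<open>Y\<close> is not assumed to be locally connected.\<close>

definition piece :: "int \<Rightarrow> 'y set \<Rightarrow> bool" where
  "piece j D \<longleftrightarrow> D \<subseteq> arcs j \<and> openin Y D \<and> openin Y (arcs j - D)"

definition cut :: "int \<Rightarrow> 'y set \<Rightarrow> 'y \<Rightarrow> complex" where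
  "cut j D v = (if v \<in> D then \<theta> j v else 1)"

definition coord :: "int \<Rightarrow> 'y set \<Rightarrow> ('y \<Rightarrow> real) \<Rightarrow> bool" where
  "coord j D c \<longleftrightarrow> piece j D \<and> continuous_map Y euclideanreal c \<and>
     (\<forall>v\<in>topspace Y. cut j D v = cis (2 * pi * c v))"

text \<open>A coordinate is an integer exactly outside its piece \<open>D\<close>, and along a path it changes by the signed
  number of crossings of the components of \<open>D\<close>.\<close>

definition coords :: "('y \<Rightarrow> real) set" where
  "coords = {c. \<exists>j D. coord j D c}"

text \<open>Tree-like behaviour is available only modulo this relation. It is an intersection of
  closed conditions, one for each coordinate, which is what the compactness arguments
  exploit.\<close>

definition eqv :: "'y \<Rightarrow> 'y \<Rightarrow> bool" where
  "eqv v w \<longleftrightarrow> v \<in> topspace Y \<and> w \<in> topspace Y \<and> (\<forall>c\<in>coords. c v = c w)"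

text \<open>Coordinate paths are more flexible than paths in \<open>Y\<close>: they can be joined at points that are
  merely equivalent.\<close>

definition coord_path :: "(real \<Rightarrow> 'y) \<Rightarrow> bool" where
  "coord_path \<alpha> \<longleftrightarrow> \<alpha> ` {0..1} \<subseteq> topspace Y \<and> (\<forall>c\<in>coords. continuous_on {0..1} (c \<circ> \<alpha>))"

lemma openin_vimage:
  "continuous_map Y euclidean (f :: 'y \<Rightarrow> 'b::topological_space) \<Longrightarrow> open U \<Longrightarrow> openin Y {v \<in> topspace Y. f v \<in> U}"
  by (rule openin_continuous_map_preimage) auto

text \<open>The preimage of an open set containing 1 gains the open set \<open>arcs j - D\<close>;
  that of an open set without 1 is cut down to the open set \<open>D\<close>.\<close>

lemma continuous_cut:
  assumes "piece j D"
  shows "continuous_map Y euclidean (cut j D)"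
  unfolding continuous_map_def
proof (intro conjI allI impI)
  fix U :: "complex set" assume "openin euclidean U"
  then have U: "open U" by simp
  note pre = openin_vimage[OF cont this, of j]
  show "openin Y {v \<in> topspace Y. cut j D v \<in> U}"
  proof (cases "1 \<in> U")
    case True
    then have "{v \<in> topspace Y. cut j D v \<in> U} = {v \<in> topspace Y. \<theta> j v \<in> U} \<union> (arcs j - D)"
      by (auto simp: cut_def arcs_def)
    then show ?thesis using pre assms by (auto simp: piece_def)
  next
    case False
    then have "{v \<in> topspace Y. cut j D v \<in> U} = {v \<in> topspace Y. \<theta> j v \<in> U} \<inter> D"
      using assms by (auto simp: cut_def arcs_def piece_def)
    then show ?thesis using pre assms by (auto simp: piece_def)
  qed
qed simp

lemma coord_exists: "piece j D \<Longrightarrow> \<exists>c. coord j D c"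
  using lift[OF continuous_cut, of j D] unit by (auto simp: coord_def cut_def)

lemma cis_eq_1_iff: "cis (2 * pi * x) = 1 \<longleftrightarrow> x \<in> \<int>"
  using cis_2pi_eq_iff[of x 0] by simp

lemma coord_nonint_iff:
  assumes "coord j D c" "v \<in> topspace Y"
  shows "c v \<notin> \<int> \<longleftrightarrow> v \<in> D"
proof -
  have "D \<subseteq> arcs j" "cut j D v = cis (2 * pi * c v)" using assms by (auto simp: coord_def piece_def)
  then show ?thesis by (auto simp: cut_def arcs_def simp flip: cis_eq_1_iff split: if_splits)
qed

lemma coord_cis:
  assumes "coord j D c" "v \<in> D"
  shows "\<theta> j v = cis (2 * pi * c v)" "v \<in> topspace Y"
proof -
  show "v \<in> topspace Y" using assms by (auto simp: coord_def piece_def arcs_def)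
  then show "\<theta> j v = cis (2 * pi * c v)" using assms by (auto simp: coord_def cut_def)
qed

text \<open>Two lifts of the same circle-valued map differ by an integer, which is constant along
  paths. So a piece determines its coordinate up to an additive integer, and quantities invariant
  under such shifts belong to the piece alone.\<close>

lemma coord_diff:
  assumes "coord j D c" "coord j D c'" "v \<in> topspace Y" "w \<in> topspace Y"
  shows "c v - c' v = c w - c' w" "c v - c' v \<in> \<int>"
proof -
  have int: "c v - c' v \<in> \<int>" if "v \<in> topspace Y" for v
    using assms(1,2) that by (auto simp: coord_def simp flip: cis_2pi_eq_iff)
  show "c v - c' v \<in> \<int>" using int assms by blast
  obtain \<alpha> where \<alpha>: "pathin Y \<alpha>" "\<alpha> 0 = v" "\<alpha> 1 = w"
    using path_connected assms(3,4) unfolding path_connected_space_def by blast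
  have "pathin euclideanreal (c \<circ> \<alpha>)" "pathin euclideanreal (c' \<circ> \<alpha>)"
    using assms(1,2) pathin_compose[OF \<alpha>(1)] unfolding coord_def by blast+
  then have "continuous_on {0..1} (\<lambda>t. c (\<alpha> t) - c' (\<alpha> t))"
    by (intro continuous_intros) (auto simp: path_def o_def)
  moreover have "c (\<alpha> t) - c' (\<alpha> t) \<in> \<int>" if "t \<in> {0..1}" for t
    using int funcset_mem[OF path_image_subset_topspace[OF \<alpha>(1)] that] by blast
  ultimately have "c (\<alpha> 0) - c' (\<alpha> 0) = c (\<alpha> 1) - c' (\<alpha> 1)"
    by (rule Ints_valued_constant[rotated]) auto
  then show "c v - c' v = c w - c' w" using \<alpha> by simp
qed

text \<open>On disjoint pieces at most one of the two cut maps differs from 1 at a point, so their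
  product is the cut map of the union, and the lifts add up.\<close>

lemma coord_add:
  assumes "coord j D1 c1" "coord j D2 c2" "D1 \<inter> D2 = {}"
  shows "coord j (D1 \<union> D2) (\<lambda>v. c1 v + c2 v)"
  unfolding coord_def
proof (intro conjI ballI)
  have "arcs j - (D1 \<union> D2) = (arcs j - D1) \<inter> (arcs j - D2)" by auto
  then show "piece j (D1 \<union> D2)" using assms by (auto simp: coord_def piece_def)
  show "continuous_map Y euclideanreal (\<lambda>v. c1 v + c2 v)"
    using assms by (intro continuous_intros) (auto simp: coord_def)
  fix v assume "v \<in> topspace Y"
  then have "cut j D1 v = cis (2 * pi * c1 v)" "cut j D2 v = cis (2 * pi * c2 v)"
    using assms by (auto simp: coord_def)
  moreover have "cut j (D1 \<union> D2) v = cut j D1 v * cut j D2 v"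
    using assms(3) by (auto simp: cut_def)
  ultimately show "cut j (D1 \<union> D2) v = cis (2 * pi * (c1 v + c2 v))"
    by (simp add: cis_mult distrib_left)
qed

section \<open>Crossing numbers of pieces\<close>

text \<open>The net number of upward passages of \<open>c\<close> through the levels
  \<open>\<rho> + n\<close>, for integers \<open>n\<close>, on a path from \<open>x\<close> to
  \<open>y\<close>. Only the values at the ends enter, which allows one path to be exchanged for
  another.\<close>

definition crossing :: "real \<Rightarrow> ('y \<Rightarrow> real) \<Rightarrow> 'y \<Rightarrow> 'y \<Rightarrow> int" where
  "crossing \<rho> c x y = \<lfloor>c y - \<rho>\<rfloor> - \<lfloor>c x - \<rho>\<rfloor>"

lemma crossing_cong:
  assumes "coord j D c" "coord j D c'" "x \<in> topspace Y" "y \<in> topspace Y"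
  shows "crossing \<rho> c x y = crossing \<rho> c' x y"
proof -
  obtain k :: int where k: "c x - c' x = of_int k"
    using coord_diff(2)[OF assms(1,2,3,4)] by (auto elim: Ints_cases)
  then have "c x - \<rho> = (c' x - \<rho>) + of_int k" "c y - \<rho> = (c' y - \<rho>) + of_int k"
    using coord_diff(1)[OF assms] by auto
  then show ?thesis unfolding crossing_def by (metis add_diff_cancel_right floor_add_int)
qed

lemma crossing_add:
  assumes "coord j D1 c1" "coord j D2 c2" "D1 \<inter> D2 = {}" "\<rho> \<notin> \<int>" "x \<in> topspace Y" "y \<in> topspace Y"
  shows "crossing \<rho> (\<lambda>v. c1 v + c2 v) x y = crossing \<rho> c1 x y + crossing \<rho> c2 x y"
proof -
  \<comment> \<open>An integer summand can be pulled out of the floor. The error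
    \<open>\<lfloor>- \<rho>\<rfloor>\<close> is the same at both end points and cancels in the
    difference. This applies because at every point one of the two coordinates is an
    integer.\<close>
  have *: "\<lfloor>a + b - \<rho>\<rfloor> = \<lfloor>a - \<rho>\<rfloor> + \<lfloor>b - \<rho>\<rfloor> - \<lfloor>- \<rho>\<rfloor>" if "a \<in> \<int>" for a b
  proof -
    obtain k :: int where "a = of_int k" using \<open>a \<in> \<int>\<close> by (auto elim: Ints_cases)
    then show ?thesis
      using floor_add_int[of "b - \<rho>" k] floor_add_int[of "- \<rho>" k] by (simp add: algebra_simps)
  qed
  have "\<lfloor>c1 v + c2 v - \<rho>\<rfloor> = \<lfloor>c1 v - \<rho>\<rfloor> + \<lfloor>c2 v - \<rho>\<rfloor> - \<lfloor>- \<rho>\<rfloor>" if v: "v \<in> topspace Y" for v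
  proof -
    have "c1 v \<in> \<int> \<or> c2 v \<in> \<int>"
      using coord_nonint_iff[OF assms(1) v] coord_nonint_iff[OF assms(2) v] assms(3) by blast
    then show ?thesis using *[of "c1 v" "c2 v"] *[of "c2 v" "c1 v"] by (auto simp: add.commute)
  qed
  then show ?thesis using assms by (simp add: crossing_def)
qed

lemma crossing_imp_hit:
  assumes "coord_path \<alpha>" "coord j D c" "crossing \<rho> c (\<alpha> 0) (\<alpha> 1) \<noteq> 0"
  obtains t where "t \<in> {0..1}" "c (\<alpha> t) - \<rho> \<in> \<int>"
proof -
  have "c \<in> coords" using assms(2) by (auto simp: coords_def)
  then have "continuous_on {0..1} (c \<circ> \<alpha>)" using assms(1) by (auto simp: coord_path_def)
  then have "continuous_on {0..1} (\<lambda>t. c (\<alpha> t) - \<rho>)" by (intro continuous_intros) (auto simp: o_def)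
  from floor_eq_if_no_integer_value[OF this] show ?thesis
    using assms(3) that unfolding crossing_def by fastforce
qed

lemma coord_path_subset: "coord_path \<alpha> \<Longrightarrow> t \<in> {0..1} \<Longrightarrow> \<alpha> t \<in> topspace Y"
  by (auto simp: coord_path_def)

section \<open>Splitting a piece by finitely many coordinates\<close>

text \<open>For an integer value the key holds the value itself, otherwise the gap between
  consecutive integers that contains it. So it leaves only the fractional part open, and that is
  governed by the angle \<open>\<theta>\<close>.\<close>

definition key :: "('y \<Rightarrow> real) set \<Rightarrow> 'y \<Rightarrow> ('y \<Rightarrow> real) \<Rightarrow> bool \<times> int" where
  "key F v = restrict (\<lambda>c. (c v \<in> \<int>, \<lfloor>c v\<rfloor>)) F"

text \<open>To have an integer value is not an open condition in general, but it is one inside a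
  piece \<open>D\<close>: there it means lying outside the piece \<open>E\<close> of the coordinate,
  and \<open>D - E\<close> is open, being all of \<open>D\<close> if the indices differ.\<close>

lemma openin_key_fiber:
  assumes F: "finite F" "F \<subseteq> coords" and D: "piece j D" and w: "w \<in> D"
  shows "openin Y {v \<in> D. key F v = key F w}"
proof -
  have DY: "D \<subseteq> topspace Y" using D by (auto simp: piece_def arcs_def)
  have "openin Y {v \<in> D. (c v \<in> \<int> \<longleftrightarrow> c w \<in> \<int>) \<and> \<lfloor>c v\<rfloor> = \<lfloor>c w\<rfloor>}" if "c \<in> F" for c
  proof -
    obtain i E where c: "coord i E c" using F \<open>c \<in> F\<close> by (auto simp: coords_def)
    have cc: "continuous_map Y euclideanreal c" using c by (auto simp: coord_def)
    have oD: "openin Y D" using D by (auto simp: piece_def)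
    obtain n :: int where n: "n = \<lfloor>c w\<rfloor>" by simp
    show ?thesis
    proof (cases "c w \<in> \<int>")
      case False
      have "{v \<in> D. (c v \<in> \<int> \<longleftrightarrow> c w \<in> \<int>) \<and> \<lfloor>c v\<rfloor> = \<lfloor>c w\<rfloor>} = D \<inter> {v \<in> topspace Y. c v \<in> {of_int n<..<of_int n + 1}}"
        using DY False nonint_floor_iff[of _ n] unfolding n[symmetric] by auto
      then show ?thesis using openin_vimage[OF cc, of "{of_int n<..<of_int n + 1}"] oD by auto
    next
      case True
      then have cw: "c w = of_int n" using n by (auto elim: Ints_cases)
      have oDE: "openin Y (D - E)"
      proof (cases "i = j")
        case True
        then have "D - E = D \<inter> (arcs j - E)" using D by (auto simp: piece_def)
        then show ?thesis using c oD True by (auto simp: coord_def piece_def)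
      next
        case False
        then have "D - E = D"
          using disjoint[of _ i j] c D by (fastforce simp: coord_def piece_def arcs_def)
        then show ?thesis using oD by simp
      qed
      \<comment> \<open>On \<open>D - E\<close> the coordinate is an integer, so an open interval of
        length 2 around \<open>n\<close> isolates the value \<open>n\<close>.\<close>
      have "{v \<in> D. (c v \<in> \<int> \<longleftrightarrow> c w \<in> \<int>) \<and> \<lfloor>c v\<rfloor> = \<lfloor>c w\<rfloor>} = (D - E) \<inter> {v \<in> topspace Y. c v \<in> {of_int n - 1<..<of_int n + 1}}"
      proof (intro equalityI subsetI)
        fix v assume "v \<in> {v \<in> D. (c v \<in> \<int> \<longleftrightarrow> c w \<in> \<int>) \<and> \<lfloor>c v\<rfloor> = \<lfloor>c w\<rfloor>}"
        then show "v \<in> (D - E) \<inter> {v \<in> topspace Y. c v \<in> {of_int n - 1<..<of_int n + 1}}"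
          using coord_nonint_iff[OF c, of v] DY True n by (auto elim!: Ints_cases)
      next
        fix v assume v: "v \<in> (D - E) \<inter> {v \<in> topspace Y. c v \<in> {of_int n - 1<..<of_int n + 1}}"
        then have "c v \<in> \<int>" using coord_nonint_iff[OF c, of v] by auto
        then obtain m :: int where "c v = of_int m" by (auto elim: Ints_cases)
        moreover have "m = n" using v calculation by auto
        ultimately show "v \<in> {v \<in> D. (c v \<in> \<int> \<longleftrightarrow> c w \<in> \<int>) \<and> \<lfloor>c v\<rfloor> = \<lfloor>c w\<rfloor>}"
          using v cw by simp
      qed
      then show ?thesis using openin_vimage[OF cc, of "{of_int n - 1<..<of_int n + 1}"] oDE by auto
    qed
  qed
  then have "openin Y (D \<inter> \<Inter> ((\<lambda>c. {v \<in> D. (c v \<in> \<int> \<longleftrightarrow> c w \<in> \<int>) \<and> \<lfloor>c v\<rfloor> = \<lfloor>c w\<rfloor>}) ` F))"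
    using F D by (intro openin_Int_Inter) (auto simp: piece_def)
  moreover have "{v \<in> D. key F v = key F w} = D \<inter> \<Inter> ((\<lambda>c. {v \<in> D. (c v \<in> \<int> \<longleftrightarrow> c w \<in> \<int>) \<and> \<lfloor>c v\<rfloor> = \<lfloor>c w\<rfloor>}) ` F)"
    by (auto simp: key_def restrict_def fun_eq_iff)
  ultimately show ?thesis by simp
qed

text \<open>The points of \<open>D\<close> that satisfy a condition on the key and those that
  violate it both form unions of open key fibres. The new pieces have coordinates of their own,
  available for further splitting; this makes coordinates sensitive to the order of
  crossings.\<close>

lemma piece_key:
  assumes "finite F" "F \<subseteq> coords" "piece j D"
  shows "piece j {v \<in> D. P (key F v)}"
proof -
  have op: "openin Y {v \<in> D. Q (key F v)}" for Q
  proof -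
    have "{v \<in> D. Q (key F v)} = (\<Union>w\<in>{v \<in> D. Q (key F v)}. {v \<in> D. key F v = key F w})" by auto
    moreover have "openin Y (\<Union>w\<in>{v \<in> D. Q (key F v)}. {v \<in> D. key F v = key F w})"
      using openin_key_fiber[OF assms] by blast
    ultimately show ?thesis by simp
  qed
  have "arcs j - {v \<in> D. P (key F v)} = (arcs j - D) \<union> {v \<in> D. \<not> P (key F v)}"
    using assms(3) by (auto simp: piece_def)
  then show ?thesis using op[of P] op[of "\<lambda>k. \<not> P k"] assms(3) by (auto simp: piece_def)
qed

text \<open>The crossing number of a finite union of key fibres is the sum over the fibres, so some
  summand is non-zero. For the empty union the coordinate is integer-valued and never meets a level
  that differs from \<open>\<rho>\<close> by an integer.\<close>

lemma crossing_finite_keys: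
  assumes F: "finite F" "F \<subseteq> coords" and D: "piece j D" and \<alpha>: "coord_path \<alpha>" and \<rho>: "\<rho> \<notin> \<int>"
    and "finite \<K>" "coord j {v \<in> D. key F v \<in> \<K>} c" "crossing \<rho> c (\<alpha> 0) (\<alpha> 1) \<noteq> 0"
  shows "\<exists>\<kappa>\<in>\<K>. \<exists>c'. coord j {v \<in> D. key F v = \<kappa>} c' \<and> crossing \<rho> c' (\<alpha> 0) (\<alpha> 1) \<noteq> 0"
  using assms(6-8)
proof (induction \<K> arbitrary: c)
  case empty
  have "c v \<in> \<int>" if "v \<in> topspace Y" for v
    using coord_nonint_iff[OF empty(1) that] by auto
  moreover obtain t where "t \<in> {0..1}" "c (\<alpha> t) - \<rho> \<in> \<int>"
    using crossing_imp_hit[OF \<alpha> empty(1,2)] by blast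
  ultimately have "c (\<alpha> t) - (c (\<alpha> t) - \<rho>) \<in> \<int>"
    using coord_path_subset[OF \<alpha>] by (intro Ints_diff) auto
  then show ?case using \<rho> by simp
next
  case (insert \<kappa> \<K>)
  have \<alpha>Y: "\<alpha> 0 \<in> topspace Y" "\<alpha> 1 \<in> topspace Y" using coord_path_subset[OF \<alpha>] by auto
  obtain c1 c2 where c1: "coord j {v \<in> D. key F v = \<kappa>} c1" and c2: "coord j {v \<in> D. key F v \<in> \<K>} c2"
    using coord_exists[OF piece_key[OF F D, of "\<lambda>k. k = \<kappa>"]]
      coord_exists[OF piece_key[OF F D, of "\<lambda>k. k \<in> \<K>"]] by blast
  have disj: "{v \<in> D. key F v = \<kappa>} \<inter> {v \<in> D. key F v \<in> \<K>} = {}" using insert(2) by auto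
  have "{v \<in> D. key F v = \<kappa>} \<union> {v \<in> D. key F v \<in> \<K>} = {v \<in> D. key F v \<in> insert \<kappa> \<K>}" by auto
  then have "coord j {v \<in> D. key F v \<in> insert \<kappa> \<K>} (\<lambda>v. c1 v + c2 v)"
    using coord_add[OF c1 c2 disj] by simp
  from crossing_cong[OF this insert(4) \<alpha>Y] crossing_add[OF c1 c2 disj \<rho> \<alpha>Y] insert(5)
  have "crossing \<rho> c1 (\<alpha> 0) (\<alpha> 1) \<noteq> 0 \<or> crossing \<rho> c2 (\<alpha> 0) (\<alpha> 1) \<noteq> 0" by auto
  then show ?case using c1 insert.IH[OF c2] by blast
qed


text \<open>Fix a coordinate of a piece \<open>D\<close> that separates the end points, and a generic value \<open>r\<close> between its
  values there. Given finitely many further coordinates, \<open>D\<close> splits into pieces on which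
  these are determined by their keys and the coordinate of \<open>D\<close> modulo \<open>1\<close>. As crossing numbers
  are additive, one of these pieces has a non-zero crossing number, which depends on the end points
  only; hence both paths cross it. Compactness extends this to all coordinates.\<close>

lemma coord_path_common_point:
  assumes \<alpha>: "coord_path \<alpha>" and \<sigma>: "coord_path \<sigma>"
    and ends: "eqv (\<alpha> 0) (\<sigma> 0)" "eqv (\<alpha> 1) (\<sigma> 1)" and neq: "\<not> eqv (\<alpha> 0) (\<alpha> 1)"
  obtains a b where "a \<in> {0..1}" "b \<in> {0..1}" "eqv (\<alpha> a) (\<sigma> b)"
    "\<not> eqv (\<alpha> a) (\<alpha> 0)" "\<not> eqv (\<alpha> a) (\<alpha> 1)"
proof -
  have \<alpha>Y: "\<alpha> t \<in> topspace Y" and \<sigma>Y: "\<sigma> t \<in> topspace Y" if "t \<in> {0..1}" for t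
    using coord_path_subset \<alpha> \<sigma> that by auto
  obtain c j D where c: "coord j D c" "c (\<alpha> 0) \<noteq> c (\<alpha> 1)"
    using neq \<alpha>Y[of 0] \<alpha>Y[of 1] by (auto simp: eqv_def coords_def)
  have D: "piece j D" and ccoords: "c \<in> coords" using c by (auto simp: coord_def coords_def)
  \<comment> \<open>All but countably many levels qualify. Since \<open>r\<close> is not an integer,
    its translates are attained only inside \<open>D\<close>; the last two conditions keep the
    common point away from both ends.\<close>
  obtain r where r: "min (c (\<alpha> 0)) (c (\<alpha> 1)) < r" "r < max (c (\<alpha> 0)) (c (\<alpha> 1))"
    "r \<notin> \<int>" "r - c (\<alpha> 0) \<notin> \<int>" "r - c (\<alpha> 1) \<notin> \<int>"
  proof -
    define B where "B = \<int> \<union> range (\<lambda>n::int. c (\<alpha> 0) + of_int n) \<union> range (\<lambda>n::int. c (\<alpha> 1) + of_int n)"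
    have "countable B" by (auto simp: B_def Ints_def)
    moreover have "uncountable {min (c (\<alpha> 0)) (c (\<alpha> 1))<..<max (c (\<alpha> 0)) (c (\<alpha> 1))}"
      using c(2) by (simp add: uncountable_open_interval)
    ultimately have "\<not> {min (c (\<alpha> 0)) (c (\<alpha> 1))<..<max (c (\<alpha> 0)) (c (\<alpha> 1))} \<subseteq> B"
      using countable_subset by blast
    then obtain r where "r \<in> {min (c (\<alpha> 0)) (c (\<alpha> 1))<..<max (c (\<alpha> 0)) (c (\<alpha> 1))}" "r \<notin> B"
      by blast
    moreover have "r - x \<notin> \<int>" if "r \<notin> range (\<lambda>n::int. x + of_int n)" for x
      using that by (auto elim!: Ints_cases simp: diff_eq_eq add.commute)
    ultimately show ?thesis using that[of r] by (auto simp: B_def)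
  qed
  define hit where "hit = (\<lambda>t. c (\<alpha> t) - r \<in> \<int>)"
  have c\<alpha>: "continuous_on {0..1} (\<lambda>t. e (\<alpha> t))" and c\<sigma>: "continuous_on {0..1} (\<lambda>t. e (\<sigma> t))"
    if "e \<in> coords" for e
    using \<alpha> \<sigma> that by (auto simp: coord_path_def o_def)
  have hitD: "\<alpha> t \<in> D" if "hit t" "t \<in> {0..1}" for t
  proof -
    have "c (\<alpha> t) \<notin> \<int>"
    proof
      assume "c (\<alpha> t) \<in> \<int>"
      then have "c (\<alpha> t) - (c (\<alpha> t) - r) \<in> \<int>" using that by (intro Ints_diff) (auto simp: hit_def)
      then show False using r(3) by simp
    qed
    then show ?thesis using coord_nonint_iff[OF c(1) \<alpha>Y[OF that(2)]] by simp
  qed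
  have cross: "crossing r c (\<alpha> 0) (\<alpha> 1) \<noteq> 0"
  proof -
    have *: "\<lfloor>x - r\<rfloor> < \<lfloor>y - r\<rfloor>" if "x < r" "r < y" for x y
      using that zero_le_floor[of "y - r"] floor_less_zero[of "x - r"] by linarith
    have "c (\<alpha> 0) < r \<and> r < c (\<alpha> 1) \<or> c (\<alpha> 1) < r \<and> r < c (\<alpha> 0)"
      using r(1,2) by linarith
    then show ?thesis
      using *[of "c (\<alpha> 0)" "c (\<alpha> 1)"] *[of "c (\<alpha> 1)" "c (\<alpha> 0)"] by (auto simp: crossing_def)
  qed
  have sub: "\<exists>a\<in>{0..1}. \<exists>b\<in>{0..1}. hit a \<and> (\<forall>e\<in>F. e (\<alpha> a) = e (\<sigma> b))"
    if F: "finite F" "F \<subseteq> coords" for F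
  proof -
    define P where "P = (\<lambda>\<kappa>. {v \<in> D. key F v = \<kappa>})"
    have "\<exists>e. coord j (P \<kappa>) e" for \<kappa>
      unfolding P_def using coord_exists[OF piece_key[OF F D, of "\<lambda>k. k = \<kappa>"]] .
    then obtain e where e: "\<And>\<kappa>. coord j (P \<kappa>) (e \<kappa>)" by metis
    have ecoords: "e \<kappa> \<in> coords" for \<kappa> using e by (auto simp: coords_def)
    \<comment> \<open>There may be infinitely many keys, while crossing numbers are only finitely
      additive. The hits of \<open>\<alpha>\<close> form a compact set, so finitely many keys
      account for all of them.\<close>
    define A where "A = {t \<in> {0..1}. hit t}"
    have "closed ({0..1} \<inter> (\<lambda>t. c (\<alpha> t) - r) -` \<int>)"
      by (intro continuous_closed_preimage continuous_intros c\<alpha> ccoords closed_Ints)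
    then have "compact ({0..1} \<inter> ({0..1} \<inter> (\<lambda>t. c (\<alpha> t) - r) -` \<int>))"
      by (intro compact_Int_closed) auto
    moreover have "A = {0..1} \<inter> ({0..1} \<inter> (\<lambda>t. c (\<alpha> t) - r) -` \<int>)"
      by (auto simp: A_def hit_def)
    ultimately have compA: "compact A" by simp
    define O' where "O' = (\<lambda>\<kappa>. {t \<in> A. \<alpha> t \<in> P \<kappa>})"
    have "openin (top_of_set A) (O' \<kappa>)" for \<kappa>
    proof -
      have "continuous_on A (\<lambda>t. e \<kappa> (\<alpha> t))"
        using c\<alpha>[OF ecoords] by (rule continuous_on_subset) (auto simp: A_def)
      then have "openin (top_of_set A) (A \<inter> (\<lambda>t. e \<kappa> (\<alpha> t)) -` (- \<int>))"
        by (rule continuous_openin_preimage_gen) (simp add: closed_Ints open_Compl)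
      moreover have "A \<inter> (\<lambda>t. e \<kappa> (\<alpha> t)) -` (- \<int>) = O' \<kappa>"
        using coord_nonint_iff[OF e \<alpha>Y] by (auto simp: O'_def A_def)
      ultimately show ?thesis by simp
    qed
    moreover have "A \<subseteq> \<Union> (range O')"
      using hitD by (auto simp: O'_def A_def P_def)
    ultimately have "\<exists>\<O>\<subseteq>range O'. finite \<O> \<and> A \<subseteq> \<Union> \<O>"
      using compA[unfolded compact_eq_openin_cover, rule_format, of "range O'"] by blast
    then obtain \<O> where "\<O> \<subseteq> range O'" "finite \<O>" "A \<subseteq> \<Union> \<O>" by blast
    then obtain \<K> where \<K>: "finite \<K>" "A \<subseteq> \<Union> (O' ` \<K>)"
      using finite_subset_image[of \<O> O' UNIV] by blast
    obtain c1 c2 where c1: "coord j {v \<in> D. key F v \<in> \<K>} c1" and c2: "coord j {v \<in> D. key F v \<notin> \<K>} c2"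
      using coord_exists[OF piece_key[OF F D, of "\<lambda>k. k \<in> \<K>"]]
        coord_exists[OF piece_key[OF F D, of "\<lambda>k. k \<notin> \<K>"]] by blast
    have same: "c v - e' v \<in> \<int>" if "coord j E e'" "v \<in> D" "v \<in> E" for e' E v
      using coord_cis[OF c(1) that(2)] coord_cis[OF that(1,3)] by (simp flip: cis_2pi_eq_iff)
    have key_hit: "v \<in> E \<and> c v - r \<in> \<int>"
      if "coord j E e'" "e' v - r \<in> \<int>" "E \<subseteq> D" "v \<in> topspace Y" for e' E v
    proof -
      have "e' v \<notin> \<int>"
      proof
        assume "e' v \<in> \<int>"
        then have "e' v - (e' v - r) \<in> \<int>" using that by (intro Ints_diff) auto
        then show False using r(3) by simp
      qed
      then have "v \<in> E" using coord_nonint_iff[OF that(1,4)] by simp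
      moreover have "(c v - e' v) + (e' v - r) \<in> \<int>"
        using same[OF that(1)] that \<open>v \<in> E\<close> by (intro Ints_add) auto
      ultimately show ?thesis by simp
    qed
    have disj: "{v \<in> D. key F v \<in> \<K>} \<inter> {v \<in> D. key F v \<notin> \<K>} = {}" by auto
    have un: "{v \<in> D. key F v \<in> \<K>} \<union> {v \<in> D. key F v \<notin> \<K>} = D" by auto
    \<comment> \<open>All the remaining keys together form one piece, in which
      \<open>\<alpha>\<close> has no hit.\<close>
    have "crossing r c2 (\<alpha> 0) (\<alpha> 1) = 0"
    proof (rule ccontr)
      assume "crossing r c2 (\<alpha> 0) (\<alpha> 1) \<noteq> 0"
      then obtain t where t: "t \<in> {0..1}" "c2 (\<alpha> t) - r \<in> \<int>"
        using crossing_imp_hit[OF \<alpha> c2] by blast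
      from key_hit[OF c2 t(2) _ \<alpha>Y[OF t(1)]] have "key F (\<alpha> t) \<notin> \<K>" "hit t"
        by (auto simp: hit_def)
      then show False using \<K>(2) t(1) by (auto simp: A_def O'_def P_def)
    qed
    moreover have "crossing r c (\<alpha> 0) (\<alpha> 1) = crossing r c1 (\<alpha> 0) (\<alpha> 1) + crossing r c2 (\<alpha> 0) (\<alpha> 1)"
      using crossing_cong[OF c(1) coord_add[OF c1 c2 disj, unfolded un] \<alpha>Y \<alpha>Y]
        crossing_add[OF c1 c2 disj r(3) \<alpha>Y \<alpha>Y] by simp
    ultimately have "crossing r c1 (\<alpha> 0) (\<alpha> 1) \<noteq> 0" using cross by simp
    from crossing_finite_keys[OF F D \<alpha> r(3) \<K>(1) c1 this]
    obtain \<kappa> c' where c': "coord j (P \<kappa>) c'" "crossing r c' (\<alpha> 0) (\<alpha> 1) \<noteq> 0"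
      unfolding P_def by blast
    have "c' \<in> coords" using c'(1) by (auto simp: coords_def)
    then have "c' (\<sigma> 0) = c' (\<alpha> 0)" "c' (\<sigma> 1) = c' (\<alpha> 1)" using ends by (auto simp: eqv_def)
    then have "crossing r c' (\<sigma> 0) (\<sigma> 1) \<noteq> 0" using c'(2) by (simp add: crossing_def)
    then obtain b where b: "b \<in> {0..1}" "c' (\<sigma> b) - r \<in> \<int>"
      using crossing_imp_hit[OF \<sigma> c'(1)] by blast
    obtain a where a: "a \<in> {0..1}" "c' (\<alpha> a) - r \<in> \<int>"
      using crossing_imp_hit[OF \<alpha> c'(1) c'(2)] by blast
    have PD: "P \<kappa> \<subseteq> D" by (auto simp: P_def)
    have ka: "\<alpha> a \<in> P \<kappa>" "c (\<alpha> a) - r \<in> \<int>" and kb: "\<sigma> b \<in> P \<kappa>" "c (\<sigma> b) - r \<in> \<int>"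
      using key_hit[OF c'(1) a(2) PD \<alpha>Y[OF a(1)]] key_hit[OF c'(1) b(2) PD \<sigma>Y[OF b(1)]] by auto
    have "f (\<alpha> a) = f (\<sigma> b)" if f: "f \<in> F" for f
    proof -
      have "key F (\<alpha> a) f = key F (\<sigma> b) f" using ka kb by (simp add: P_def)
      then have k: "f (\<alpha> a) \<in> \<int> \<longleftrightarrow> f (\<sigma> b) \<in> \<int>" "\<lfloor>f (\<alpha> a)\<rfloor> = \<lfloor>f (\<sigma> b)\<rfloor>"
        using f by (auto simp: key_def)
      obtain i E where E: "coord i E f" using F f by (auto simp: coords_def)
      show ?thesis
      proof (cases "f (\<alpha> a) \<in> \<int>")
        case True
        then show ?thesis using k by (auto elim!: Ints_cases)
      next
        case False
        then have vE: "\<alpha> a \<in> E" "\<sigma> b \<in> E"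
          using k(1) coord_nonint_iff[OF E] \<alpha>Y[OF a(1)] \<sigma>Y[OF b(1)] by auto
        have "i = j"
          using disjoint[of "\<alpha> a" i j] vE(1) ka(1) PD E D \<alpha>Y[OF a(1)]
          by (auto simp: coord_def piece_def arcs_def)
        then have fi: "c (\<alpha> a) - f (\<alpha> a) \<in> \<int>" "c (\<sigma> b) - f (\<sigma> b) \<in> \<int>"
          using same[of E f] E vE ka(1) kb(1) PD by auto
        \<comment> \<open>Inside the fibre both \<open>c\<close> and \<open>f\<close> lift
          \<open>\<theta> j\<close>, so modulo integers \<open>f\<close> takes the value
          \<open>r\<close> at both hits; equal floors then force equal values.\<close>
        have "((c (\<alpha> a) - r) - (c (\<sigma> b) - r)) - ((c (\<alpha> a) - f (\<alpha> a)) - (c (\<sigma> b) - f (\<sigma> b))) \<in> \<int>"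
          by (rule Ints_diff[OF Ints_diff[OF ka(2) kb(2)] Ints_diff[OF fi]])
        then have "f (\<alpha> a) - f (\<sigma> b) \<in> \<int>" by (simp add: algebra_simps)
        moreover have "\<bar>f (\<alpha> a) - f (\<sigma> b)\<bar> < 1" using k(2) by linarith
        ultimately show ?thesis using Ints_nonzero_abs_less1 by fastforce
      qed
    qed
    then show ?thesis
      using a(1) b(1) ka(2) by (intro bexI[of _ a] bexI[of _ b]) (auto simp: hit_def)
  qed
  \<comment> \<open>These sets are closed in the unit square, and by \<open>sub\<close> any finitely
    many of them have a common point.\<close>
  define C where "C = (\<lambda>e :: 'y \<Rightarrow> real. {z \<in> {0..1} \<times> {0..1}. hit (fst z) \<and> e (\<alpha> (fst z)) = e (\<sigma> (snd z))})"
  have fst_cont: "continuous_on ({0..1} \<times> {0..1}) (\<lambda>z. e (\<alpha> (fst z)))"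
    and snd_cont: "continuous_on ({0..1} \<times> {0..1}) (\<lambda>z. e (\<sigma> (snd z)))" if "e \<in> coords" for e
    by (rule continuous_on_compose2[OF c\<alpha>[OF that] continuous_on_fst[OF continuous_on_id]]; force)
       (rule continuous_on_compose2[OF c\<sigma>[OF that] continuous_on_snd[OF continuous_on_id]]; force)
  have "({0..1} \<times> {0..1}) \<inter> \<Inter> (C ` coords) \<noteq> {}"
  proof (rule compact_imp_fip_image)
    show "compact ({0..1::real} \<times> {0..1::real})" by (intro compact_Times) auto
    show "closed (C e)" if e: "e \<in> coords" for e
    proof -
      have "closed ({0..1} \<times> {0..1::real} \<inter> (\<lambda>z. c (\<alpha> (fst z)) - r) -` \<int>)"
        by (intro continuous_closed_preimage continuous_intros fst_cont ccoords closed_Times closed_Ints)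
      moreover have "closed ({0..1} \<times> {0..1} \<inter> (\<lambda>z. e (\<alpha> (fst z)) - e (\<sigma> (snd z))) -` {0})"
        by (intro continuous_closed_preimage continuous_intros fst_cont snd_cont e closed_Times closed_singleton)
      moreover have "C e = ({0..1} \<times> {0..1} \<inter> (\<lambda>z. c (\<alpha> (fst z)) - r) -` \<int>) \<inter>
          ({0..1} \<times> {0..1} \<inter> (\<lambda>z. e (\<alpha> (fst z)) - e (\<sigma> (snd z))) -` {0})"
        by (auto simp: C_def hit_def)
      ultimately show ?thesis by auto
    qed
    show "{0..1} \<times> {0..1} \<inter> \<Inter> (C ` F) \<noteq> {}" if "finite F" "F \<subseteq> coords" for F
      using sub[OF that] by (auto simp: C_def)
  qed
  then obtain z where "z \<in> {0..1} \<times> {0..1}" "\<And>e. e \<in> coords \<Longrightarrow> z \<in> C e"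
    by blast
  then obtain a b where ab: "a \<in> {0..1}" "b \<in> {0..1}" "\<And>e. e \<in> coords \<Longrightarrow> (a, b) \<in> C e"
    by (cases z) auto
  have "eqv (\<alpha> a) (\<sigma> b)"
    using ab \<alpha>Y \<sigma>Y by (auto simp: eqv_def C_def)
  moreover have "\<not> eqv (\<alpha> a) x" if "r - c x \<notin> \<int>" for x
  proof
    assume "eqv (\<alpha> a) x"
    then have "c (\<alpha> a) = c x" using ccoords by (auto simp: eqv_def)
    moreover have "c (\<alpha> a) - r \<in> \<int>" using ab(3)[OF ccoords] by (auto simp: C_def hit_def)
    ultimately have "- (c x - r) \<in> \<int>" by (intro Ints_minus) simp
    then show False using that by simp
  qed
  ultimately show ?thesis using that[of a b] ab r(4,5) by blast
qed

section \<open>Excursions and the contraction of a loop\<close>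

lemma eqv_refl: "v \<in> topspace Y \<Longrightarrow> eqv v v"
  by (simp add: eqv_def)

lemma affine_in_unit_interval:
  fixes a b s :: real
  assumes "a \<in> {l..h}" "b \<in> {l..h}" "s \<in> {0..1}"
  shows "a + s * (b - a) \<in> {l..h}"
proof -
  have "(1 - s) * a + s * b \<in> {l..h}"
    using convexD[OF convex_real_interval(5)[of l h], of a b "1 - s" s] assms by auto
  then show ?thesis by (simp add: algebra_simps)
qed

lemma coord_path_affine:
  assumes \<gamma>: "pathin Y \<gamma>" and ab: "a \<in> {0..1}" "b \<in> {0..1}"
  shows "coord_path (\<lambda>s. \<gamma> (a + s * (b - a)))"
  unfolding coord_path_def
proof (intro conjI ballI)
  show "(\<lambda>s. \<gamma> (a + s * (b - a))) ` {0..1} \<subseteq> topspace Y"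
    using funcset_mem[OF path_image_subset_topspace[OF \<gamma>]] affine_in_unit_interval[OF ab] by blast
  fix c assume "c \<in> coords"
  then have "continuous_map Y euclideanreal c" by (auto simp: coords_def coord_def)
  from pathin_compose[OF \<gamma> this] have c\<gamma>: "continuous_on {0..1} (\<lambda>t. c (\<gamma> t))"
    by (simp add: path_def o_def)
  have "continuous_on {0..1} (\<lambda>s. c (\<gamma> (a + s * (b - a))))"
  proof (rule continuous_on_compose2[OF c\<gamma>])
    show "continuous_on {0..1} (\<lambda>s. a + s * (b - a))" by (intro continuous_intros)
    show "(\<lambda>s. a + s * (b - a)) ` {0..1} \<subseteq> {0..1}" using affine_in_unit_interval[OF ab] by blast
  qed
  then show "continuous_on {0..1} (c \<circ> (\<lambda>s. \<gamma> (a + s * (b - a))))" by (simp add: o_def)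
qed

lemma coord_path_join:
  assumes \<alpha>: "coord_path \<alpha>" and \<beta>: "coord_path \<beta>" and eq: "eqv (\<alpha> 1) (\<beta> 0)"
  shows "coord_path (path_join \<alpha> \<beta>)"
  unfolding coord_path_def
proof (intro conjI ballI)
  show "path_join \<alpha> \<beta> ` {0..1} \<subseteq> topspace Y"
    using coord_path_subset[OF \<alpha>] coord_path_subset[OF \<beta>] by (auto simp: path_join_def)
  fix c assume c: "c \<in> coords"
  have "path ((c \<circ> \<alpha>) +++ (c \<circ> \<beta>))"
    using \<alpha> \<beta> eq c by (intro path_join_imp) (auto simp: coord_path_def path_def pathfinish_def pathstart_def eqv_def)
  moreover have "(c \<circ> \<alpha>) +++ (c \<circ> \<beta>) = c \<circ> path_join \<alpha> \<beta>"
    by (auto simp: joinpaths_def path_join_def fun_eq_iff)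
  ultimately show "continuous_on {0..1} (c \<circ> path_join \<alpha> \<beta>)" by (simp add: path_def)
qed

text \<open>By \<open>exc\<close>, the path \<open>\<alpha>\<close> meets the initial segment of
  \<open>\<gamma>\<close> up to time \<open>u\<close> only at its ends. Running along
  \<open>\<gamma>\<close> from \<open>v1\<close> to \<open>v2\<close> is a competitor inside that
  segment with equivalent ends, so inequivalent ends would produce a further common point.\<close>

lemma eqv_ends_of_excursion:
  assumes \<alpha>: "coord_path \<alpha>" and \<gamma>: "pathin Y \<gamma>" and u: "u \<in> {0..1}"
    and ends: "v1 \<in> {0..u}" "v2 \<in> {0..u}" "eqv (\<alpha> 0) (\<gamma> v1)" "eqv (\<alpha> 1) (\<gamma> v2)"
    and exc: "\<And>s v. s \<in> {0..1} \<Longrightarrow> v \<in> {0..u} \<Longrightarrow> eqv (\<alpha> s) (\<gamma> v) \<Longrightarrow> eqv (\<alpha> s) (\<alpha> 0) \<or> eqv (\<alpha> s) (\<alpha> 1)"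
  shows "eqv (\<alpha> 0) (\<alpha> 1)"
proof (rule ccontr)
  assume neq: "\<not> eqv (\<alpha> 0) (\<alpha> 1)"
  have v: "v1 \<in> {0..1}" "v2 \<in> {0..1}" using ends u by auto
  obtain a b where "a \<in> {0..1}" "b \<in> {0..1}" "eqv (\<alpha> a) (\<gamma> (v1 + b * (v2 - v1)))"
    "\<not> eqv (\<alpha> a) (\<alpha> 0)" "\<not> eqv (\<alpha> a) (\<alpha> 1)"
    using coord_path_common_point[OF \<alpha> coord_path_affine[OF \<gamma> v] _ _ neq] ends by auto
  moreover have "v1 + b * (v2 - v1) \<in> {0..u}"
    using affine_in_unit_interval[OF ends(1,2) \<open>b \<in> {0..1}\<close>] .
  ultimately show False using exc by blast
qed

text \<open>In a tree, a path that leaves a subtree can only return to it through the point where it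
  left. Hence the last time \<open>r t u\<close> before \<open>t\<close> at which \<open>\<gamma>\<close> visits \<open>\<gamma> ` {0..u}\<close> yields the
  nearest-point projection of \<open>\<gamma> t\<close> onto \<open>\<gamma> ` {0..u}\<close>; letting \<open>u\<close> decrease from \<open>1\<close> to \<open>0\<close>
  contracts the loop.\<close>

lemma coord_nullhomotopy:
  fixes x :: "real \<Rightarrow> 'e::metric_space"
  assumes \<gamma>: "pathin Y \<gamma>" and loop: "\<gamma> 0 = \<gamma> 1"
    and x: "continuous_on {0..1} x"
    and xeq: "\<And>a b. a \<in> {0..1} \<Longrightarrow> b \<in> {0..1} \<Longrightarrow> eqv (\<gamma> a) (\<gamma> b) \<Longrightarrow> x a = x b"
  obtains H :: "real \<times> real \<Rightarrow> 'e" where "continuous_on ({0..1} \<times> {0..1}) H"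
    "H ` ({0..1} \<times> {0..1}) \<subseteq> x ` {0..1}"
    "\<And>t. t \<in> {0..1} \<Longrightarrow> H (t, 0) = x t" "\<And>t. t \<in> {0..1} \<Longrightarrow> H (t, 1) = x 0"
    "\<And>u. u \<in> {0..1} \<Longrightarrow> H (0, u) = x 0" "\<And>u. u \<in> {0..1} \<Longrightarrow> H (1, u) = x 0"
proof -
  have \<gamma>Y: "\<gamma> t \<in> topspace Y" if "t \<in> {0..1}" for t
    using funcset_mem[OF path_image_subset_topspace[OF \<gamma>] that] .
  define S where "S = (\<lambda>u. {r \<in> {0..1}. \<exists>v\<in>{0..u}. eqv (\<gamma> r) (\<gamma> v)})"
  have compS: "compact (S u)" if u: "u \<in> {0..1}" for u
  proof -
    define E where "E = (\<lambda>c. ({0..1} \<times> {0..u}) \<inter> (\<lambda>z. c (\<gamma> (fst z)) - c (\<gamma> (snd z))) -` {0::real})"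
    have "closed (E c)" if c: "c \<in> coords" for c
    proof -
      have "continuous_map Y euclideanreal c" using c by (auto simp: coords_def coord_def)
      from pathin_compose[OF \<gamma> this] have cc: "continuous_on {0..1} (\<lambda>t. c (\<gamma> t))"
        by (simp add: path_def o_def)
      show ?thesis
        unfolding E_def using u
        by (intro continuous_closed_preimage closed_Times continuous_on_diff
            continuous_on_compose2[OF cc continuous_on_fst[OF continuous_on_id]]
            continuous_on_compose2[OF cc continuous_on_snd[OF continuous_on_id]]) auto
    qed
    then have "compact (({0..1} \<times> {0..u}) \<inter> (\<Inter>c\<in>coords. E c))"
      by (intro compact_Int_closed closed_INT compact_Times) auto
    then have "compact (fst ` (({0..1} \<times> {0..u}) \<inter> (\<Inter>c\<in>coords. E c)))"
      by (intro compact_continuous_image continuous_on_fst continuous_on_id)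
    moreover have "S u = fst ` (({0..1} \<times> {0..u}) \<inter> (\<Inter>c\<in>coords. E c))"
    proof (intro equalityI subsetI)
      fix r assume "r \<in> S u"
      then obtain v where "r \<in> {0..1}" "v \<in> {0..u}" "eqv (\<gamma> r) (\<gamma> v)" by (auto simp: S_def)
      then show "r \<in> fst ` (({0..1} \<times> {0..u}) \<inter> (\<Inter>c\<in>coords. E c))"
        by (intro image_eqI[of _ _ "(r, v)"]) (auto simp: E_def eqv_def)
    next
      fix r assume "r \<in> fst ` (({0..1} \<times> {0..u}) \<inter> (\<Inter>c\<in>coords. E c))"
      then obtain z where "z \<in> {0..1} \<times> {0..u}" "\<forall>c\<in>coords. z \<in> E c" "r = fst z"
        by blast
      then obtain v where "r \<in> {0..1}" "v \<in> {0..u}" "\<forall>c\<in>coords. c (\<gamma> r) = c (\<gamma> v)"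
        by (auto simp: E_def)
      then show "r \<in> S u" using u \<gamma>Y by (auto simp: S_def eqv_def intro!: bexI[of _ v])
    qed
    ultimately show ?thesis by simp
  qed
  have S_mem: "v \<in> S u" if "v \<in> {0..u}" "u \<in> {0..1}" for u v
    using that \<gamma>Y by (auto simp: S_def intro!: bexI[of _ v] eqv_refl)
  have ex: "\<exists>r. r \<in> S u \<inter> {0..t} \<and> (\<forall>s\<in>S u \<inter> {0..t}. s \<le> r)" if "t \<in> {0..1}" "u \<in> {0..1}" for t u
  proof -
    have "compact (S u \<inter> {0..t})" using compS that by (intro compact_Int_closed) auto
    moreover have "S u \<inter> {0..t} \<noteq> {}" using S_mem[of 0 u] that by auto
    ultimately show ?thesis using compact_attains_sup by blast
  qed
  define r where "r = (\<lambda>t u. SOME r. r \<in> S u \<inter> {0..t} \<and> (\<forall>s\<in>S u \<inter> {0..t}. s \<le> r))"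
  have r0: "r t u \<in> S u \<inter> {0..t} \<and> (\<forall>s\<in>S u \<inter> {0..t}. s \<le> r t u)" if "t \<in> {0..1}" "u \<in> {0..1}" for t u
    using someI_ex[OF ex[OF that]] by (simp add: r_def)
  have r: "r t u \<in> S u \<inter> {0..t}" "\<And>s. s \<in> S u \<Longrightarrow> s \<in> {0..t} \<Longrightarrow> s \<le> r t u"
    if "t \<in> {0..1}" "u \<in> {0..1}" for t u
    using r0[OF that] by blast+
  have S01: "S u \<subseteq> {0..1}" for u by (auto simp: S_def)
  \<comment> \<open>The time \<open>r t u\<close> may jump as \<open>t\<close> varies, but only
    across an excursion, whose two ends have the same image under \<open>x\<close>. Hence
    \<open>x (r t u)\<close> varies no more than \<open>x\<close> does between \<open>t\<close> and
    \<open>t'\<close>.\<close>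
  have near_t: "x (r t u) = x (r t' u) \<or> (\<exists>a\<in>{t..t'}. \<exists>b\<in>{t..t'}. x (r t u) = x a \<and> x (r t' u) = x b)"
    if t: "t \<in> {0..1}" "t' \<in> {0..1}" "t \<le> t'" and u: "u \<in> {0..1}" for t t' u
  proof (cases "r t' u \<le> t")
    case True
    then have "r t' u \<le> r t u" using r(1)[OF t(2) u] by (intro r(2)[OF t(1) u]) auto
    moreover have "r t u \<le> r t' u" using r(1)[OF t(1) u] t by (intro r(2)[OF t(2) u]) auto
    ultimately show ?thesis by simp
  next
    case False
    have "compact (S u \<inter> {t..t'})" using compS[OF u] by (intro compact_Int_closed) auto
    moreover have "r t' u \<in> S u \<inter> {t..t'}" using False r(1)[OF t(2) u] by auto
    \<comment> \<open>The first visit from time \<open>t\<close> on. Together with the last visit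
      \<open>p\<close> up to time \<open>t\<close> it bounds an excursion.\<close>
    ultimately obtain q where q: "q \<in> S u \<inter> {t..t'}" "\<And>s. s \<in> S u \<inter> {t..t'} \<Longrightarrow> q \<le> s"
      using compact_attains_inf[of "S u \<inter> {t..t'}"] by blast
    define p where "p = r t u"
    have p: "p \<in> S u" "0 \<le> p" "p \<le> t" using r(1)[OF t(1) u] by (auto simp: p_def)
    have pq: "p \<in> {0..1}" "q \<in> {0..1}" using p q t by auto
    obtain v1 v2 where v: "v1 \<in> {0..u}" "eqv (\<gamma> p) (\<gamma> v1)" "v2 \<in> {0..u}" "eqv (\<gamma> q) (\<gamma> v2)"
      using p q by (auto simp: S_def)
    define \<alpha> where "\<alpha> = (\<lambda>s. \<gamma> (p + s * (q - p)))"
    have "eqv (\<alpha> 0) (\<alpha> 1)"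
    proof (rule eqv_ends_of_excursion[OF _ \<gamma> u v(1,3)])
      show "coord_path \<alpha>" unfolding \<alpha>_def by (rule coord_path_affine[OF \<gamma> pq])
      fix s w assume s: "s \<in> {0..1}" and w: "w \<in> {0..u}" "eqv (\<alpha> s) (\<gamma> w)"
      define z where "z = p + s * (q - p)"
      have z: "z \<in> {p..q}" unfolding z_def using affine_in_unit_interval[of p p q q s] p q s by auto
      then have zS: "z \<in> S u" using w pq by (auto simp: S_def \<alpha>_def z_def)
      have "z = p \<or> z = q"
      proof (cases "z \<le> t")
        case True
        then have "z \<le> p" using r(2)[OF t(1) u zS] z p by (auto simp: p_def)
        then show ?thesis using z by auto
      next
        case False
        then have "q \<le> z" using q z zS by auto
        then show ?thesis using z by auto
      qed
      then show "eqv (\<alpha> s) (\<alpha> 0) \<or> eqv (\<alpha> s) (\<alpha> 1)"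
        using \<gamma>Y pq by (auto simp: \<alpha>_def simp flip: z_def intro: eqv_refl)
    qed (use v in \<open>auto simp: \<alpha>_def\<close>)
    then have "x p = x q" using pq by (intro xeq) (auto simp: \<alpha>_def)
    then show ?thesis using q(1) False r(1)[OF t(2) u] unfolding p_def by force
  qed
  \<comment> \<open>When \<open>u\<close> grows to \<open>u'\<close>, the last visit moves from
    \<open>p\<close> to a later \<open>q\<close> only because \<open>q\<close> meets the new stretch
    of the loop, at a time \<open>w\<close> between \<open>u\<close> and \<open>u'\<close>. The path
    from \<open>p\<close> to \<open>q\<close>, continued at the equivalent point of time
    \<open>w\<close> and run back to the last visit \<open>m\<close> to the old segment, is an
    excursion. This is where a path joined at merely equivalent points is needed.\<close>
  have near_u: "x (r t u) = x (r t u') \<or> (\<exists>a\<in>{u..u'}. \<exists>b\<in>{u..u'}. x (r t u) = x a \<and> x (r t u') = x b)"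
    if u: "u \<in> {0..1}" "u' \<in> {0..1}" "u \<le> u'" and t: "t \<in> {0..1}" for t u u'
  proof (cases "r t u = r t u'")
    case False
    define p q where "p = r t u" and "q = r t u'"
    have p: "p \<in> S u" "0 \<le> p" "p \<le> t" using r(1)[OF t u(1)] by (auto simp: p_def)
    have q: "q \<in> S u'" "0 \<le> q" "q \<le> t" using r(1)[OF t u(2)] by (auto simp: q_def)
    have "p \<in> S u'" using p(1) u by (fastforce simp: S_def)
    then have "p < q" using r(2)[OF t u(2), of p] p False by (auto simp: p_def q_def)
    then have qS: "q \<notin> S u" using r(2)[OF t u(1), of q] q by (auto simp: p_def)
    obtain w where w: "w \<in> {0..u'}" "eqv (\<gamma> q) (\<gamma> w)" using q by (auto simp: S_def)
    have pq: "p \<in> {0..1}" "q \<in> {0..1}" "w \<in> {0..1}" using p q w u t by auto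
    have wu: "u < w" using qS w pq by (force simp: S_def)
    have "compact (S u \<inter> {u..w})" using compS[OF u(1)] by (intro compact_Int_closed) auto
    moreover have "u \<in> S u \<inter> {u..w}" using S_mem[of u u] u wu by auto
    ultimately obtain m where m: "m \<in> S u \<inter> {u..w}" "\<And>s. s \<in> S u \<inter> {u..w} \<Longrightarrow> s \<le> m"
      using compact_attains_sup[of "S u \<inter> {u..w}"] by blast
    have m1: "m \<in> {0..1}" using m u w by auto
    obtain v1 v2 where v: "v1 \<in> {0..u}" "eqv (\<gamma> p) (\<gamma> v1)" "v2 \<in> {0..u}" "eqv (\<gamma> m) (\<gamma> v2)"
      using p m by (auto simp: S_def)
    define \<alpha>1 where "\<alpha>1 = (\<lambda>s. \<gamma> (p + s * (q - p)))"
    define \<alpha>2 where "\<alpha>2 = (\<lambda>s. \<gamma> (w + s * (m - w)))"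
    define \<alpha> where "\<alpha> = path_join \<alpha>1 \<alpha>2"
    have \<alpha>01: "\<alpha> 0 = \<gamma> p" "\<alpha> 1 = \<gamma> m" by (auto simp: \<alpha>_def path_join_def \<alpha>1_def \<alpha>2_def)
    have "eqv (\<alpha> 0) (\<alpha> 1)"
    proof (rule eqv_ends_of_excursion[OF _ \<gamma> u(1) v(1,3)])
      show "coord_path \<alpha>"
        unfolding \<alpha>_def \<alpha>1_def \<alpha>2_def
        by (intro coord_path_join coord_path_affine \<gamma> pq m1) (use w in simp)
      fix s v assume s: "s \<in> {0..1}" and v: "v \<in> {0..u}" "eqv (\<alpha> s) (\<gamma> v)"
      show "eqv (\<alpha> s) (\<alpha> 0) \<or> eqv (\<alpha> s) (\<alpha> 1)"
      proof (cases "s \<le> 1 / 2")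
        case True
        define z where "z = p + (2 * s) * (q - p)"
        have z: "z \<in> {p..q}"
          unfolding z_def using \<open>p < q\<close> s True by (intro affine_in_unit_interval) auto
        have \<alpha>z: "\<alpha> s = \<gamma> z" using True by (simp add: \<alpha>_def path_join_def \<alpha>1_def z_def)
        then have "z \<in> S u" using v z pq by (auto simp: S_def)
        then have "z \<le> p" using r(2)[OF t u(1), of z] z p q by (auto simp: p_def)
        then have "z = p" using z by auto
        then show ?thesis using \<alpha>z \<alpha>01 \<gamma>Y[OF pq(1)] eqv_refl by simp
      next
        case False
        define z where "z = w + (2 * s - 1) * (m - w)"
        have z: "z \<in> {m..w}"
          unfolding z_def using m(1) s False by (intro affine_in_unit_interval) auto
        have \<alpha>z: "\<alpha> s = \<gamma> z" using False by (simp add: \<alpha>_def path_join_def \<alpha>2_def z_def)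
        then have "z \<in> S u" using v z pq m1 by (auto simp: S_def)
        then have "z \<le> m" using m z by auto
        then have "z = m" using z by auto
        then show ?thesis using \<alpha>z \<alpha>01 \<gamma>Y[OF m1] eqv_refl by simp
      qed
    qed (use v \<alpha>01 in auto)
    then have "x p = x m" using pq m1 \<alpha>01 by (intro xeq) auto
    moreover have "x q = x w" using pq w by (intro xeq) auto
    ultimately show ?thesis using m(1) w(1) wu unfolding p_def q_def by force
  qed auto
  define G where "G = (\<lambda>z. x (r (fst z) (snd z)))"
  have unif: "uniformly_continuous_on {0..1} x"
    using x by (intro compact_uniformly_continuous) auto
  \<comment> \<open>\<open>near_t\<close> and \<open>near_u\<close> turn a modulus of continuity of
    \<open>x\<close> into one of \<open>G\<close>, with half of the error spent on each
    variable.\<close>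
  have "uniformly_continuous_on ({0..1} \<times> {0..1}) G"
    unfolding uniformly_continuous_on_def
  proof (intro allI impI)
    fix e :: real assume "e > 0"
    then obtain d where d: "d > 0"
      "\<And>a b. a \<in> {0..1} \<Longrightarrow> b \<in> {0..1} \<Longrightarrow> dist a b < d \<Longrightarrow> dist (x a) (x b) < e / 2"
      by (rule uniformly_continuous_onE[OF unif half_gt_zero]) (metis dist_commute)
    have A: "dist (x (r t u)) (x (r t' u)) < e / 2"
      if "t \<in> {0..1}" "t' \<in> {0..1}" "t \<le> t'" "u \<in> {0..1}" "\<bar>t - t'\<bar> < d" for t t' u
      using near_t[OF that(1-4)]
    proof
      assume "\<exists>a\<in>{t..t'}. \<exists>b\<in>{t..t'}. x (r t u) = x a \<and> x (r t' u) = x b"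
      then obtain a b where "a \<in> {t..t'}" "b \<in> {t..t'}" "x (r t u) = x a" "x (r t' u) = x b" by blast
      then show ?thesis using d(2)[of a b] that by (auto simp: dist_real_def)
    qed (use \<open>e > 0\<close> in simp)
    have B: "dist (x (r t u)) (x (r t u')) < e / 2"
      if "u \<in> {0..1}" "u' \<in> {0..1}" "u \<le> u'" "t \<in> {0..1}" "\<bar>u - u'\<bar> < d" for t u u'
      using near_u[OF that(1-4)]
    proof
      assume "\<exists>a\<in>{u..u'}. \<exists>b\<in>{u..u'}. x (r t u) = x a \<and> x (r t u') = x b"
      then obtain a b where "a \<in> {u..u'}" "b \<in> {u..u'}" "x (r t u) = x a" "x (r t u') = x b" by blast
      then show ?thesis using d(2)[of a b] that by (auto simp: dist_real_def)
    qed (use \<open>e > 0\<close> in simp)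
    have A': "dist (x (r t u)) (x (r t' u)) < e / 2"
      if "t \<in> {0..1}" "t' \<in> {0..1}" "u \<in> {0..1}" "\<bar>t - t'\<bar> < d" for t t' u
      using A[of t t' u] A[of t' t u] that by (cases "t \<le> t'") (auto simp: dist_commute abs_minus_commute)
    have B': "dist (x (r t u)) (x (r t u')) < e / 2"
      if "u \<in> {0..1}" "u' \<in> {0..1}" "t \<in> {0..1}" "\<bar>u - u'\<bar> < d" for t u u'
      using B[of u u' t] B[of u' u t] that by (cases "u \<le> u'") (auto simp: dist_commute abs_minus_commute)
    have "dist (G z') (G z) < e" if z: "z \<in> {0..1} \<times> {0..1}" "z' \<in> {0..1} \<times> {0..1}" "dist z' z < d" for z z'
    proof -
      obtain t u t' u' where tu: "z = (t, u)" "z' = (t', u')" by (cases z, cases z')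
      have "\<bar>t - t'\<bar> < d" "\<bar>u - u'\<bar> < d"
        using z(3) dist_fst_le[of z' z] dist_snd_le[of z' z] by (auto simp: tu dist_real_def abs_minus_commute)
      then have "dist (x (r t u)) (x (r t' u)) < e / 2" "dist (x (r t' u)) (x (r t' u')) < e / 2"
        using A'[of t t' u] B'[of u u' t'] z tu by auto
      then show ?thesis
        using dist_triangle[of "x (r t u)" "x (r t' u')" "x (r t' u)"] by (simp add: G_def tu dist_commute)
    qed
    then show "\<exists>d>0. \<forall>z\<in>{0..1} \<times> {0..1}. \<forall>z'\<in>{0..1} \<times> {0..1}. dist z' z < d \<longrightarrow> dist (G z') (G z) < e"
      using d(1) by blast
  qed
  then have G: "continuous_on ({0..1} \<times> {0..1}) G" by (rule uniformly_continuous_imp_continuous)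
  define H where "H = (\<lambda>z. G (fst z, 1 - snd z))"
  show ?thesis
  proof (rule that)
    show "continuous_on ({0..1} \<times> {0..1}) H"
      unfolding H_def by (intro continuous_on_compose2[OF G] continuous_intros) auto
    show "H ` ({0..1} \<times> {0..1}) \<subseteq> x ` {0..1}"
    proof (rule image_subsetI)
      fix z :: "real \<times> real" assume z: "z \<in> {0..1} \<times> {0..1}"
      then have "r (fst z) (1 - snd z) \<in> {0..1}"
        using r(1)[of "fst z" "1 - snd z"] S01[of "1 - snd z"] by auto
      then show "H z \<in> x ` {0..1}" by (simp add: H_def G_def)
    qed
    show "H (t, 0) = x t" if t: "t \<in> {0..1}" for t
    proof -
      have "t \<le> r t 1" using r(2)[OF t, of 1 t] S_mem[of t 1] t by auto
      moreover have "r t 1 \<le> t" using r(1)[OF t, of 1] by auto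
      ultimately show ?thesis by (simp add: H_def G_def)
    qed
    show "H (t, 1) = x 0" if t: "t \<in> {0..1}" for t
    proof -
      have "r t 0 \<in> S 0" using r(1)[OF t, of 0] by auto
      then show ?thesis using xeq[of "r t 0" 0] by (auto simp: H_def G_def S_def)
    qed
    show "H (0, u) = x 0" if "u \<in> {0..1}" for u
      using r(1)[of 0 "1 - u"] that by (auto simp: H_def G_def)
    show "H (1, u) = x 0" if u: "u \<in> {0..1}" for u
    proof -
      have "eqv (\<gamma> 1) (\<gamma> 0)" using loop \<gamma>Y[of 0] eqv_refl by simp
      then have "1 \<in> S (1 - u)" using u by (auto simp: S_def intro!: bexI[of _ 0])
      then have "1 \<le> r 1 (1 - u)" using r(2)[of 1 "1 - u" 1] u by auto
      moreover have "r 1 (1 - u) \<le> 1" using r(1)[of 1 "1 - u"] u by auto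
      ultimately have "r 1 (1 - u) = 1" by simp
      then show ?thesis using xeq[of 1 0] \<open>eqv (\<gamma> 1) (\<gamma> 0)\<close> by (simp add: H_def G_def)
    qed
  qed
qed

end

section \<open>The Hawaiian earring and its mapping torus\<close>

text \<open>The condition is the equation of the circle of radius \<open>1 / i\<close>. On the
  earring, the map winds once around the unit circle along that circle and is 1 elsewhere. For
  \<open>i \<le> 0\<close> it is constantly 1 there, so shifts of the index need no case
  distinction.\<close>

definition angle :: "int \<Rightarrow> real \<times> real \<Rightarrow> complex" where
  "angle i v = (if of_int i * ((fst v)\<^sup>2 + (snd v)\<^sup>2) = 2 * fst v
     then Complex (1 - of_int i * fst v) (of_int i * snd v) else 1)"

lemma earring_loop_circle:
  assumes "m \<ge> 1"
  shows "real m * ((fst (earring_loop m t))\<^sup>2 + (snd (earring_loop m t))\<^sup>2) = 2 * fst (earring_loop m t)"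
proof -
  have "(1 - cos (2 * pi * t))\<^sup>2 + (sin (2 * pi * t))\<^sup>2 = 2 * (1 - cos (2 * pi * t))"
    using sin_cos_squared_add[of "2 * pi * t"] by (simp add: power2_diff)
  then have "((1 - cos (2 * pi * t)) / real m)\<^sup>2 + (sin (2 * pi * t) / real m)\<^sup>2 = 2 * (1 - cos (2 * pi * t)) / (real m)\<^sup>2"
    by (simp add: power_divide flip: add_divide_distrib)
  then show ?thesis using assms by (simp add: earring_loop_def power2_eq_square)
qed

lemma angle_loop:
  assumes "m \<ge> 1"
  shows "angle i (earring_loop m t) = (if i = int m then cis (2 * pi * t) else 1)"
proof -
  define v where "v = earring_loop m t"
  define Q where "Q = (fst v)\<^sup>2 + (snd v)\<^sup>2"
  have Q: "real m * Q = 2 * fst v"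
    using earring_loop_circle[OF assms] by (simp add: Q_def v_def)
  have cis: "Complex (1 - real m * fst v) (real m * snd v) = cis (2 * pi * t)"
    using assms by (simp add: v_def earring_loop_def complex_eq_iff)
  show ?thesis
  proof (cases "Q = 0")
    case True
    then have "fst v = 0" "snd v = 0" by (simp_all add: Q_def sum_power2_eq_zero_iff)
    then show ?thesis using cis by (simp add: angle_def complex_eq_iff flip: v_def)
  next
    case False
    have "of_int i * Q = 2 * fst v \<longleftrightarrow> of_int i * Q = real m * Q" using Q by simp
    also have "\<dots> \<longleftrightarrow> i = int m" using False by auto
    finally have "of_int i * Q = 2 * fst v \<longleftrightarrow> i = int m" .
    then show ?thesis using cis by (auto simp: angle_def simp flip: v_def Q_def)
  qed
qed

lemma earring_cases:
  assumes "v \<in> earring"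
  obtains m t where "m \<ge> 1" "t \<in> {0..1}" "v = earring_loop m t"
  using assms unfolding earring_iff by blast

lemma earring_loop_in: "m \<ge> 1 \<Longrightarrow> t \<in> {0..1} \<Longrightarrow> earring_loop m t \<in> earring"
  unfolding earring_iff by blast

lemma zero_in_earring: "(0, 0) \<in> earring"
  using earring_loop_in[of 1 0] by (simp add: earring_loop_def)

lemma angle_zero [simp]: "angle i (0, 0) = 1"
  by (simp add: angle_def complex_eq_iff)

lemma norm_angle: "v \<in> earring \<Longrightarrow> norm (angle i v) = 1"
  by (elim earring_cases) (simp add: angle_loop)

lemma angle_disjoint: "v \<in> earring \<Longrightarrow> angle i v \<noteq> 1 \<Longrightarrow> angle j v \<noteq> 1 \<Longrightarrow> i = j"
  by (elim earring_cases) (auto simp: angle_loop split: if_splits)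

lemma earring_loop_eq_angle:
  "m \<ge> 1 \<Longrightarrow> v = earring_loop m t \<Longrightarrow> v = ((1 - Re (angle (int m) v)) / m, Im (angle (int m) v) / m)"
  by (simp add: angle_loop) (simp add: earring_loop_def)

lemma angle_inject:
  assumes v: "v \<in> earring" and w: "w \<in> earring" and eq: "\<And>i. angle i v = angle i w"
  shows "v = w"
proof -
  obtain m t where mt: "m \<ge> 1" "v = earring_loop m t" using v by (elim earring_cases)
  obtain k s where ks: "k \<ge> 1" "w = earring_loop k s" using w by (elim earring_cases)
  note v' = earring_loop_eq_angle[OF mt] and w' = earring_loop_eq_angle[OF ks]
  show ?thesis
  proof (cases "k = m")
    case True
    then show ?thesis using v' w' eq by simp
  next
    case False
    then have "angle (int m) v = 1" "angle (int k) w = 1"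
      using eq[of "int m"] eq[of "int k"] mt ks by (simp_all add: angle_loop)
    then show ?thesis using v' w' by simp
  qed
qed

text \<open>At the origin, the distance from 1 is at most \<open>\<bar>i\<bar>\<close> times the
  norm. Away from it, the value of \<open>\<mu>\<close> on the earring is the index of the circle;
  being continuous and integer-valued, it keeps nearby points on the same circle, where
  \<open>angle i\<close> is affine or constant.\<close>

lemma continuous_on_angle: "continuous_on earring (angle i)"
  unfolding continuous_on_eq_continuous_within
proof
  fix v assume v: "v \<in> earring"
  show "continuous (at v within earring) (angle i)"
  proof (cases "v = 0")
    case True
    have "norm (angle i w - 1) \<le> norm (of_int i * norm w)" for w
    proof (cases "of_int i * ((fst w)\<^sup>2 + (snd w)\<^sup>2) = 2 * fst w")
      case True
      then have "angle i w - 1 = - of_int i * Complex (fst w) (- snd w)"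
        by (simp add: angle_def complex_eq_iff)
      then have "norm (angle i w - 1) = \<bar>of_int i\<bar> * norm (Complex (fst w) (- snd w))"
        by (simp only: norm_mult norm_minus_cancel norm_of_int)
      then show ?thesis by (simp add: cmod_def norm_prod_def abs_mult)
    qed (simp add: angle_def)
    then have "\<forall>\<^sub>F w in at 0 within earring. norm (angle i w - 1) \<le> norm (of_int i * norm w)"
      by (intro always_eventually) blast
    moreover have "((\<lambda>w. norm (real_of_int i * norm w)) \<longlongrightarrow> 0) (at (0 :: real \<times> real) within earring)"
      by (rule tendsto_norm_zero[OF tendsto_mult_right_zero[OF tendsto_norm_zero[OF tendsto_ident_at]]])
    ultimately have "((\<lambda>w. angle i w - 1) \<longlongrightarrow> 0) (at 0 within earring)"
      by (rule Lim_null_comparison)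
    then have "(angle i \<longlongrightarrow> 1) (at 0 within earring)" by (simp add: LIM_zero_iff)
    moreover have "angle i 0 = 1" by (simp add: zero_prod_def)
    ultimately show ?thesis by (simp add: True continuous_within)
  next
    case False
    define \<mu> where "\<mu> = (\<lambda>w :: real \<times> real. 2 * fst w / ((fst w)\<^sup>2 + (snd w)\<^sup>2))"
    obtain m t where m: "m \<ge> 1" "v = earring_loop m t" using v by (elim earring_cases)
    have \<mu>_loop: "\<mu> w = real k" if "k \<ge> 1" "w = earring_loop k s" "w \<noteq> 0" for w k s
    proof -
      have "(fst w)\<^sup>2 + (snd w)\<^sup>2 \<noteq> 0"
        using that(3) by (simp add: prod_eq_iff sum_power2_eq_zero_iff)
      then show ?thesis
        using earring_loop_circle[OF that(1), of s] that(2) by (simp add: \<mu>_def nonzero_divide_eq_eq)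
    qed
    have nz: "(fst v)\<^sup>2 + (snd v)\<^sup>2 \<noteq> 0" using False by (simp add: prod_eq_iff sum_power2_eq_zero_iff)
    have "continuous (at v within earring) \<mu>"
      unfolding \<mu>_def using nz by (intro continuous_intros) auto
    then obtain d where d: "d > 0" "\<And>w. w \<in> earring \<Longrightarrow> dist w v < d \<Longrightarrow> dist (\<mu> w) (\<mu> v) < 1 / 2"
      unfolding continuous_within_eps_delta by (metis half_gt_zero zero_less_one)
    define g where "g = (\<lambda>w. if i = int m then Complex (1 - of_int i * fst w) (of_int i * snd w) else 1)"
    have g_eq: "g w = angle i w" if w: "w \<in> earring" "dist w v < d" for w
    proof -
      obtain k s where k: "k \<ge> 1" "w = earring_loop k s" using w(1) by (elim earring_cases)
      have *: "\<bar>\<mu> w - real m\<bar> < 1 / 2"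
        using d(2)[OF w] \<mu>_loop[OF m False] by (simp add: dist_real_def)
      have "w \<noteq> 0"
      proof
        assume "w = 0"
        then show False using * m by (simp add: \<mu>_def)
      qed
      then have "\<bar>real k - real m\<bar> < 1 / 2" using * \<mu>_loop[OF k] by simp
      then have "k = m" by linarith
      then show ?thesis
      proof (cases "i = int m")
        case True
        then show ?thesis
          using earring_loop_circle[OF k(1), of s] k \<open>k = m\<close> by (simp add: g_def angle_def)
      next
        case False
        then show ?thesis using k \<open>k = m\<close> by (simp add: g_def angle_loop)
      qed
    qed
    have "continuous (at v within earring) (\<lambda>w. complex_of_real (1 - of_int i * fst w) + \<i> * complex_of_real (of_int i * snd w))"
      by (intro continuous_intros)
    then have g_cont: "continuous (at v within earring) g"
      by (cases "i = int m") (simp_all only: g_def Complex_eq simp_thms if_True if_False continuous_const)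
    show ?thesis by (rule continuous_transform_within[OF g_cont d(1) v g_eq])
  qed
qed

section \<open>The shift, and continuity into the earring by angles\<close>

lemma earring_shift:
  shows continuous_on_earring_shift: "continuous_on earring earring_shift"
    and earring_shift_in: "v \<in> earring \<Longrightarrow> earring_shift v \<in> earring"
    and earring_shift_loop: "m \<ge> 1 \<Longrightarrow> t \<in> {0..1} \<Longrightarrow> earring_shift (earring_loop m t) = earring_loop (m + 1) t"
proof -
  have "earring_shift \<in> extensional earring \<and>
     continuous_map (top_of_set earring) (top_of_set earring) earring_shift \<and>
     (\<forall>m\<ge>1. \<forall>t\<in>{0..1}. earring_shift (earring_loop m t) = earring_loop (m + 1) t)"
    using theI'[OF earring_shift_ex1, folded earring_shift_def] .
  then show "continuous_on earring earring_shift"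
    "v \<in> earring \<Longrightarrow> earring_shift v \<in> earring"
    "m \<ge> 1 \<Longrightarrow> t \<in> {0..1} \<Longrightarrow> earring_shift (earring_loop m t) = earring_loop (m + 1) t"
    by (auto simp: continuous_map_in_subtopology image_subset_iff)
qed

lemma angle_earring_shift: "v \<in> earring \<Longrightarrow> angle (i + 1) (earring_shift v) = angle i v"
  by (elim earring_cases) (simp add: earring_shift_loop angle_loop)

lemma earring_shift_funpow_in: "v \<in> earring \<Longrightarrow> (earring_shift ^^ n) v \<in> earring"
  by (induction n) (auto simp: earring_shift_in)

lemma angle_earring_shift_funpow:
  "v \<in> earring \<Longrightarrow> angle (i + int n) ((earring_shift ^^ n) v) = angle i v"
proof (induction n)
  case (Suc n)
  then show ?case
    using angle_earring_shift[OF earring_shift_funpow_in[OF Suc(2)], of "i + int n" n]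
    by (simp add: algebra_simps)
qed simp

lemma earring_shift_funpow_loop:
  "m \<ge> 1 \<Longrightarrow> t \<in> {0..1} \<Longrightarrow> (earring_shift ^^ n) (earring_loop m t) = earring_loop (m + n) t"
  by (induction n) (auto simp: earring_shift_loop)

lemma continuous_on_earring_shift_funpow: "continuous_on earring (earring_shift ^^ n)"
proof (induction n)
  case (Suc n)
  have "continuous_on earring (\<lambda>x. earring_shift ((earring_shift ^^ n) x))"
    by (rule continuous_on_compose2[OF continuous_on_earring_shift Suc])
       (use earring_shift_funpow_in in blast)
  then show ?case by (simp add: o_def)
qed (simp add: continuous_on_id)

lemma norm_earring_loop: "norm (earring_loop m t) \<le> 3 / real m"
proof -
  have "norm (earring_loop m t) \<le> norm ((1 - cos (2 * pi * t)) / real m) + norm (sin (2 * pi * t) / real m)"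
    unfolding earring_loop_def by (rule norm_Pair_le)
  also have "\<dots> = (\<bar>1 - cos (2 * pi * t)\<bar> + \<bar>sin (2 * pi * t)\<bar>) / real m"
    by (simp add: add_divide_distrib)
  also have "\<dots> \<le> 3 / real m"
  proof (rule divide_right_mono)
    have "\<bar>1 - cos (2 * pi * t)\<bar> \<le> 2"
      using cos_ge_minus_one[of "2 * pi * t"] cos_le_one[of "2 * pi * t"] by linarith
    then show "\<bar>1 - cos (2 * pi * t)\<bar> + \<bar>sin (2 * pi * t)\<bar> \<le> 3"
      using abs_sin_le_one[of "2 * pi * t"] by linarith
  qed simp
  finally show ?thesis .
qed

text \<open>The part of \<open>x\<close> on the first \<open>n\<close> circles is a finite sum of
  continuous terms. It differs from \<open>x\<close> only at points on circles of index greater than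
  \<open>n\<close>, and these have norm at most \<open>3 / n\<close>; so the convergence is
  uniform.\<close>

lemma continuous_on_earringI:
  fixes x :: "'a::topological_space \<Rightarrow> real \<times> real"
  assumes x: "x ` S \<subseteq> earring" and cont: "\<And>i. continuous_on S (\<lambda>w. angle i (x w))"
  shows "continuous_on S x"
proof (rule uniform_limit_theorem)
  define z where "z = (\<lambda>k w. ((1 - Re (angle (int k) (x w))) / real k, Im (angle (int k) (x w)) / real k))"
  define g where "g = (\<lambda>n w. \<Sum>k=1..n. z k w)"
  show "\<forall>\<^sub>F n in sequentially. continuous_on S (g n)"
  proof (intro always_eventually allI)
    fix n
    have "continuous_on S (z k)" if "k \<in> {1..n}" for k
      unfolding z_def using that by (intro continuous_intros cont) auto
    then show "continuous_on S (g n)" unfolding g_def by (intro continuous_on_sum) auto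
  qed
  show "uniform_limit S g x sequentially"
  proof (rule uniform_limitI)
    fix e :: real assume e: "e > 0"
    obtain N :: nat where N: "3 / e < N" using reals_Archimedean2 by blast
    have "dist (g n w) (x w) < e" if n: "n \<ge> N" and w: "w \<in> S" for n w
    proof -
      obtain m t where m: "m \<ge> 1" "x w = earring_loop m t"
        using x w earring_cases[of "x w"] by blast
      have z: "z k w = (if k = m then x w else 0)" for k
      proof (cases "k = m")
        case True
        then show ?thesis using earring_loop_eq_angle[OF m, symmetric] by (simp add: z_def)
      next
        case False
        then have "angle (int k) (x w) = 1" using m by (simp add: angle_loop)
        then show ?thesis using False by (simp add: z_def zero_prod_def)
      qed
      show ?thesis
      proof (cases "m \<le> n")
        case True
        then show ?thesis using m e by (simp add: g_def z)
      next
        case False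
        then have "g n w = 0" by (simp add: g_def z)
        moreover have "norm (x w) \<le> 3 / real m" using norm_earring_loop m by simp
        moreover have "3 / real m < e"
        proof -
          have "3 / e < real m" using N n False by linarith
          then show ?thesis using e m by (simp add: field_simps)
        qed
        ultimately show ?thesis by simp
      qed
    qed
    then show "\<forall>\<^sub>F n in sequentially. \<forall>w\<in>S. dist (g n w) (x w) < e"
      unfolding eventually_sequentially by blast
  qed
qed simp

section \<open>Maps out of the mapping torus, and its semiflow\<close>

abbreviation earring_top :: "(real \<times> real) topology" where
  "earring_top \<equiv> top_of_set earring"

abbreviation glue :: "(real \<times> real) \<times> real \<Rightarrow> ((real \<times> real) \<times> real) set" where
  "glue \<equiv> torus_proj earring_top earring_shift"

lemma quotient_map_glue: "quotient_map (prod_topology earring_top I01) earring_torus glue"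
  unfolding earring_torus_def mapping_torus_def by (rule quotient_map_quotient_topology)

lemma continuous_map_glue: "continuous_map (prod_topology earring_top I01) earring_torus glue"
  using quotient_map_glue by (rule quotient_imp_continuous_map)

lemma topspace_earring_torus: "topspace earring_torus = glue ` (earring \<times> {0..1})"
  using quotient_imp_surjective_map[OF quotient_map_glue] by simp

lemma glue_seam:
  assumes "x \<in> earring"
  shows "glue (x, 1) = glue (earring_shift x, 0)"
proof -
  let ?R = "\<lambda>c d. \<exists>x\<in>topspace earring_top. c = (x, 1) \<and> d = (earring_shift x, 0)"
  have "equivclp ?R (x, 1) (earring_shift x, 0)"
    using assms by (intro r_into_equivclp) auto
  note equivclp_trans[OF this] equivclp_trans[OF equivclp_sym[OF this]]
  then have *: "equivclp ?R (x, 1) b \<longleftrightarrow> equivclp ?R (earring_shift x, 0) b" for b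
    by (rule iffI[rotated])
  show ?thesis unfolding torus_proj_def by (rule Collect_cong) (simp only: *)
qed

lemma glue_eq_imp:
  assumes F: "\<And>x. x \<in> earring \<Longrightarrow> F (x, 1) = F (earring_shift x, 0)"
    and b: "b \<in> earring \<times> {0..1}" and eq: "glue a = glue b"
  shows "F a = F b"
proof -
  let ?R = "\<lambda>c d. \<exists>x\<in>topspace earring_top. c = (x, 1) \<and> d = (earring_shift x, 0)"
  have "b \<in> glue b" using b by (simp add: torus_proj_def)
  then have "b \<in> glue a" using eq by simp
  then have "equivclp ?R a b" by (simp add: torus_proj_def)
  then show ?thesis
    by (induction rule: equivclp_induct) (use F in auto)
qed

text \<open>The line is locally compact, so \<open>glue\<close> times its identity is again a
  quotient map. The real parameter serves as lifted height in \<open>torus_angle\<close> and as time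
  in the semiflow.\<close>

lemma earring_torus_descend:
  fixes G :: "((real \<times> real) \<times> real) \<times> real \<Rightarrow> 'z"
  assumes G: "continuous_map (prod_topology (prod_topology earring_top I01) euclideanreal) Z G"
    and seam: "\<And>x s. x \<in> earring \<Longrightarrow> G ((x, 1), s) = G ((earring_shift x, 0), s)"
  obtains G' where "continuous_map (prod_topology earring_torus euclideanreal) Z G'"
    "\<And>x \<tau> s. x \<in> earring \<Longrightarrow> \<tau> \<in> {0..1} \<Longrightarrow> G' (glue (x, \<tau>), s) = G ((x, \<tau>), s)"
proof -
  define G' where "G' = (\<lambda>(z, s). G (SOME a. a \<in> earring \<times> {0..1} \<and> glue a = z, s))"
  have G': "G' (glue a, s) = G (a, s)" if a: "a \<in> earring \<times> {0..1}" for a s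
  proof -
    have "\<exists>b. b \<in> earring \<times> {0..1} \<and> glue b = glue a" using a by blast
    then have "glue (SOME b. b \<in> earring \<times> {0..1} \<and> glue b = glue a) = glue a"
      by (rule someI2_ex) blast
    from glue_eq_imp[of "\<lambda>a. G (a, s)", OF seam a this] show ?thesis
      by (simp add: G'_def)
  qed
  have "continuous_map (prod_topology earring_torus euclideanreal) Z G'"
  proof (rule continuous_compose_quotient_map)
    show "quotient_map (prod_topology (prod_topology earring_top I01) euclideanreal)
        (prod_topology earring_torus euclideanreal) (\<lambda>(x, y). (glue x, y))"
      by (intro quotient_map_prod_left quotient_map_glue) (auto simp: locally_compact_space_euclidean)
    show "continuous_map (prod_topology (prod_topology earring_top I01) euclideanreal) Z
        (G' \<circ> (\<lambda>(x, y). (glue x, y)))"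
      by (rule continuous_map_eq[OF G]) (auto simp: G')
  qed
  then show ?thesis using that[of G'] G' by simp
qed

text \<open>For maps whose formula changes at the integers: the closed strips over the unit
  intervals form a locally finite cover.\<close>

lemma continuous_map_prod_intervals:
  fixes G :: "'a \<times> real \<Rightarrow> 'b"
  assumes G: "\<And>k::int. continuous_map (prod_topology X (top_of_set {of_int k..of_int k + 1})) Z G"
  shows "continuous_map (prod_topology X euclideanreal) Z G"
proof (rule pasting_lemma_locally_finite[where I = "UNIV :: int set" and f = "\<lambda>_. G"
      and T = "\<lambda>k. topspace X \<times> {of_int k..of_int k + 1}"])
  fix x assume x: "x \<in> topspace (prod_topology X euclideanreal)"
  obtain v s where vs: "x = (v, s)" by (cases x)
  define V where "V = topspace X \<times> {s - 1<..<s + 1}"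
  have "openin (prod_topology X euclideanreal) V"
    by (simp add: V_def openin_prod_Times_iff)
  moreover have "{k::int. topspace X \<times> {of_int k..of_int k + 1} \<inter> V \<noteq> {}} \<subseteq> {\<lfloor>s\<rfloor> - 3..\<lfloor>s\<rfloor> + 3}"
  proof
    fix k :: int assume "k \<in> {k::int. topspace X \<times> {of_int k..of_int k + 1} \<inter> V \<noteq> {}}"
    then obtain r :: real where "of_int k \<le> r" "r \<le> of_int k + 1" "s - 1 < r" "r < s + 1"
      by (auto simp: V_def)
    then show "k \<in> {\<lfloor>s\<rfloor> - 3..\<lfloor>s\<rfloor> + 3}" by simp linarith
  qed
  then have "finite {k::int. topspace X \<times> {of_int k..of_int k + 1} \<inter> V \<noteq> {}}"
    by (rule finite_subset) simp
  moreover have "x \<in> V" using x vs by (auto simp: V_def)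
  ultimately show "\<exists>V. openin (prod_topology X euclideanreal) V \<and> x \<in> V \<and>
      finite {k \<in> UNIV. topspace X \<times> {of_int k..of_int k + 1} \<inter> V \<noteq> {}}"
    by auto
  have "of_int \<lfloor>s\<rfloor> \<le> s" "s \<le> of_int \<lfloor>s\<rfloor> + 1" by linarith+
  then show "\<exists>j. j \<in> UNIV \<and> x \<in> topspace X \<times> {of_int j..of_int j + 1} \<and> G x = G x"
    using x vs by (intro exI[of _ "\<lfloor>s\<rfloor>"]) auto
next
  fix k :: int
  show "closedin (prod_topology X euclideanreal) (topspace X \<times> {of_int k..of_int k + 1})"
    by (simp add: closedin_prod_Times_iff)
  show "continuous_map (subtopology (prod_topology X euclideanreal) (topspace X \<times> {of_int k..of_int k + 1})) Z G"
    using G[of k] by (simp add: subtopology_Times)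
qed auto

lemma continuous_map_torus_descend1:
  fixes g :: "(real \<times> real) \<times> real \<Rightarrow> 'z"
  assumes "continuous_map (prod_topology earring_top I01) Z g"
    and "\<And>x. x \<in> earring \<Longrightarrow> g (x, 1) = g (earring_shift x, 0)"
  obtains g' where "continuous_map earring_torus Z g'"
    "\<And>x \<tau>. x \<in> earring \<Longrightarrow> \<tau> \<in> {0..1} \<Longrightarrow> g' (glue (x, \<tau>)) = g (x, \<tau>)"
proof -
  have "continuous_map (prod_topology (prod_topology earring_top I01) euclideanreal) Z (g \<circ> fst)"
    using assms(1) by (intro continuous_map_compose[OF continuous_map_fst])
  then obtain G where G: "continuous_map (prod_topology earring_torus euclideanreal) Z G"
    "\<And>x \<tau> s. x \<in> earring \<Longrightarrow> \<tau> \<in> {0..1} \<Longrightarrow> G (glue (x, \<tau>), s) = (g \<circ> fst) ((x, \<tau>), s)"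
    by (rule earring_torus_descend) (use assms(2) in auto)
  have "continuous_map earring_torus (prod_topology earring_torus euclideanreal) (\<lambda>z. (z, 0))"
    by (intro continuous_map_pairedI) auto
  from continuous_map_compose[OF this G(1)]
  show ?thesis using that[of "\<lambda>z. G (z, 0)"] G(2)[of _ _ 0] by (simp add: o_def)
qed

text \<open>Only the values at integers \<open>q\<close> matter, where the value lies on the circle; the interpolation in
  between makes the map continuous on the whole product.\<close>

definition telescope_angle :: "int \<Rightarrow> (real \<times> real) \<times> real \<Rightarrow> complex" where
  "telescope_angle j = (\<lambda>(x, q). of_real (1 - frac q) * angle (j + \<lfloor>q\<rfloor>) x + of_real (frac q) * angle (j + \<lfloor>q\<rfloor> + 1) x)"

lemma continuous_telescope_angle:
  "continuous_map (prod_topology earring_top euclideanreal) euclidean (telescope_angle j)"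
proof (rule continuous_map_prod_intervals)
  fix k :: int
  define g where "g = (\<lambda>z. of_real (1 - (snd z - of_int k)) * angle (j + k) (fst z) +
      of_real (snd z - of_int k) * angle (j + k + 1) (fst z))"
  have "continuous_on (earring \<times> {of_int k..of_int k + 1}) g"
    unfolding g_def
    by (intro continuous_intros continuous_on_compose2[OF continuous_on_angle continuous_on_fst[OF continuous_on_id]]) auto
  moreover have "g z = telescope_angle j z" if "z \<in> earring \<times> {of_int k..of_int k + 1}" for z
  proof (cases "snd z = of_int k + 1")
    \<comment> \<open>At the right end the floor has already moved on to \<open>k + 1\<close>, but
      both formulas give \<open>angle (j + k + 1)\<close>.\<close>
    case True
    then have "\<lfloor>snd z\<rfloor> = k + 1" "frac (snd z) = 0" by (simp_all add: frac_def)
    then show ?thesis using True by (simp add: g_def telescope_angle_def case_prod_unfold add.assoc)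
  next
    case False
    then have "\<lfloor>snd z\<rfloor> = k" using that by (cases z) (auto simp: floor_eq_iff)
    then show ?thesis by (simp add: g_def telescope_angle_def case_prod_unfold frac_def)
  qed
  ultimately have "continuous_on (earring \<times> {of_int k..of_int k + 1}) (telescope_angle j)"
    by (rule continuous_on_eq)
  then show "continuous_map (prod_topology earring_top (top_of_set {of_int k..of_int k + 1})) euclidean (telescope_angle j)"
    by (simp flip: subtopology_Times)
qed

text \<open>The angle of one circle gives no map on the torus, as the shift renames the circles.
  Paired with a lifted height it does: at the seam \<open>s - \<tau>\<close>, and with it the index,
  grows by 1, and \<open>angle (i + 1)\<close> after the shift is \<open>angle i\<close>.\<close>

lemma torus_angle_exists:
  "\<exists>g. continuous_map (prod_topology earring_torus euclideanreal) euclidean g \<and>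
     (\<forall>x\<in>earring. \<forall>\<tau>\<in>{0..1}. \<forall>k. g (glue (x, \<tau>), \<tau> + of_int k) = angle (j + k) x)"
proof -
  have "continuous_map (prod_topology (prod_topology earring_top I01) euclideanreal)
      (prod_topology earring_top euclideanreal) (\<lambda>z. (fst (fst z), snd z - snd (fst z)))"
  proof (intro continuous_map_pairedI continuous_map_diff continuous_map_snd)
    show "continuous_map (prod_topology (prod_topology earring_top I01) euclideanreal) earring_top (\<lambda>z. fst (fst z))"
      by (rule continuous_map_compose[OF continuous_map_fst continuous_map_fst, unfolded o_def])
    have "continuous_map (prod_topology earring_top I01) euclideanreal snd"
      by (rule continuous_map_into_fulltopology[OF continuous_map_snd])
    then show "continuous_map (prod_topology (prod_topology earring_top I01) euclideanreal) euclideanreal (\<lambda>z. snd (fst z))"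
      by (rule continuous_map_compose[OF continuous_map_fst, unfolded o_def])
  qed
  from continuous_map_compose[OF this continuous_telescope_angle[of j]]
  have "continuous_map (prod_topology (prod_topology earring_top I01) euclideanreal) euclidean
      (\<lambda>z. telescope_angle j (fst (fst z), snd z - snd (fst z)))"
    by (simp add: o_def)
  then obtain g where g: "continuous_map (prod_topology earring_torus euclideanreal) euclidean g"
    "\<And>x \<tau> s. x \<in> earring \<Longrightarrow> \<tau> \<in> {0..1} \<Longrightarrow> g (glue (x, \<tau>), s) = telescope_angle j (x, s - \<tau>)"
  proof (rule earring_torus_descend)
    fix x and s :: real assume x: "x \<in> earring"
    have "\<lfloor>s - 1\<rfloor> = \<lfloor>s\<rfloor> - 1" "frac (s - 1) = frac s" by (simp_all add: frac_def)
    then show "telescope_angle j (fst (fst ((x, 1), s)), snd ((x, 1), s) - snd (fst ((x, 1), s))) =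
        telescope_angle j (fst (fst ((earring_shift x, 0), s)), snd ((earring_shift x, 0), s) - snd (fst ((earring_shift x, 0), s)))"
      using angle_earring_shift[OF x, of "j + \<lfloor>s\<rfloor> - 1"] angle_earring_shift[OF x, of "j + \<lfloor>s\<rfloor>"]
      by (simp add: telescope_angle_def algebra_simps)
  qed simp
  have "g (glue (x, \<tau>), \<tau> + of_int k) = angle (j + k) x" if "x \<in> earring" "\<tau> \<in> {0..1}" for x \<tau> k
    using g(2)[OF that, of "\<tau> + of_int k"] by (simp add: telescope_angle_def)
  then show ?thesis using g(1) by blast
qed

definition torus_angle :: "int \<Rightarrow> ((real \<times> real) \<times> real) set \<times> real \<Rightarrow> complex" where
  "torus_angle j = (SOME g. continuous_map (prod_topology earring_torus euclideanreal) euclidean g \<and>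
     (\<forall>x\<in>earring. \<forall>\<tau>\<in>{0..1}. \<forall>k. g (glue (x, \<tau>), \<tau> + of_int k) = angle (j + k) x))"

lemma torus_angle:
  shows continuous_torus_angle: "continuous_map (prod_topology earring_torus euclideanreal) euclidean (torus_angle j)"
    and torus_angle_glue: "x \<in> earring \<Longrightarrow> \<tau> \<in> {0..1} \<Longrightarrow> torus_angle j (glue (x, \<tau>), \<tau> + of_int k) = angle (j + k) x"
  using someI_ex[OF torus_angle_exists[of j]] by (simp_all add: torus_angle_def)

lemma torus_projection:
  obtains pr where "continuous_map earring_torus euclidean pr"
    "\<And>x \<tau>. x \<in> earring \<Longrightarrow> \<tau> \<in> {0..1} \<Longrightarrow> pr (glue (x, \<tau>)) = cis (2 * pi * \<tau>)"
proof -
  have "continuous_on (earring \<times> {0..1}) (\<lambda>z. cis (2 * pi * snd z))"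
    by (intro continuous_intros)
  then have "continuous_map (prod_topology earring_top I01) euclidean (\<lambda>z. cis (2 * pi * snd z))"
    by (simp flip: subtopology_Times)
  then show ?thesis
    by (rule continuous_map_torus_descend1) (use that in auto)
qed

text \<open>The forward orbit of \<open>(x, 0)\<close>, with one shift for each seam crossed. For
  negative \<open>s\<close> it waits at the start, which keeps the map continuous on the whole
  line.\<close>

definition ray :: "(real \<times> real) \<times> real \<Rightarrow> ((real \<times> real) \<times> real) set" where
  "ray = (\<lambda>(x, s). glue ((earring_shift ^^ nat \<lfloor>s\<rfloor>) x, max 0 s - real (nat \<lfloor>s\<rfloor>)))"

lemma ray_eq_glue:
  assumes "x \<in> earring" "real n \<le> s" "s \<le> real n + 1"
  shows "ray (x, s) = glue ((earring_shift ^^ n) x, s - real n)"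
proof (cases "s = real n + 1")
  case True
  then have "nat \<lfloor>s\<rfloor> = Suc n" by (simp add: nat_eq_iff floor_eq_iff)
  then show ?thesis
    using True glue_seam[OF earring_shift_funpow_in[OF assms(1)], of n] by (simp add: ray_def)
next
  case False
  then have "\<lfloor>s\<rfloor> = int n" using assms by (simp add: floor_eq_iff)
  then show ?thesis using assms by (simp add: ray_def)
qed

lemma continuous_ray: "continuous_map (prod_topology earring_top euclideanreal) earring_torus ray"
proof (rule continuous_map_prod_intervals)
  fix k :: int
  define n where "n = nat k"
  define g where "g = (\<lambda>z :: (real \<times> real) \<times> real. ((earring_shift ^^ n) (fst z), max 0 (snd z - of_int k) * (if k < 0 then 0 else 1)))"
  have "continuous_on (earring \<times> {of_int k..of_int k + 1}) g"
    unfolding g_def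
    by (intro continuous_intros continuous_on_compose2[OF continuous_on_earring_shift_funpow continuous_on_fst[OF continuous_on_id]]) auto
  moreover have "g z \<in> earring \<times> {0..1}" if "z \<in> earring \<times> {of_int k..of_int k + 1}" for z
    using that by (auto simp: g_def earring_shift_funpow_in)
  ultimately have "continuous_map (top_of_set (earring \<times> {of_int k..of_int k + 1})) (top_of_set (earring \<times> {0..1})) g"
    by (auto simp: continuous_map_in_subtopology)
  then have "continuous_map (prod_topology earring_top (top_of_set {of_int k..of_int k + 1})) (prod_topology earring_top I01) g"
    by (simp flip: subtopology_Times)
  from continuous_map_compose[OF this continuous_map_glue]
  show "continuous_map (prod_topology earring_top (top_of_set {of_int k..of_int k + 1})) earring_torus ray"
  proof (rule continuous_map_eq)
    fix z assume "z \<in> topspace (prod_topology earring_top (top_of_set {real_of_int k..real_of_int k + 1}))"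
    then obtain x s where z: "z = (x, s)" "x \<in> earring" "of_int k \<le> s" "s \<le> of_int k + 1" by auto
    show "(glue \<circ> g) z = ray z"
    proof (cases "k < 0")
      case True
      then have "real_of_int k + 1 \<le> 0" by linarith
      then have "s \<le> 0" using z by linarith
      then have "nat \<lfloor>s\<rfloor> = 0" "max 0 s = 0" by simp_all
      then show ?thesis using True by (simp add: z ray_def g_def n_def)
    next
      case False
      then have "real n = of_int k" by (simp add: n_def)
      then show ?thesis using ray_eq_glue[of x n s] z False by (simp add: g_def)
    qed
  qed
qed

text \<open>Moving up at unit speed respects the gluing. As the shift is not onto, there is no flow
  backwards; negative times are clamped to 0.\<close>

lemma earring_torus_semiflow:
  obtains Fl where "continuous_map (prod_topology earring_torus euclideanreal) earring_torus Fl"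
    "\<And>x \<tau> u. x \<in> earring \<Longrightarrow> \<tau> \<in> {0..1} \<Longrightarrow> u \<ge> 0 \<Longrightarrow> Fl (glue (x, \<tau>), u) = ray (x, \<tau> + u)"
proof -
  have "continuous_map (prod_topology (prod_topology earring_top I01) euclideanreal)
      (prod_topology earring_top euclideanreal) (\<lambda>z. (fst (fst z), snd (fst z) + max 0 (snd z)))"
  proof (intro continuous_map_pairedI continuous_map_add continuous_map_real_max continuous_map_snd)
    show "continuous_map (prod_topology (prod_topology earring_top I01) euclideanreal) earring_top (\<lambda>z. fst (fst z))"
      by (rule continuous_map_compose[OF continuous_map_fst continuous_map_fst, unfolded o_def])
    have "continuous_map (prod_topology earring_top I01) euclideanreal snd"
      by (rule continuous_map_into_fulltopology[OF continuous_map_snd])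
    then show "continuous_map (prod_topology (prod_topology earring_top I01) euclideanreal) euclideanreal (\<lambda>z. snd (fst z))"
      by (rule continuous_map_compose[OF continuous_map_fst, unfolded o_def])
  qed simp
  from continuous_map_compose[OF this continuous_ray]
  have "continuous_map (prod_topology (prod_topology earring_top I01) euclideanreal) earring_torus
      (\<lambda>z. ray (fst (fst z), snd (fst z) + max 0 (snd z)))"
    by (simp add: o_def)
  then obtain Fl where "continuous_map (prod_topology earring_torus euclideanreal) earring_torus Fl"
    "\<And>x \<tau> s. x \<in> earring \<Longrightarrow> \<tau> \<in> {0..1} \<Longrightarrow> Fl (glue (x, \<tau>), s) = ray (x, \<tau> + max 0 s)"
  proof (rule earring_torus_descend)
    fix x and s :: real assume x: "x \<in> earring"
    define r where "r = max 0 s"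
    have r: "r \<ge> 0" by (simp add: r_def)
    define n where "n = nat \<lfloor>r\<rfloor>"
    have n: "real n \<le> r" "r \<le> real n + 1" using r unfolding n_def by linarith+
    have "ray (x, 1 + r) = glue ((earring_shift ^^ Suc n) x, 1 + r - real (Suc n))"
      using n by (intro ray_eq_glue[OF x]) auto
    also have "\<dots> = ray (earring_shift x, r)"
      using ray_eq_glue[OF earring_shift_in[OF x] n] by (simp add: funpow_swap1)
    finally show "ray (fst (fst ((x, 1), s)), snd (fst ((x, 1), s)) + max 0 (snd ((x, 1), s))) =
        ray (fst (fst ((earring_shift x, 0), s)), snd (fst ((earring_shift x, 0), s)) + max 0 (snd ((earring_shift x, 0), s)))"
      by (simp add: r_def)
  qed simp
  then show ?thesis using that[of Fl] by (simp add: max_def)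
qed

lemma torus_height_lift:
  assumes pr: "\<And>x \<tau>. x \<in> earring \<Longrightarrow> \<tau> \<in> {0..1} \<Longrightarrow> pr (glue (x, \<tau>)) = cis (2 * pi * \<tau>)"
    and z: "z \<in> topspace earring_torus" and s: "pr z = cis (2 * pi * s)"
  obtains x \<tau> k where "x \<in> earring" "\<tau> \<in> {0..1}" "z = glue (x, \<tau>)" "s = \<tau> + of_int k"
proof -
  obtain x \<tau> where x: "x \<in> earring" "\<tau> \<in> {0..1}" "z = glue (x, \<tau>)"
    using z by (auto simp: topspace_earring_torus)
  then have "s - \<tau> \<in> \<int>" using pr[OF x(1,2)] s by (simp flip: cis_2pi_eq_iff)
  then obtain k :: int where "s - \<tau> = of_int k" by (auto elim: Ints_cases)
  then show ?thesis using that x by (metis add.commute diff_add_cancel)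
qed

section \<open>Simple connectivity of the universal object\<close>

lemma earring_torus_universal_coordinates:
  assumes univ: "universal_upl_object earring_torus earring_torus_base Y y p"
  obtains s where "continuous_map Y euclideanreal s"
    "\<And>v. v \<in> topspace Y \<Longrightarrow> \<exists>x\<in>earring. \<exists>\<tau>\<in>{0..1}. \<exists>k::int. p v = glue (x, \<tau>) \<and> s v = \<tau> + of_int k"
proof -
  obtain pr where pr: "continuous_map earring_torus euclidean pr"
    "\<And>x \<tau>. x \<in> earring \<Longrightarrow> \<tau> \<in> {0..1} \<Longrightarrow> pr (glue (x, \<tau>)) = cis (2 * pi * \<tau>)"
    using torus_projection by blast
  have p: "continuous_map Y earring_torus p"
    using univ by (auto simp: universal_upl_object_def upl_object_def hurewicz_fibration_def)
  have pT: "p v \<in> topspace earring_torus" if "v \<in> topspace Y" for v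
    using continuous_map_image_subset_topspace[OF p] that by blast
  have "norm ((pr \<circ> p) v) = 1" if v: "v \<in> topspace Y" for v
  proof -
    obtain x \<tau> where "x \<in> earring" "\<tau> \<in> {0..1}" "p v = glue (x, \<tau>)"
      using pT[OF v] by (auto simp: topspace_earring_torus)
    then show ?thesis by (simp add: pr(2))
  qed
  then obtain s where s: "continuous_map Y euclideanreal s"
    "\<And>v. v \<in> topspace Y \<Longrightarrow> (pr \<circ> p) v = cis (2 * pi * s v)"
    using universal_upl_object_circle_lift[OF univ continuous_map_compose[OF p pr(1)]] by blast
  have "\<exists>x\<in>earring. \<exists>\<tau>\<in>{0..1}. \<exists>k::int. p v = glue (x, \<tau>) \<and> s v = \<tau> + of_int k"
    if v: "v \<in> topspace Y" for v
  proof -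
    have pr_s: "pr (p v) = cis (2 * pi * s v)" using s(2)[OF v] by simp
    obtain x \<tau> and k :: int where "x \<in> earring" "\<tau> \<in> {0..1}" "p v = glue (x, \<tau>)" "s v = \<tau> + of_int k"
      by (rule torus_height_lift[where pr = pr, OF _ pT[OF v] pr_s]) (auto intro: pr(2))
    then show ?thesis by blast
  qed
  then show ?thesis using that s(1) by blast
qed

lemma homotopy_concat:
  assumes f: "continuous_map (prod_topology W I01) X f" and g: "continuous_map (prod_topology W I01) X g"
    and fg: "\<And>w. w \<in> topspace W \<Longrightarrow> f (w, 1) = g (w, 0)"
  shows "continuous_map (prod_topology W I01) X
    (\<lambda>z. if snd z \<le> 1 / 2 then f (fst z, min 1 (2 * snd z)) else g (fst z, max 0 (2 * snd z - 1)))"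
proof (rule continuous_map_cases_le)
  have sndc: "continuous_map (prod_topology W I01) euclideanreal snd"
    by (rule continuous_map_into_fulltopology[OF continuous_map_snd])
  then show "continuous_map (prod_topology W I01) euclideanreal snd" .
  have "continuous_map I01 I01 (\<lambda>u. min 1 (2 * u))" "continuous_map I01 I01 (\<lambda>u. max 0 (2 * u - 1))"
    by (auto simp: continuous_map_in_subtopology intro!: continuous_intros)
  then have "continuous_map (prod_topology W I01) (prod_topology W I01) (\<lambda>z. (fst z, min 1 (2 * snd z)))"
    "continuous_map (prod_topology W I01) (prod_topology W I01) (\<lambda>z. (fst z, max 0 (2 * snd z - 1)))"
    by (auto intro!: continuous_map_pairedI continuous_map_fst
        intro: continuous_map_compose[OF continuous_map_snd, unfolded o_def])
  from continuous_map_compose[OF this(1) f] continuous_map_compose[OF this(2) g]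
  show "continuous_map (subtopology (prod_topology W I01) {x \<in> topspace (prod_topology W I01). snd x \<le> 1 / 2}) X
      (\<lambda>z. f (fst z, min 1 (2 * snd z)))"
    "continuous_map (subtopology (prod_topology W I01) {x \<in> topspace (prod_topology W I01). 1 / 2 \<le> snd x}) X
      (\<lambda>z. g (fst z, max 0 (2 * snd z - 1)))"
    by (auto simp: o_def intro: continuous_map_from_subtopology)
  show "f (fst x, min 1 (2 * snd x)) = g (fst x, max 0 (2 * snd x - 1))"
    if "x \<in> topspace (prod_topology W I01)" "snd x = 1 / 2" for x
    using fg[of "fst x"] that by auto
qed auto

text \<open>Lift \<open>M\<close> starting from \<open>\<gamma>\<close>. The two vertical sides of
  the lift cover the same path from the same point \<open>v\<close>, and its top covers a constant
  path; unique path lifting makes the sides equal and the top constant.\<close>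

lemma fibration_lift_free_nullhomotopy:
  assumes fib: "hurewicz_fibration Y X p" and upl: "unique_path_lifting Y p"
    and \<gamma>: "loop_at Y v \<gamma>"
    and M: "continuous_map (prod_topology I01 I01) X M"
    and M0: "\<And>t. t \<in> {0..1} \<Longrightarrow> M (t, 0) = p (\<gamma> t)"
    and M1: "\<And>t. t \<in> {0..1} \<Longrightarrow> M (t, 1) = M (0, 1)"
    and sides: "\<And>u. u \<in> {0..1} \<Longrightarrow> M (0, u) = M (1, u)"
  shows "loop_class Y v \<gamma> = loop_class Y v (\<lambda>_. v)"
proof -
  have \<gamma>': "pathin Y \<gamma>" "\<gamma> 0 = v" "\<gamma> 1 = v" using \<gamma> by (auto simp: loop_at_def)
  obtain K where K: "continuous_map (prod_topology I01 I01) Y K"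
    "\<And>t. t \<in> {0..1} \<Longrightarrow> K (t, 0) = \<gamma> t"
    "\<And>t u. t \<in> {0..1} \<Longrightarrow> u \<in> {0..1} \<Longrightarrow> p (K (t, u)) = M (t, u)"
    using hurewicz_fibration_lifting[OF fib, of I01] \<gamma>'(1) M M0
    unfolding homotopy_lifting_def pathin_def by (metis topspace_euclidean_subtopology)
  have vert: "pathin Y (\<lambda>u. K (t, u))" if "t \<in> {0..1}" for t
  proof -
    have "continuous_map I01 (prod_topology I01 I01) (\<lambda>u. (t, u))"
      using that by (intro continuous_map_pairedI) auto
    from continuous_map_compose[OF this K(1)] show ?thesis by (simp add: pathin_def o_def)
  qed
  have horiz: "pathin Y (\<lambda>t. K (t, u))" if "u \<in> {0..1}" for u
  proof -
    have "continuous_map I01 (prod_topology I01 I01) (\<lambda>t. (t, u))"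
      using that by (intro continuous_map_pairedI) auto
    from continuous_map_compose[OF this K(1)] show ?thesis by (simp add: pathin_def o_def)
  qed
  have uniq: "\<omega> t = \<omega>' t"
    if "pathin Y \<omega>" "pathin Y \<omega>'" "\<omega> 0 = \<omega>' 0" "\<And>t. t \<in> {0..1} \<Longrightarrow> p (\<omega> t) = p (\<omega>' t)" "t \<in> {0..1}" for \<omega> \<omega>' t
    using upl that unfolding unique_path_lifting_def by blast
  have side: "K (0, u) = K (1, u)" if "u \<in> {0..1}" for u
    by (rule uniq[OF vert vert]) (use that K \<gamma>' sides in auto)
  have "K (0, 1) \<in> topspace Y"
    using continuous_map_image_subset_topspace[OF K(1)] by auto
  then have const: "pathin Y (\<lambda>t. K (0, 1))" by (simp add: pathin_def)
  have top: "K (t, 1) = K (0, 1)" if "t \<in> {0..1}" for t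
  proof (rule uniq[OF horiz const])
    show "p (K (t, 1)) = p (K (0, 1))" if "t \<in> {0..1}" for t
      using K(3)[OF that, of 1] K(3)[of 0 1] M1[OF that] by simp
  qed (use that in simp_all)
  have K00: "K (0, 0) = v" using K(2)[of 0] \<gamma>' by simp
  have "loop_class Y v \<gamma> = loop_class Y v (\<lambda>t. K (t, 0))"
    using \<gamma> K(2) by (intro loop_class_cong) auto
  also have "\<dots> = loop_class Y v (\<lambda>_. v)"
    using loop_class_free_nullhomotopy[OF K(1) side top] by (simp add: K00)
  finally show ?thesis .
qed

lemma universal_loop_null:
  assumes univ: "universal_upl_object earring_torus earring_torus_base Y y p"
    and \<gamma>: "loop_at Y v \<gamma>"
  shows "loop_class Y v \<gamma> = loop_class Y v (\<lambda>_. v)"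
proof -
  have fib: "hurewicz_fibration Y earring_torus p" and p: "continuous_map Y earring_torus p"
    and upl: "unique_path_lifting Y p" and pc: "path_connected_space Y"
    using univ by (auto simp: universal_upl_object_def upl_object_def hurewicz_fibration_def)
  obtain s where s: "continuous_map Y euclideanreal s"
    "\<And>v. v \<in> topspace Y \<Longrightarrow> \<exists>x\<in>earring. \<exists>\<tau>\<in>{0..1}. \<exists>k::int. p v = glue (x, \<tau>) \<and> s v = \<tau> + of_int k"
    using earring_torus_universal_coordinates[OF univ] by blast
  then obtain X \<tau> k where X: "\<And>v. v \<in> topspace Y \<Longrightarrow> X v \<in> earring" "\<And>v. v \<in> topspace Y \<Longrightarrow> \<tau> v \<in> {0..1}"
    "\<And>v. v \<in> topspace Y \<Longrightarrow> p v = glue (X v, \<tau> v)" "\<And>v. v \<in> topspace Y \<Longrightarrow> s v = \<tau> v + of_int (k v :: int)"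
    by metis
  \<comment> \<open>\<open>X\<close>, \<open>\<tau>\<close> and \<open>k\<close> are mere choices of
    representatives and need not be continuous; \<open>\<theta> j\<close> is, being built from
    \<open>p\<close> and \<open>s\<close>.\<close>
  define \<theta> where "\<theta> = (\<lambda>j v. torus_angle j (p v, s v))"
  have \<theta>: "\<theta> j v = angle (j + k v) (X v)" if "v \<in> topspace Y" for j v
    using X[OF that] torus_angle_glue[of "X v" "\<tau> v" j "k v"] by (simp add: \<theta>_def)
  interpret circle_family Y \<theta>
  proof
    show "path_connected_space Y" by fact
    show "continuous_map Y euclidean (\<theta> j)" for j
      unfolding \<theta>_def
      using continuous_map_compose[OF continuous_map_pairedI[OF p s(1)] continuous_torus_angle] by (simp add: o_def)
    show "norm (\<theta> j v) = 1" if "v \<in> topspace Y" for j v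
      using \<theta> that X norm_angle by simp
    show "i = j" if "v \<in> topspace Y" "\<theta> i v \<noteq> 1" "\<theta> j v \<noteq> 1" for i j v
      using angle_disjoint[OF X(1)[OF that(1)], of "i + k v" "j + k v"] that \<theta> by simp
    show "\<exists>c. continuous_map Y euclideanreal c \<and> (\<forall>v\<in>topspace Y. \<phi> v = cis (2 * pi * c v))"
      if "continuous_map Y euclidean \<phi>" "\<And>v. v \<in> topspace Y \<Longrightarrow> norm (\<phi> v) = 1" for \<phi>
      by (rule universal_upl_object_circle_lift[OF univ that]) blast+
  qed
  have path: "pathin Y \<gamma>" and ends: "\<gamma> 0 = v" "\<gamma> 1 = v" using \<gamma> by (auto simp: loop_at_def)
  have \<gamma>Y: "\<gamma> t \<in> topspace Y" if "t \<in> {0..1}" for t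
    using funcset_mem[OF path_image_subset_topspace[OF path] that] .
  have s\<gamma>: "continuous_on {0..1} (\<lambda>t. s (\<gamma> t))"
    using pathin_compose[OF path s(1)] by (simp add: path_def o_def)
  then have "bounded ((\<lambda>t. s (\<gamma> t)) ` {0..1})"
    by (intro compact_imp_bounded compact_continuous_image) auto
  then obtain B where "\<forall>r\<in>(\<lambda>t. s (\<gamma> t)) ` {0..1}. \<bar>r\<bar> \<le> B"
    by (auto simp: bounded_real)
  then have B: "\<bar>s (\<gamma> t)\<bar> \<le> B" if "t \<in> {0..1}" for t
    using that by blast
  \<comment> \<open>An integer height above the whole loop, which every point reaches in
    non-negative time.\<close>
  define K where "K = \<lceil>B\<rceil>"
  have sK: "s (\<gamma> t) \<le> of_int K" if "t \<in> {0..1}" for t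
    using B[OF that] unfolding K_def by linarith
  have kK: "k (\<gamma> t) \<le> K" if "t \<in> {0..1}" for t
  proof -
    have "of_int (k (\<gamma> t)) \<le> (of_int K :: real)"
      using sK[OF that] X(2,4)[OF \<gamma>Y[OF that]] by simp
    then show ?thesis by simp
  qed
  define n where "n = (\<lambda>t. nat (K - k (\<gamma> t)))"
  have n: "int (n t) = K - k (\<gamma> t)" if "t \<in> {0..1}" for t using kK[OF that] by (simp add: n_def)
  define x where "x = (\<lambda>t. (earring_shift ^^ n t) (X (\<gamma> t)))"
  have xE: "x t \<in> earring" if "t \<in> {0..1}" for t
    unfolding x_def using X(1) \<gamma>Y[OF that] by (intro earring_shift_funpow_in)
  have angle_x: "angle i (x t) = \<theta> (i - K) (\<gamma> t)" if t: "t \<in> {0..1}" for i t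
    using angle_earring_shift_funpow[OF X(1)[OF \<gamma>Y[OF t]], of "i - int (n t)" "n t"] n[OF t] \<theta>[OF \<gamma>Y[OF t], of "i - K"]
    by (simp add: x_def algebra_simps)
  \<comment> \<open>The number \<open>n t\<close> of shifts jumps, yet by \<open>angle_x\<close> the
    angles of \<open>x\<close> vary continuously.\<close>
  have x_cont: "continuous_on {0..1} x"
  proof (rule continuous_on_earringI)
    show "x ` {0..1} \<subseteq> earring" using xE by blast
    show "continuous_on {0..1} (\<lambda>t. angle i (x t))" for i
    proof -
      have "continuous_on {0..1} (\<lambda>t. \<theta> (i - K) (\<gamma> t))"
        using pathin_compose[OF path cont[of "i - K"]] by (simp add: pathin_def o_def)
      then show ?thesis by (rule continuous_on_eq) (simp add: angle_x)
    qed
  qed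
  \<comment> \<open>For the full piece \<open>arcs (i - K)\<close> the cut map is
    \<open>\<theta> (i - K)\<close> itself, so its coordinate determines the angle of index
    \<open>i\<close>.\<close>
  have x_eq: "x a = x b" if ab: "a \<in> {0..1}" "b \<in> {0..1}" "eqv (\<gamma> a) (\<gamma> b)" for a b
  proof (rule angle_inject)
    fix i
    have "openin Y (arcs (i - K))"
    proof -
      have "arcs (i - K) = {v \<in> topspace Y. \<theta> (i - K) v \<in> - {1}}" by (auto simp: arcs_def)
      then show ?thesis using openin_vimage[OF cont, of "- {1}" "i - K"] by (simp add: open_Compl)
    qed
    then have "piece (i - K) (arcs (i - K))" by (simp add: piece_def)
    then obtain c where c: "coord (i - K) (arcs (i - K)) c" using coord_exists by blast
    then have "c (\<gamma> a) = c (\<gamma> b)" using ab(3) by (auto simp: eqv_def coords_def)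
    moreover have "\<theta> (i - K) w = cis (2 * pi * c w)" if "w \<in> topspace Y" for w
      using c that by (auto simp: coord_def cut_def arcs_def split: if_splits)
    ultimately show "angle i (x a) = angle i (x b)"
      using \<gamma>Y ab(1,2) by (simp add: angle_x)
  qed (use ab xE in auto)
  obtain H :: "real \<times> real \<Rightarrow> real \<times> real" where H: "continuous_on ({0..1} \<times> {0..1}) H" "H ` ({0..1} \<times> {0..1}) \<subseteq> x ` {0..1}"
    "\<And>t. t \<in> {0..1} \<Longrightarrow> H (t, 0) = x t" "\<And>t. t \<in> {0..1} \<Longrightarrow> H (t, 1) = x 0"
    "\<And>u. u \<in> {0..1} \<Longrightarrow> H (0, u) = x 0" "\<And>u. u \<in> {0..1} \<Longrightarrow> H (1, u) = x 0"
    by (rule coord_nullhomotopy[OF path _ x_cont x_eq]) (simp_all add: ends)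
  obtain Fl where Fl: "continuous_map (prod_topology earring_torus euclideanreal) earring_torus Fl"
    "\<And>x \<tau> u. x \<in> earring \<Longrightarrow> \<tau> \<in> {0..1} \<Longrightarrow> u \<ge> 0 \<Longrightarrow> Fl (glue (x, \<tau>), u) = ray (x, \<tau> + u)"
    by (rule earring_torus_semiflow) blast
  define f where "f = (\<lambda>z. Fl (p (\<gamma> (fst z)), snd z * (of_int K - s (\<gamma> (fst z)))))"
  define g where "g = (\<lambda>z. glue (H z, 0))"
  have f: "continuous_map (prod_topology I01 I01) earring_torus f"
  proof -
    have 1: "continuous_map (prod_topology I01 I01) earring_torus (\<lambda>z. p (\<gamma> (fst z)))"
      using continuous_map_compose[OF continuous_map_fst, of I01 earring_torus "p \<circ> \<gamma>" I01] pathin_compose[OF path p]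
      by (simp only: pathin_def o_def)
    have "continuous_on ({0..1} \<times> {0..1}) (\<lambda>z. snd z * (of_int K - s (\<gamma> (fst z))))"
      by (intro continuous_intros continuous_on_compose2[OF s\<gamma> continuous_on_fst[OF continuous_on_id]]) auto
    then have 2: "continuous_map (prod_topology I01 I01) euclideanreal (\<lambda>z. snd z * (of_int K - s (\<gamma> (fst z))))"
      by (simp flip: subtopology_Times)
    show ?thesis
      using continuous_map_compose[OF continuous_map_pairedI[OF 1 2] Fl(1)] by (simp only: f_def o_def)
  qed
  have g: "continuous_map (prod_topology I01 I01) earring_torus g"
  proof -
    have "H z \<in> earring" if "z \<in> {0..1} \<times> {0..1}" for z
      using subsetD[OF H(2) imageI[OF that]] xE by auto
    then have "continuous_map (top_of_set ({0..1} \<times> {0..1})) (top_of_set (earring \<times> {0..1})) (\<lambda>z. (H z, 0 :: real))"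
      using H(1) by (auto simp: continuous_map_in_subtopology intro!: continuous_intros)
    then have "continuous_map (prod_topology I01 I01) (prod_topology earring_top I01) (\<lambda>z. (H z, 0))"
      by (simp flip: subtopology_Times)
    from continuous_map_compose[OF this continuous_map_glue] show ?thesis by (simp only: g_def o_def)
  qed
  have f0: "f (t, 0) = p (\<gamma> t)" if t: "t \<in> {0..1}" for t
  proof -
    have "ray (X (\<gamma> t), \<tau> (\<gamma> t)) = glue (X (\<gamma> t), \<tau> (\<gamma> t))"
      using ray_eq_glue[of "X (\<gamma> t)" 0 "\<tau> (\<gamma> t)"] X[OF \<gamma>Y[OF t]] by simp
    then show ?thesis using Fl(2)[of "X (\<gamma> t)" "\<tau> (\<gamma> t)" 0] X[OF \<gamma>Y[OF t]] by (simp add: f_def)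
  qed
  have f1: "f (t, 1) = glue (x t, 0)" if t: "t \<in> {0..1}" for t
  proof -
    have "f (t, 1) = ray (X (\<gamma> t), \<tau> (\<gamma> t) + (of_int K - s (\<gamma> t)))"
      using Fl(2)[of "X (\<gamma> t)" "\<tau> (\<gamma> t)" "of_int K - s (\<gamma> t)"] X[OF \<gamma>Y[OF t]] sK[OF t] by (simp add: f_def)
    also have "\<tau> (\<gamma> t) + (of_int K - s (\<gamma> t)) = real (n t)"
      using X(4)[OF \<gamma>Y[OF t]] arg_cong[OF n[OF t], of real_of_int] by simp
    also have "ray (X (\<gamma> t), real (n t)) = glue (x t, 0)"
      using ray_eq_glue[of "X (\<gamma> t)" "n t" "real (n t)"] X(1)[OF \<gamma>Y[OF t]] by (simp add: x_def)
    finally show ?thesis .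
  qed
  define M where "M = (\<lambda>z. if snd z \<le> 1 / 2 then f (fst z, min 1 (2 * snd z)) else g (fst z, max 0 (2 * snd z - 1)))"
  have M: "continuous_map (prod_topology I01 I01) earring_torus M"
    unfolding M_def by (rule homotopy_concat[OF f g]) (use f1 H(3) in \<open>simp add: g_def\<close>)
  show ?thesis
  proof (rule fibration_lift_free_nullhomotopy[OF fib upl \<gamma> M])
    show "M (t, 0) = p (\<gamma> t)" if "t \<in> {0..1}" for t using f0[OF that] by (simp add: M_def)
    show "M (t, 1) = M (0, 1)" if "t \<in> {0..1}" for t using H(4)[OF that] H(4)[of 0] by (simp add: M_def g_def)
    show "M (0, u) = M (1, u)" if "u \<in> {0..1}" for u
      using that ends H(5,6)[of "max 0 (2 * u - 1)"] by (auto simp: M_def g_def f_def)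
  qed
qed

lemma universal_simply_connected:
  assumes univ: "universal_upl_object earring_torus earring_torus_base Y y p"
  shows "simply_connected_space Y"
proof (rule simply_connected_spaceI)
  show "path_connected_space Y" using univ by (auto simp: universal_upl_object_def upl_object_def)
qed (rule universal_loop_null[OF univ])

section \<open>Uncountability of the Spanier group\<close>

text \<open>The loop runs once through the circle of radius \<open>1 / (n + 1)\<close>, during the time interval from
  \<open>1 / (n + 2)\<close> to \<open>1 / (n + 1)\<close>, for every \<open>n \<in> A\<close>.\<close>

definition subset_loop :: "nat set \<Rightarrow> real \<Rightarrow> real \<times> real" where
  "subset_loop A t = (let m = nat \<lfloor>1 / t\<rfloor> in
     if 0 < t \<and> t \<le> 1 \<and> m - 1 \<in> A then earring_loop m (real m * (real m + 1) * (t - 1 / (real m + 1)))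
     else (0, 0))"

text \<open>The clock of the circle of radius \<open>1 / (n + 1)\<close>: it runs from 0 to 1 during
  its time interval and stands still outside. The slope is the reciprocal of the interval
  length.\<close>

definition subset_loop_time :: "nat \<Rightarrow> real \<Rightarrow> real" where
  "subset_loop_time n t = max 0 (min 1 ((real n + 1) * (real n + 2) * (t - 1 / (real n + 2))))"

lemma nat_floor_inverse:
  fixes t :: real
  assumes "0 < t" "t \<le> 1" "m = nat \<lfloor>1 / t\<rfloor>"
  shows "m \<ge> 1" "1 / (real m + 1) < t" "t \<le> 1 / real m"
proof -
  have "1 \<le> 1 / t" using assms by simp
  then have "1 \<le> \<lfloor>1 / t\<rfloor>" by linarith
  then show m: "m \<ge> 1" using assms(3) by linarith
  have "real m \<le> 1 / t" "1 / t < real m + 1"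
    using \<open>1 \<le> \<lfloor>1 / t\<rfloor>\<close> assms(3) by linarith+
  then show "1 / (real m + 1) < t" "t \<le> 1 / real m"
    using assms(1) m by (simp_all add: field_simps)
qed

lemma mult_inverse_diff: "a \<noteq> 0 \<Longrightarrow> b \<noteq> 0 \<Longrightarrow> a * b * (1 / a - 1 / b) = b - (a :: real)"
  by (simp add: field_simps)

lemma subset_loop_arg:
  assumes "m \<ge> 1" "1 / (real m + 1) \<le> t" "t \<le> 1 / real m"
  shows "real m * (real m + 1) * (t - 1 / (real m + 1)) \<in> {0..1}"
proof -
  have "real m * (real m + 1) * (t - 1 / (real m + 1)) \<le> real m * (real m + 1) * (1 / real m - 1 / (real m + 1))"
    using assms by (intro mult_left_mono) auto
  also have "\<dots> = 1" using assms(1) mult_inverse_diff[of "real m" "real m + 1"] by simp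
  finally show ?thesis using assms by simp
qed

lemma subset_loop_cases:
  assumes "t \<in> {0..1}"
  obtains "subset_loop A t = (0, 0)" "t = 0"
  | m where "m \<ge> 1" "1 / (real m + 1) < t" "t \<le> 1 / real m"
      "subset_loop A t = (if m - 1 \<in> A then earring_loop m (real m * (real m + 1) * (t - 1 / (real m + 1))) else (0, 0))"
proof (cases "t = 0")
  case True
  then show ?thesis using that(1) by (simp add: subset_loop_def)
next
  case False
  then have t: "0 < t" "t \<le> 1" using assms by auto
  show ?thesis
    by (rule that(2)[OF nat_floor_inverse[OF t refl]]) (use t in \<open>simp add: subset_loop_def Let_def\<close>)
qed

lemma subset_loop_in: "t \<in> {0..1} \<Longrightarrow> subset_loop A t \<in> earring"
  by (erule subset_loop_cases[of t A]) (auto simp: zero_in_earring intro!: earring_loop_in subset_loop_arg)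

lemma angle_subset_loop:
  assumes t: "t \<in> {0..1}"
  shows "angle (int (Suc n)) (subset_loop A t) = (if n \<in> A then cis (2 * pi * subset_loop_time n t) else 1)"
  using t
proof (cases rule: subset_loop_cases[of t A])
  case 1
  have "subset_loop_time n 0 = 0"
    by (simp add: subset_loop_time_def min_def max_def mult_le_0_iff)
  then show ?thesis using 1 by simp
next
  case (2 m)
  \<comment> \<open>Large \<open>m\<close> means early time: for \<open>m \<ge> n + 2\<close> the
    clock still shows 0, for \<open>m \<le> n\<close> it already shows 1, and both give angle
    1.\<close>
  consider "m = Suc n" | "m \<ge> n + 2" | "m \<le> n" by linarith
  then show ?thesis
  proof cases
    case 1
    have "real m * (real m + 1) * (t - 1 / (real m + 1)) = subset_loop_time n t"
      using subset_loop_arg[OF 2(1) less_imp_le[OF 2(2)] 2(3)]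
      by (simp add: subset_loop_time_def 1 add.commute max_def min_def)
    then show ?thesis using 2 by (simp add: angle_loop 1)
  next
    case a: 2
    then have "1 / real m \<le> 1 / (real n + 2)" by (intro divide_left_mono) auto
    then have "(real n + 1) * (real n + 2) * (t - 1 / (real n + 2)) \<le> 0"
      using 2(3) by (intro mult_nonneg_nonpos) auto
    then have "subset_loop_time n t = 0" by (simp add: subset_loop_time_def)
    then show ?thesis using 2 a by (simp add: angle_loop)
  next
    case b: 3
    then have "1 / (real n + 1) \<le> 1 / (real m + 1)" by (intro divide_left_mono) auto
    then have "(real n + 1) * (real n + 2) * (1 / (real n + 1) - 1 / (real n + 2))
        \<le> (real n + 1) * (real n + 2) * (t - 1 / (real n + 2))"
      using 2(2) by (intro mult_left_mono) auto
    moreover have "(real n + 1) * (real n + 2) * (1 / (real n + 1) - 1 / (real n + 2)) = 1"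
      by (subst mult_inverse_diff) auto
    ultimately have "subset_loop_time n t = 1" by (simp add: subset_loop_time_def)
    moreover have "cis (2 * pi) = 1" by (simp add: complex_eq_iff)
    ultimately show ?thesis using 2 b by (simp add: angle_loop)
  qed
qed

lemma continuous_subset_loop: "continuous_on {0..1} (subset_loop A)"
proof (rule continuous_on_earringI)
  show "subset_loop A ` {0..1} \<subseteq> earring" using subset_loop_in by blast
  fix i
  show "continuous_on {0..1} (\<lambda>t. angle i (subset_loop A t))"
  proof (cases "i \<ge> 1")
    case True
    then obtain n where i: "i = int (Suc n)" by (intro that[of "nat (i - 1)"]) simp
    have "continuous_on {0..1} (\<lambda>t. if n \<in> A then cis (2 * pi * subset_loop_time n t) else 1)"
      unfolding subset_loop_time_def by (cases "n \<in> A") (auto intro!: continuous_intros)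
    then show ?thesis
      by (rule continuous_on_eq) (simp only: i angle_subset_loop)
  next
    case False
    have "continuous_on {0..1::real} (\<lambda>t. 1 :: complex)" by simp
    then show ?thesis
    proof (rule continuous_on_eq)
      fix t :: real assume "t \<in> {0..1}"
      then obtain m s where "m \<ge> 1" "subset_loop A t = earring_loop m s"
        using subset_loop_in earring_cases by metis
      then show "1 = angle i (subset_loop A t)" using False by (simp add: angle_loop)
    qed
  qed
qed

lemma subset_loop_ends: "subset_loop A 0 = (0, 0)" "subset_loop A 1 = (0, 0)"
  by (simp_all add: subset_loop_def earring_loop_def)

lemma pathin_glue:
  assumes "continuous_on {0..1} x" "\<And>t. t \<in> {0..1} \<Longrightarrow> x t \<in> earring"
  shows "pathin earring_torus (\<lambda>t. glue (x t, 0))"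
proof -
  have "continuous_map I01 (prod_topology earring_top I01) (\<lambda>t. (x t, 0))"
    using assms by (intro continuous_map_pairedI) (auto simp: continuous_map_in_subtopology)
  from continuous_map_compose[OF this continuous_map_glue] show ?thesis by (simp only: pathin_def o_def)
qed

lemma earring_torus_base_eq: "earring_torus_base = glue ((0, 0), 0)"
  by (simp add: earring_torus_base_def)

lemma loop_at_subset_loop: "loop_at earring_torus earring_torus_base (\<lambda>t. glue (subset_loop A t, 0))"
  using pathin_glue[OF continuous_subset_loop subset_loop_in, of A]
  by (simp add: loop_at_def subset_loop_ends earring_torus_base_eq)

lemma earring_shift_funpow_small:
  assumes V: "openin (prod_topology earring_top I01) V" "((0, 0), 0) \<in> V"
  obtains n where "\<And>x. x \<in> earring \<Longrightarrow> ((earring_shift ^^ n) x, 0) \<in> V"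
proof -
  have "openin (top_of_set (earring \<times> {0..1})) V" using V(1) by (simp flip: subtopology_Times)
  then obtain e where e: "e > 0" "ball ((0, 0), 0) e \<inter> (earring \<times> {0..1}) \<subseteq> V"
    using V(2) by (meson openin_contains_ball)
  obtain n :: nat where n: "3 / e < n" using reals_Archimedean2 by blast
  have "((earring_shift ^^ n) x, 0) \<in> V" if x: "x \<in> earring" for x
  proof -
    obtain m t where m: "m \<ge> 1" "t \<in> {0..1}" "x = earring_loop m t" using x by (elim earring_cases)
    have "norm ((earring_shift ^^ n) x) \<le> 3 / real (m + n)"
      using norm_earring_loop[of "m + n" t] m by (simp add: earring_shift_funpow_loop)
    moreover have "3 / real (m + n) < e"
    proof -
      have "3 / e < real (m + n)" using n by simp
      then show ?thesis using e(1) m by (simp add: field_simps)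
    qed
    ultimately have "dist ((0, 0), 0) ((earring_shift ^^ n) x, 0 :: real) < e"
      by (simp add: dist_Pair_Pair dist_norm flip: zero_prod_def)
    then show ?thesis using e(2) earring_shift_funpow_in[OF x] by (force simp: mem_ball)
  qed
  then show ?thesis using that by blast
qed

text \<open>Given a cover, let the loop flow for an integer time \<open>n\<close> after which it
  lies in a member \<open>U\<close> around the basepoint. Meanwhile the basepoint runs
  \<open>n\<close> times around the torus; this trace is the conjugating path, so the class is a
  single generator.\<close>

lemma earring_loop_in_spanier_group:
  assumes x: "continuous_on {0..1} x" "\<And>t. t \<in> {0..1} \<Longrightarrow> x t \<in> earring" "x 0 = (0, 0)" "x 1 = (0, 0)"
  shows "loop_class earring_torus earring_torus_base (\<lambda>t. glue (x t, 0)) \<in> spanier_group earring_torus earring_torus_base"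
  unfolding spanier_group_def
proof (rule INT_I)
  fix \<U> assume "\<U> \<in> {\<U>. open_cover earring_torus \<U>}"
  then have op: "\<And>U. U \<in> \<U> \<Longrightarrow> openin earring_torus U" and cover: "\<Union>\<U> = topspace earring_torus"
    by (auto simp: open_cover_def)
  have "glue ((0, 0), 0) \<in> \<Union>\<U>"
    unfolding cover topspace_earring_torus using zero_in_earring by auto
  then obtain U where U: "U \<in> \<U>" "glue ((0, 0), 0) \<in> U" by blast
  have "openin (prod_topology earring_top I01) {z \<in> topspace (prod_topology earring_top I01). glue z \<in> U}"
    using op[OF U(1)] by (rule openin_continuous_map_preimage[OF continuous_map_glue])
  moreover have "((0, 0), 0) \<in> {z \<in> topspace (prod_topology earring_top I01). glue z \<in> U}"
    using U(2) zero_in_earring by simp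
  ultimately obtain n where n: "\<And>x. x \<in> earring \<Longrightarrow> glue ((earring_shift ^^ n) x, 0) \<in> U"
    by (rule earring_shift_funpow_small) blast
  define K where "K = (\<lambda>z. ray (x (fst z), real n * snd z))"
  have "continuous_on ({0..1} \<times> {0..1}) (\<lambda>z. x (fst z))"
    by (intro continuous_on_compose2[OF x(1)] continuous_intros) auto
  then have "continuous_map (prod_topology I01 I01) earring_top (\<lambda>z. x (fst z))"
    using x(2) by (auto simp: continuous_map_in_subtopology simp flip: subtopology_Times)
  moreover have "continuous_map (prod_topology I01 I01) euclideanreal (\<lambda>z. real n * snd z)"
    by (auto simp flip: subtopology_Times intro!: continuous_intros)
  ultimately have K: "continuous_map (prod_topology I01 I01) earring_torus K"
    using continuous_map_compose[OF continuous_map_pairedI continuous_ray] by (simp only: K_def o_def)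
  have K0: "K (t, 0) = glue (x t, 0)" and K1: "K (t, 1) = glue ((earring_shift ^^ n) (x t), 0)"
    if "t \<in> {0..1}" for t
    using ray_eq_glue[OF x(2)[OF that], of 0 0] ray_eq_glue[OF x(2)[OF that], of n "real n"]
    by (simp_all add: K_def)
  have sides: "K (0, u) = K (1, u)" for u using x(3,4) by (simp add: K_def)
  have vert: "pathin earring_torus (\<lambda>u. K (0, u))" and horiz: "pathin earring_torus (\<lambda>t. K (t, 1))"
  proof -
    have "continuous_map I01 (prod_topology I01 I01) (\<lambda>u. (0, u))"
      "continuous_map I01 (prod_topology I01 I01) (\<lambda>t. (t, 1))"
      by (intro continuous_map_pairedI; simp)+
    then show "pathin earring_torus (\<lambda>u. K (0, u))" "pathin earring_torus (\<lambda>t. K (t, 1))"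
      using continuous_map_compose[OF _ K] by (simp_all only: pathin_def o_def)
  qed
  have base: "K (0, 0) = earring_torus_base"
    using K0[of 0] x(3) by (simp add: earring_torus_base_eq)
  have "loop_class earring_torus earring_torus_base (\<lambda>t. glue (x t, 0)) = loop_class earring_torus earring_torus_base (\<lambda>t. K (t, 0))"
    using pathin_glue[OF x(1,2)] x(3,4) K0
    by (intro loop_class_cong) (simp_all add: loop_at_def earring_torus_base_eq)
  also have "\<dots> = loop_class earring_torus earring_torus_base
      (path_join (path_join (\<lambda>u. K (0, u)) (\<lambda>t. K (t, 1))) (path_reverse (\<lambda>u. K (0, u))))"
    using loop_class_free_homotopy[OF K sides] by (simp only: base)
  also have "\<dots> \<in> spanier_subgroup earring_torus earring_torus_base \<U>"
    unfolding spanier_subgroup_def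
  proof (rule generate.incl, rule CollectI, intro exI conjI)
    show "pathin earring_torus (\<lambda>u. K (0, u))" "K (0, 0) = earring_torus_base" by fact+
    show "loop_at earring_torus (K (0, 1)) (\<lambda>t. K (t, 1))"
      using horiz sides[of 1] by (simp add: loop_at_def)
    show "\<exists>U\<in>\<U>. (\<lambda>t. K (t, 1)) ` {0..1} \<subseteq> U"
    proof (intro bexI[of _ U] image_subsetI)
      fix t :: real assume "t \<in> {0..1}"
      then show "K (t, 1) \<in> U" using n[OF x(2)] K1 by simp
    qed (rule U(1))
  qed (rule refl)
  finally show "loop_class earring_torus earring_torus_base (\<lambda>t. glue (x t, 0))
      \<in> spanier_subgroup earring_torus earring_torus_base \<U>" .
qed

text \<open>On the homotopy square first the height and then an angle lift to the line. The lifted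
  angle is constant along the two sides where the homotopy rests at the basepoint, so its changes
  along the other two sides, the winding numbers of the two loops, agree.\<close>

lemma subset_loop_class_inject:
  assumes eq: "loop_class earring_torus earring_torus_base (\<lambda>t. glue (subset_loop A t, 0)) =
      loop_class earring_torus earring_torus_base (\<lambda>t. glue (subset_loop B t, 0))"
  shows "A = B"
proof -
  let ?b = "earring_torus_base"
  have "(\<lambda>t. glue (subset_loop B t, 0)) \<in> loop_class earring_torus ?b (\<lambda>t. glue (subset_loop B t, 0))"
    using loop_at_subset_loop[of B]
    by (auto simp: loop_class_def loop_at_def pathin_def intro!: homotopic_with_refl[THEN iffD2])
  then have "homotopic_with (\<lambda>k. k 0 = ?b \<and> k 1 = ?b) I01 earring_torus
      (\<lambda>t. glue (subset_loop A t, 0)) (\<lambda>t. glue (subset_loop B t, 0))"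
    unfolding eq[symmetric] by (simp add: loop_class_def)
  then obtain H where H: "continuous_map (prod_topology I01 I01) earring_torus H"
    "\<And>t. H (0, t) = glue (subset_loop A t, 0)" "\<And>t. H (1, t) = glue (subset_loop B t, 0)"
    "\<And>u. u \<in> {0..1} \<Longrightarrow> H (u, 0) = ?b" "\<And>u. u \<in> {0..1} \<Longrightarrow> H (u, 1) = ?b"
    unfolding homotopic_with_def by blast
  obtain pr where pr: "continuous_map earring_torus euclidean pr"
    "\<And>x \<tau>. x \<in> earring \<Longrightarrow> \<tau> \<in> {0..1} \<Longrightarrow> pr (glue (x, \<tau>)) = cis (2 * pi * \<tau>)"
    using torus_projection by blast
  define Q where "Q = {0..1::real} \<times> {0..1::real}"
  have HQ: "H z \<in> topspace earring_torus" if "z \<in> Q" for z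
    using continuous_map_image_subset_topspace[OF H(1)] that by (auto simp: Q_def)
  have to_on: "continuous_on Q f" if "continuous_map (prod_topology I01 I01) euclidean f" for f :: "real \<times> real \<Rightarrow> complex"
    using that by (simp add: Q_def flip: subtopology_Times)
  have contr: "contractible Q" unfolding Q_def by (intro convex_imp_contractible convex_Times) auto
  have "continuous_on Q (\<lambda>z. pr (H z))"
    using to_on[OF continuous_map_compose[OF H(1) pr(1)]] by (simp add: o_def)
  moreover have "norm (pr (H z)) = 1" if z: "z \<in> Q" for z
  proof -
    obtain x \<tau> where "x \<in> earring" "\<tau> \<in> {0..1}" "H z = glue (x, \<tau>)"
      using HQ[OF z] by (auto simp: topspace_earring_torus)
    then show ?thesis by (simp add: pr(2))
  qed
  ultimately obtain s where s: "continuous_on Q s" "\<And>z. z \<in> Q \<Longrightarrow> pr (H z) = cis (2 * pi * s z)"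
    using circle_lift_contractible[OF _ contr] by blast
  have const: "h a = h b"
    if "S \<subseteq> Q" "connected S" "continuous_on Q h" "\<And>z. z \<in> S \<Longrightarrow> h z \<in> \<int>" "a \<in> S" "b \<in> S"
    for S and h :: "real \<times> real \<Rightarrow> real" and a b
    using Ints_valued_constant[of S h a b] that continuous_on_subset by blast
  have conn: "connected ({0..1::real} \<times> {v::real})" "connected ({v::real} \<times> {0..1::real})" for v
    by (auto intro!: connected_Times)
  have s_int: "s z \<in> \<int>" if "z \<in> Q" "H z = glue (x, 0)" "x \<in> earring" for z x
    using s(2)[OF that(1)] pr(2)[OF that(3), of 0] that(2) cis_2pi_eq_iff[of "s z" 0] by simp
  have edge: "s z \<in> \<int>" if "z \<in> Q" "fst z \<in> {0, 1} \<or> snd z \<in> {0, 1}" for z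
  proof -
    have "\<exists>x\<in>earring. H z = glue (x, 0)"
      using that H(2-5) subset_loop_in zero_in_earring
      by (cases z) (auto simp: Q_def earring_torus_base_eq)
    then show ?thesis using s_int that by blast
  qed
  have s00: "s z = s (0, 0)" if "z \<in> Q" "fst z \<in> {0, 1} \<or> snd z \<in> {0, 1}" for z
  proof -
    have bottom: "s (u, 0) = s (0, 0)" if "u \<in> {0..1}" for u
      by (rule const[OF _ conn(1)[of 0] s(1)]) (use that edge in \<open>auto simp: Q_def\<close>)
    have left: "s (0, u) = s (0, 0)" if "u \<in> {0..1}" for u
      by (rule const[OF _ conn(2)[of 0] s(1)]) (use that edge in \<open>auto simp: Q_def\<close>)
    have right: "s (1, u) = s (1, 0)" if "u \<in> {0..1}" for u
      by (rule const[OF _ conn(2)[of 1] s(1)]) (use that edge in \<open>auto simp: Q_def\<close>)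
    have top: "s (u, 1) = s (0, 1)" if "u \<in> {0..1}" for u
      by (rule const[OF _ conn(1)[of 1] s(1)]) (use that edge in \<open>auto simp: Q_def\<close>)
    show ?thesis
      using that bottom[of "fst z"] left[of "snd z"] right[of "snd z"] top[of "fst z"] bottom[of 1] left[of 1]
      by (cases z) (auto simp: Q_def)
  qed
  obtain k0 :: int where k0: "s (0, 0) = of_int k0" using edge[of "(0, 0)"] by (auto simp: Q_def elim: Ints_cases)
  have "n \<in> A \<longleftrightarrow> n \<in> B" for n
  proof -
    \<comment> \<open>The lifted height is \<open>k0\<close> on the whole boundary; this offset
      makes \<open>\<theta>\<close> there the angle of index \<open>n + 1\<close>.\<close>
    define j where "j = int (Suc n) - k0"
    define \<theta> where "\<theta> = (\<lambda>z. torus_angle j (H z, s z))"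
    have \<theta>_edge: "\<theta> z = angle (int (Suc n)) x"
      if "z \<in> Q" "fst z \<in> {0, 1} \<or> snd z \<in> {0, 1}" "H z = glue (x, 0)" "x \<in> earring" for z x
      using torus_angle_glue[OF that(4), of 0 j k0] s00[OF that(1,2)] that(3) k0 by (simp add: \<theta>_def j_def)
    have "continuous_map (prod_topology I01 I01) euclideanreal s"
      using s(1) by (simp add: Q_def flip: subtopology_Times)
    from continuous_map_compose[OF continuous_map_pairedI[OF H(1) this] continuous_torus_angle[of j]]
    have "continuous_on Q \<theta>" using to_on by (simp add: \<theta>_def o_def)
    moreover have "norm (\<theta> z) = 1" if z: "z \<in> Q" for z
    proof -
      obtain x \<tau> k where "x \<in> earring" "\<tau> \<in> {0..1}" "H z = glue (x, \<tau>)" "s z = \<tau> + of_int k"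
        by (rule torus_height_lift[where pr = pr, OF _ HQ[OF z] s(2)[OF z]]) (auto intro: pr(2))
      then show ?thesis by (simp add: \<theta>_def torus_angle_glue norm_angle)
    qed
    ultimately obtain c where c: "continuous_on Q c" "\<And>z. z \<in> Q \<Longrightarrow> \<theta> z = cis (2 * pi * c z)"
      using circle_lift_contractible[OF _ contr] by blast
    have c_int: "c (u, v) \<in> \<int>" if "u \<in> {0..1}" "v \<in> {0, 1}" for u v
    proof -
      have Q: "(u, v) \<in> Q" using that by (auto simp: Q_def)
      moreover have "H (u, v) = glue ((0, 0), 0)"
        using that H(4,5) by (auto simp: earring_torus_base_eq)
      ultimately have "\<theta> (u, v) = 1" using \<theta>_edge[of "(u, v)" "(0, 0)"] that zero_in_earring by auto
      then show ?thesis using c(2)[OF Q] cis_2pi_eq_iff[of "c (u, v)" 0] by simp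
    qed
    have bottom: "c (0, 0) = c (1, 0)"
      by (rule const[OF _ conn(1)[of 0] c(1)]) (use c_int in \<open>auto simp: Q_def\<close>)
    have top: "c (0, 1) = c (1, 1)"
      by (rule const[OF _ conn(1)[of 1] c(1)]) (use c_int in \<open>auto simp: Q_def\<close>)
    have winding: "c (u, 1) - c (u, 0) = (if n \<in> C then 1 else 0)"
      if u: "u \<in> {0, 1}" and C: "\<And>t. H (u, t) = glue (subset_loop C t, 0)" for u C
    proof -
      \<comment> \<open>If \<open>n \<in> C\<close>, then \<open>c\<close> and the clock lift the
        same circle-valued path on this side; otherwise \<open>c\<close> itself lifts a constant.
        Either way \<open>d\<close> is integer-valued there, hence constant.\<close>
      define d where "d = (\<lambda>z. c z - (if n \<in> C then subset_loop_time n (snd z) else 0))"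
      have "continuous_on Q d"
        unfolding d_def subset_loop_time_def by (cases "n \<in> C") (auto intro!: continuous_intros c(1))
      moreover have "d z \<in> \<int>" if "z \<in> {u} \<times> {0..1}" for z
      proof -
        obtain t where z: "z = (u, t)" "t \<in> {0..1}" using \<open>z \<in> {u} \<times> {0..1}\<close> by auto
        have zQ: "z \<in> Q" using z u by (auto simp: Q_def)
        have "\<theta> z = angle (int (Suc n)) (subset_loop C t)"
          using \<theta>_edge[OF zQ, of "subset_loop C t"] u z C subset_loop_in by auto
        then have "cis (2 * pi * c z) = (if n \<in> C then cis (2 * pi * subset_loop_time n t) else 1)"
          using c(2)[OF zQ] angle_subset_loop[OF z(2)] by simp
        then show ?thesis
          using cis_2pi_eq_iff[of "c z" "subset_loop_time n t"] cis_2pi_eq_iff[of "c z" 0] z(1)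
          by (auto simp: d_def split: if_splits)
      qed
      ultimately have "d (u, 1) = d (u, 0)"
        using u by (intro const[OF _ conn(2)[of u]]) (auto simp: Q_def)
      moreover have "subset_loop_time n 0 = 0" "subset_loop_time n 1 = 1"
      proof -
        show "subset_loop_time n 0 = 0"
          by (simp add: subset_loop_time_def min_def max_def mult_le_0_iff)
        have "(real n + 1) * (real n + 2) * (1 - 1 / (real n + 2)) = (real n + 1) * (real n + 1)"
          by (simp add: field_simps)
        moreover have "1 * 1 \<le> (real n + 1) * (real n + 1)" by (intro mult_mono) auto
        ultimately have "1 \<le> (real n + 1) * (real n + 2) * (1 - 1 / (real n + 2))" by linarith
        then show "subset_loop_time n 1 = 1"
          unfolding subset_loop_time_def by (simp only: min_absorb1 max_absorb2 zero_le_one)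
      qed
      ultimately show ?thesis by (auto simp: d_def split: if_splits)
    qed
    have "c (0, 1) - c (0, 0) = (if n \<in> A then 1 else 0)"
      by (rule winding) (simp_all add: H(2))
    moreover have "c (1, 1) - c (1, 0) = (if n \<in> B then 1 else 0)"
      by (rule winding) (simp_all add: H(3))
    ultimately have "(if n \<in> A then 1 else 0 :: real) = (if n \<in> B then 1 else 0)"
      using bottom top by simp
    then show ?thesis by (simp split: if_splits)
  qed
  then show ?thesis by blast
qed

lemma uncountable_spanier_group:
  "uncountable (spanier_group earring_torus earring_torus_base)"
proof
  assume "countable (spanier_group earring_torus earring_torus_base)"
  moreover define F where "F = (\<lambda>A. loop_class earring_torus earring_torus_base (\<lambda>t. glue (subset_loop A t, 0)))"
  moreover have "range F \<subseteq> spanier_group earring_torus earring_torus_base"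
    unfolding F_def
    by (intro image_subsetI earring_loop_in_spanier_group continuous_subset_loop subset_loop_in subset_loop_ends)
  ultimately have "countable (range F)" using countable_subset by blast
  moreover have "inj F" by (intro injI subset_loop_class_inject) (simp add: F_def)
  ultimately have "countable (UNIV :: nat set set)" by (rule countable_image_inj_on)
  then have "\<exists>f :: nat \<Rightarrow> nat set. f ` UNIV = Pow UNIV"
    by (intro exI[of _ "from_nat_into UNIV"]) (simp add: range_from_nat_into)
  then show False using Cantors_theorem by blast
qed

theorem corollary4p4:
  fixes Y :: "'y topology"
    and y :: 'y
    and p :: "'y \<Rightarrow> ((real \<times> real) \<times> real) set"
  assumes "universal_upl_object earring_torus earring_torus_base Y y p"
  shows "simply_connected_space Y \<and>
         uncountable (spanier_group earring_torus earring_torus_base)"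
  using universal_simply_connected[OF assms] uncountable_spanier_group by blast

end
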